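(* Let $(M,g_M)$ be a Riemannian manifold of dimension $m>1$. (a) Let $0<\rho\le+\infty$ and let $\mu,\lambda$ be positive functions of $r\in[0,\rho)$ (smooth as functions of $u$, with $r=\|u\|_M$, on the disk bundle $\mathcal{T}_{M,\rho}$). The almost-complex structure $J$ on $\mathcal{T}_{M,\rho}$ defined by $\mu,\lambda$ is integrable if and only if $M$ has constant sectional curvature $K$ and there is a constant $c_1>0$ such that $$\frac{\mu}{\lambda}(r)=\sqrt{c_1+Kr^2}\qquad\text{for all } r\in[0,\rho).$$ (b) If $M$ has constant sectional curvature $K$ and $\frac{\mu}{\lambda}(r)=\sqrt{c_1+Kr^2}$ with $c_1>0$, then the largest disk bundle $\mathcal{T}_{M,r_0}$ on which $J$ is defined and integrable is the one of radius $r_0=\sqrt{-c_1/K}$ if $K<0$, and $r_0=+\infty$ if $K\ge 0$.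
   Context: Let $\pi:\mathcal{T}_M\to M$ be the total space of the tangent bundle of $M$, $\|\cdot\|_M$ the norm of $g_M$, and $\mathcal{T}_{M,\rho}=\{u\in\mathcal{T}_M:\ \|u\|_M<\rho\}$ the open disk bundle of radius $\rho$ (so $\mathcal{T}_{M,+\infty}=\mathcal{T}_M$). The Levi-Civita connection $\nabla$ of $g_M$ induces a splitting $T\mathcal{T}_M=H^\nabla\oplus V$ into horizontal and vertical ($V=\ker\mathrm{d}\pi$) sub-bundles, each canonically isomorphic to $\pi^*TM$. For $u\in\mathcal{T}_M$ and $w\in T_{\pi(u)}M$, denote by $w^h\in H^\nabla_u$ and $w^v\in V_u$ the horizontal and vertical lifts. The almost-complex structure $J$ is defined at $u$ by $J(w^h)=\frac{\mu}{\lambda}w^v$, $J(w^v)=-\frac{\lambda}{\mu}w^h$, where $\mu,\lambda$ are evaluated at $r=\|u\|_M$. Integrable means that $J$ is induced by a complex-manifold structure (equivalently, its Nijenhuis tensor vanishes). *)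

theory Defs
  imports "HOL-Analysis.Analysis" "HOL-Library.Function_Algebras"
begin

section \<open>Smooth maps between Euclidean spaces\<close>

primrec Ck_on :: "nat \<Rightarrow> 'a::euclidean_space set \<Rightarrow> ('a \<Rightarrow> 'b::real_normed_vector) \<Rightarrow> bool" where
  "Ck_on 0 S f \<longleftrightarrow> continuous_on S f"
| "Ck_on (Suc k) S f \<longleftrightarrow>
     (\<forall>x\<in>S. f differentiable (at x)) \<and>
     (\<forall>v. Ck_on k S (\<lambda>x. frechet_derivative f (at x) v))"

text \<open>Only used for open \<open>S\<close>.\<close>
definition smooth_on :: "'a::euclidean_space set \<Rightarrow> ('a \<Rightarrow> 'b::real_normed_vector) \<Rightarrow> bool" where
  "smooth_on S f \<longleftrightarrow> (\<forall>k. Ck_on k S f)"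


section \<open>Smooth manifolds\<close>

text \<open>A chart is a pair of its domain and its coordinate map; the values of the coordinate map
  outside the domain are irrelevant. The underlying set of the manifold is the union of the chart
  domains, and its topology is the one induced by the atlas.\<close>

type_synonym ('a, 'e) chart = "'a set \<times> ('a \<Rightarrow> 'e)"

definition chart_inv :: "('a, 'e) chart \<Rightarrow> 'e \<Rightarrow> 'a" where
  "chart_inv c = inv_into (fst c) (snd c)"

definition points :: "('a, 'e) chart set \<Rightarrow> 'a set" where
  "points A = (\<Union>c\<in>A. fst c)"

definition charts_at :: "('a, 'e) chart set \<Rightarrow> 'a \<Rightarrow> ('a, 'e) chart set" where
  "charts_at A p = {c \<in> A. p \<in> fst c}"

definition atlas_open :: "('a, 'e::euclidean_space) chart set \<Rightarrow> 'a set \<Rightarrow> bool" where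
  "atlas_open A W \<longleftrightarrow> W \<subseteq> points A \<and> (\<forall>c\<in>A. open (snd c ` (fst c \<inter> W)))"

definition atlas_topology :: "('a, 'e::euclidean_space) chart set \<Rightarrow> 'a topology" where
  "atlas_topology A = topology (atlas_open A)"

definition smooth_manifold :: "('a, 'e::euclidean_space) chart set \<Rightarrow> bool" where
  "smooth_manifold A \<longleftrightarrow>
     (\<forall>c\<in>A. inj_on (snd c) (fst c)) \<and>
     (\<forall>c\<in>A. \<forall>d\<in>A. open (snd c ` (fst c \<inter> fst d)) \<and>
        smooth_on (snd c ` (fst c \<inter> fst d)) (snd d \<circ> chart_inv c)) \<and>
     Hausdorff_space (atlas_topology A) \<and> second_countable (atlas_topology A)"

lemma openin_atlas_topology:
  assumes "\<And>c. c \<in> A \<Longrightarrow> inj_on (snd c) (fst c)"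
  shows "openin (atlas_topology A) W \<longleftrightarrow> atlas_open A W"
proof -
  have "istopology (atlas_open A)"
    unfolding istopology_def
  proof (intro conjI allI impI)
    fix S T assume S: "atlas_open A S" and T: "atlas_open A T"
    have "snd c ` (fst c \<inter> (S \<inter> T)) = snd c ` (fst c \<inter> S) \<inter> snd c ` (fst c \<inter> T)"
      if "c \<in> A" for c
      using assms[OF that] by (auto simp: inj_on_def)
    with S T show "atlas_open A (S \<inter> T)"
      unfolding atlas_open_def by auto
  next
    fix K assume K: "\<forall>S\<in>K. atlas_open A S"
    have "snd c ` (fst c \<inter> \<Union>K) = (\<Union>S\<in>K. snd c ` (fst c \<inter> S))" for c :: "('a, 'b) chart"
      by auto
    with K show "atlas_open A (\<Union>K)"
      unfolding atlas_open_def by (auto intro!: open_UN)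
  qed
  then show ?thesis
    by (simp add: atlas_topology_def topology_inverse')
qed


section \<open>Tangent vectors, smooth functions and vector fields\<close>

text \<open>A tangent vector at \<open>p\<close> is the family of its components with respect to the charts around
  \<open>p\<close>, related by the derivatives of the transition maps (and set to \<open>0\<close> at all other charts).\<close>

type_synonym ('a, 'e) tvec = "('a, 'e) chart \<Rightarrow> 'e"

definition tangent_space :: "('a, 'e::euclidean_space) chart set \<Rightarrow> 'a \<Rightarrow> ('a, 'e) tvec set" where
  "tangent_space A p =
     {v. (\<forall>c\<in>charts_at A p. \<forall>d\<in>charts_at A p.
            v d = frechet_derivative (snd d \<circ> chart_inv c) (at (snd c p)) (v c)) \<and>
         (\<forall>c. c \<notin> charts_at A p \<longrightarrow> v c = 0)}"

text \<open>Sums and differences of tangent vectors and of vector fields are those of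
  \<open>HOL-Library.Function_Algebras\<close>.\<close>

abbreviation tscale :: "real \<Rightarrow> ('a, 'e::euclidean_space) tvec \<Rightarrow> ('a, 'e) tvec" (infixr "*\<^sub>T" 75) where
  "a *\<^sub>T v \<equiv> (\<lambda>c. a *\<^sub>R v c)"

definition smooth_function :: "('a, 'e::euclidean_space) chart set \<Rightarrow> 'a set \<Rightarrow> ('a \<Rightarrow> real) \<Rightarrow> bool" where
  "smooth_function A W f \<longleftrightarrow> (\<forall>c\<in>A. smooth_on (snd c ` (fst c \<inter> W)) (f \<circ> chart_inv c))"

definition smooth_field ::
    "('a, 'e::euclidean_space) chart set \<Rightarrow> 'a set \<Rightarrow> ('a \<Rightarrow> ('a, 'e) tvec) \<Rightarrow> bool" where
  "smooth_field A W X \<longleftrightarrow>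
     (\<forall>p\<in>W. X p \<in> tangent_space A p) \<and>
     (\<forall>c\<in>A. smooth_on (snd c ` (fst c \<inter> W)) (\<lambda>x. X (chart_inv c x) c))"

text \<open>The choice of the chart around \<open>p\<close> is immaterial in the next two definitions.\<close>

definition dir_deriv :: "('a, 'e::euclidean_space) chart set \<Rightarrow> ('a \<Rightarrow> real) \<Rightarrow> 'a \<Rightarrow> ('a, 'e) tvec \<Rightarrow> real" where
  "dir_deriv A f p v =
     (let c = (SOME c. c \<in> charts_at A p)
      in frechet_derivative (f \<circ> chart_inv c) (at (snd c p)) (v c))"

definition differential ::
    "('a, 'e::euclidean_space) chart set \<Rightarrow> ('b, 'f::euclidean_space) chart set \<Rightarrow>
     ('a \<Rightarrow> 'b) \<Rightarrow> 'a \<Rightarrow> ('a, 'e) tvec \<Rightarrow> ('b, 'f) tvec" where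
  "differential A B F p v = (\<lambda>d. if d \<in> charts_at B (F p)
     then let c = (SOME c. c \<in> charts_at A p)
          in frechet_derivative (snd d \<circ> F \<circ> chart_inv c) (at (snd c p)) (v c)
     else 0)"

definition velocity :: "('a, 'e::euclidean_space) chart set \<Rightarrow> (real \<Rightarrow> 'a) \<Rightarrow> real \<Rightarrow> ('a, 'e) tvec" where
  "velocity A \<gamma> t =
     (\<lambda>c. if c \<in> charts_at A (\<gamma> t) then vector_derivative (snd c \<circ> \<gamma>) (at t) else 0)"

text \<open>In a chart, \<open>[X, Y] = DY(X) - DX(Y)\<close>.\<close>
definition lie_bracket ::
    "('a, 'e::euclidean_space) chart set \<Rightarrow> ('a \<Rightarrow> ('a, 'e) tvec) \<Rightarrow> ('a \<Rightarrow> ('a, 'e) tvec) \<Rightarrow>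
     'a \<Rightarrow> ('a, 'e) tvec" where
  "lie_bracket A X Y p = (\<lambda>c. if c \<in> charts_at A p
     then frechet_derivative (\<lambda>x. Y (chart_inv c x) c) (at (snd c p)) (X p c)
        - frechet_derivative (\<lambda>x. X (chart_inv c x) c) (at (snd c p)) (Y p c)
     else 0)"


section \<open>Riemannian metrics, the Levi-Civita connection and curvature\<close>

definition riemannian_metric ::
    "('a, 'e::euclidean_space) chart set \<Rightarrow>
     ('a \<Rightarrow> ('a, 'e) tvec \<Rightarrow> ('a, 'e) tvec \<Rightarrow> real) \<Rightarrow> bool" where
  "riemannian_metric A g \<longleftrightarrow>
     (\<forall>p\<in>points A. \<forall>u\<in>tangent_space A p. \<forall>v\<in>tangent_space A p. \<forall>w\<in>tangent_space A p.
        g p v w = g p w v \<and>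
        (\<forall>a b. g p (a *\<^sub>T u + b *\<^sub>T v) w = a * g p u w + b * g p v w) \<and>
        (v \<noteq> 0 \<longrightarrow> g p v v > 0)) \<and>
     (\<forall>W X Y. atlas_open A W \<and> smooth_field A W X \<and> smooth_field A W Y \<longrightarrow>
        smooth_function A W (\<lambda>p. g p (X p) (Y p)))"

text \<open>\<open>nabla p v Y\<close> is the covariant derivative at \<open>p\<close>, in the direction \<open>v\<close>, of a vector field \<open>Y\<close> that
  is smooth on some neighbourhood of \<open>p\<close>; it depends only on the germ of \<open>Y\<close> at \<open>p\<close>.\<close>

type_synonym ('a, 'e) connection =
  "'a \<Rightarrow> ('a, 'e) tvec \<Rightarrow> ('a \<Rightarrow> ('a, 'e) tvec) \<Rightarrow> ('a, 'e) tvec"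

definition affine_connection ::
    "('a, 'e::euclidean_space) chart set \<Rightarrow> ('a, 'e) connection \<Rightarrow> bool" where
  "affine_connection A nabla \<longleftrightarrow>
     (\<forall>W Y. atlas_open A W \<and> smooth_field A W Y \<longrightarrow>
        (\<forall>p\<in>W. \<forall>v\<in>tangent_space A p. nabla p v Y \<in> tangent_space A p) \<and>
        (\<forall>p\<in>W. \<forall>v\<in>tangent_space A p. \<forall>w\<in>tangent_space A p. \<forall>a b.
           nabla p (a *\<^sub>T v + b *\<^sub>T w) Y = a *\<^sub>T nabla p v Y + b *\<^sub>T nabla p w Y) \<and>
        (\<forall>Z. smooth_field A W Z \<longrightarrow> (\<forall>p\<in>W. \<forall>v\<in>tangent_space A p.
           nabla p v (Y + Z) = nabla p v Y + nabla p v Z)) \<and>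
        (\<forall>f. smooth_function A W f \<longrightarrow> (\<forall>p\<in>W. \<forall>v\<in>tangent_space A p.
           nabla p v (\<lambda>q. f q *\<^sub>T Y q) = f p *\<^sub>T nabla p v Y + dir_deriv A f p v *\<^sub>T Y p)) \<and>
        (\<forall>Z. smooth_field A W Z \<and> (\<forall>q\<in>W. Y q = Z q) \<longrightarrow> (\<forall>p\<in>W. \<forall>v\<in>tangent_space A p.
           nabla p v Y = nabla p v Z)) \<and>
        (\<forall>X. smooth_field A W X \<longrightarrow> smooth_field A W (\<lambda>p. nabla p (X p) Y)))"

definition levi_civita ::
    "('a, 'e::euclidean_space) chart set \<Rightarrow>
     ('a \<Rightarrow> ('a, 'e) tvec \<Rightarrow> ('a, 'e) tvec \<Rightarrow> real) \<Rightarrow> ('a, 'e) connection \<Rightarrow> bool" where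
  "levi_civita A g nabla \<longleftrightarrow> affine_connection A nabla \<and>
     (\<forall>W X Y. atlas_open A W \<and> smooth_field A W X \<and> smooth_field A W Y \<longrightarrow>
        (\<forall>p\<in>W. nabla p (X p) Y - nabla p (Y p) X = lie_bracket A X Y p) \<and>
        (\<forall>p\<in>W. \<forall>v\<in>tangent_space A p.
           dir_deriv A (\<lambda>q. g q (X q) (Y q)) p v = g p (nabla p v X) (Y p) + g p (X p) (nabla p v Y)))"

definition curvature ::
    "('a, 'e::euclidean_space) chart set \<Rightarrow> ('a, 'e) connection \<Rightarrow>
     ('a \<Rightarrow> ('a, 'e) tvec) \<Rightarrow> ('a \<Rightarrow> ('a, 'e) tvec) \<Rightarrow> ('a \<Rightarrow> ('a, 'e) tvec) \<Rightarrow>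
     'a \<Rightarrow> ('a, 'e) tvec" where
  "curvature A nabla X Y Z p =
     nabla p (X p) (\<lambda>q. nabla q (Y q) Z) - nabla p (Y p) (\<lambda>q. nabla q (X q) Z) - nabla p (lie_bracket A X Y p) Z"

definition sectional_curvature ::
    "('a, 'e::euclidean_space) chart set \<Rightarrow>
     ('a \<Rightarrow> ('a, 'e) tvec \<Rightarrow> ('a, 'e) tvec \<Rightarrow> real) \<Rightarrow> ('a, 'e) connection \<Rightarrow>
     ('a \<Rightarrow> ('a, 'e) tvec) \<Rightarrow> ('a \<Rightarrow> ('a, 'e) tvec) \<Rightarrow> 'a \<Rightarrow> real" where
  "sectional_curvature A g nabla X Y p =
     g p (curvature A nabla X Y Y p) (X p) /
     (g p (X p) (X p) * g p (Y p) (Y p) - (g p (X p) (Y p))\<^sup>2)"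

definition constant_sectional_curvature ::
    "('a, 'e::euclidean_space) chart set \<Rightarrow>
     ('a \<Rightarrow> ('a, 'e) tvec \<Rightarrow> ('a, 'e) tvec \<Rightarrow> real) \<Rightarrow> ('a, 'e) connection \<Rightarrow> real \<Rightarrow> bool" where
  "constant_sectional_curvature A g nabla K \<longleftrightarrow>
     (\<forall>W X Y. atlas_open A W \<and> smooth_field A W X \<and> smooth_field A W Y \<longrightarrow>
        (\<forall>p\<in>W. (\<forall>a b. a *\<^sub>T X p + b *\<^sub>T Y p = 0 \<longrightarrow> a = 0 \<and> b = 0) \<longrightarrow>
           sectional_curvature A g nabla X Y p = K))"


section \<open>The tangent bundle\<close>

text \<open>The points of the tangent bundle are the pairs \<open>(p, v)\<close> with \<open>v\<close> tangent at \<open>p\<close>; its projection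
  is \<^const>\<open>fst\<close>.\<close>

definition tangent_chart ::
    "('a, 'e::euclidean_space) chart set \<Rightarrow> ('a, 'e) chart \<Rightarrow> ('a \<times> ('a, 'e) tvec, 'e \<times> 'e) chart" where
  "tangent_chart A c =
     ({(p, v). p \<in> fst c \<and> v \<in> tangent_space A p}, \<lambda>(p, v). (snd c p, v c))"

definition tangent_atlas ::
    "('a, 'e::euclidean_space) chart set \<Rightarrow> ('a \<times> ('a, 'e) tvec, 'e \<times> 'e) chart set" where
  "tangent_atlas A = tangent_chart A ` A"

definition fibre_norm ::
    "('a \<Rightarrow> ('a, 'e) tvec \<Rightarrow> ('a, 'e) tvec \<Rightarrow> real) \<Rightarrow> 'a \<times> ('a, 'e) tvec \<Rightarrow> real" where
  "fibre_norm g u = sqrt (g (fst u) (snd u) (snd u))"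

definition disk_bundle ::
    "('a, 'e::euclidean_space) chart set \<Rightarrow>
     ('a \<Rightarrow> ('a, 'e) tvec \<Rightarrow> ('a, 'e) tvec \<Rightarrow> real) \<Rightarrow> ereal \<Rightarrow> ('a \<times> ('a, 'e) tvec) set" where
  "disk_bundle A g \<rho> = {u \<in> points (tangent_atlas A). ereal (fibre_norm g u) < \<rho>}"

text \<open>The horizontal space at \<open>u = (p, v)\<close> consists of the vectors \<open>dY(w)\<close>, where \<open>Y\<close> is a local
  section with \<open>Y p = v\<close> that is parallel at \<open>p\<close> in the direction \<open>w\<close>.\<close>

definition horizontal_space ::
    "('a, 'e::euclidean_space) chart set \<Rightarrow> ('a, 'e) connection \<Rightarrow> 'a \<times> ('a, 'e) tvec \<Rightarrow>
     ('a \<times> ('a, 'e) tvec, 'e \<times> 'e) tvec set" where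
  "horizontal_space A nabla u =
     {differential A (tangent_atlas A) (\<lambda>q. (q, Y q)) (fst u) w | W Y w.
        atlas_open A W \<and> fst u \<in> W \<and> smooth_field A W Y \<and> Y (fst u) = snd u \<and>
        w \<in> tangent_space A (fst u) \<and> nabla (fst u) w Y = 0}"

definition horizontal_lift ::
    "('a, 'e::euclidean_space) chart set \<Rightarrow> ('a, 'e) connection \<Rightarrow> 'a \<times> ('a, 'e) tvec \<Rightarrow>
     ('a, 'e) tvec \<Rightarrow> ('a \<times> ('a, 'e) tvec, 'e \<times> 'e) tvec" where
  "horizontal_lift A nabla u w =
     (THE \<xi>. \<xi> \<in> horizontal_space A nabla u \<and> differential (tangent_atlas A) A fst u \<xi> = w)"

definition vertical_lift ::
    "('a, 'e::euclidean_space) chart set \<Rightarrow> 'a \<times> ('a, 'e) tvec \<Rightarrow>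
     ('a, 'e) tvec \<Rightarrow> ('a \<times> ('a, 'e) tvec, 'e \<times> 'e) tvec" where
  "vertical_lift A u w = velocity (tangent_atlas A) (\<lambda>t. (fst u, snd u + t *\<^sub>T w)) 0"


section \<open>Almost-complex structures\<close>

text \<open>The linear extension of \<open>J a\<^sup>h = (\<mu>/lam) a\<^sup>v\<close>, \<open>J b\<^sup>v = -(lam/\<mu>) b\<^sup>h\<close> along the
  splitting into horizontal and vertical vectors.\<close>

definition weighted_J ::
    "('a, 'e::euclidean_space) chart set \<Rightarrow>
     ('a \<Rightarrow> ('a, 'e) tvec \<Rightarrow> ('a, 'e) tvec \<Rightarrow> real) \<Rightarrow> ('a, 'e) connection \<Rightarrow>
     (real \<Rightarrow> real) \<Rightarrow> (real \<Rightarrow> real) \<Rightarrow> 'a \<times> ('a, 'e) tvec \<Rightarrow>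
     ('a \<times> ('a, 'e) tvec, 'e \<times> 'e) tvec \<Rightarrow> ('a \<times> ('a, 'e) tvec, 'e \<times> 'e) tvec" where
  "weighted_J A g nabla \<mu> lam u \<xi> = (let r = fibre_norm g u in
     THE \<eta>. \<exists>a\<in>tangent_space A (fst u). \<exists>b\<in>tangent_space A (fst u).
       \<xi> = horizontal_lift A nabla u a + vertical_lift A u b \<and>
       \<eta> = (\<mu> r / lam r) *\<^sub>T vertical_lift A u a - (lam r / \<mu> r) *\<^sub>T horizontal_lift A nabla u b)"

definition weight_functions ::
    "('a, 'e::euclidean_space) chart set \<Rightarrow>
     ('a \<Rightarrow> ('a, 'e) tvec \<Rightarrow> ('a, 'e) tvec \<Rightarrow> real) \<Rightarrow> ereal \<Rightarrow>
     (real \<Rightarrow> real) \<Rightarrow> (real \<Rightarrow> real) \<Rightarrow> bool" where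
  "weight_functions A g \<rho> \<mu> lam \<longleftrightarrow>
     (\<forall>r\<ge>0. ereal r < \<rho> \<longrightarrow> \<mu> r > 0 \<and> lam r > 0) \<and>
     smooth_function (tangent_atlas A) (disk_bundle A g \<rho>) (\<lambda>u. \<mu> (fibre_norm g u)) \<and>
     smooth_function (tangent_atlas A) (disk_bundle A g \<rho>) (\<lambda>u. lam (fibre_norm g u))"

definition nijenhuis ::
    "('a, 'e::euclidean_space) chart set \<Rightarrow> ('a \<Rightarrow> ('a, 'e) tvec \<Rightarrow> ('a, 'e) tvec) \<Rightarrow>
     ('a \<Rightarrow> ('a, 'e) tvec) \<Rightarrow> ('a \<Rightarrow> ('a, 'e) tvec) \<Rightarrow> 'a \<Rightarrow> ('a, 'e) tvec" where
  "nijenhuis A J X Y p =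
     lie_bracket A (\<lambda>q. J q (X q)) (\<lambda>q. J q (Y q)) p
     - J p (lie_bracket A (\<lambda>q. J q (X q)) Y p)
     - J p (lie_bracket A X (\<lambda>q. J q (Y q)) p)
     - lie_bracket A X Y p"

text \<open>Integrability of an almost-complex structure \<open>J\<close> on the open subset \<open>D\<close>, as vanishing of its
  Nijenhuis tensor, evaluated on all smooth local vector fields.\<close>

definition integrable_on_open ::
    "('a, 'e::euclidean_space) chart set \<Rightarrow> 'a set \<Rightarrow>
     ('a \<Rightarrow> ('a, 'e) tvec \<Rightarrow> ('a, 'e) tvec) \<Rightarrow> bool" where
  "integrable_on_open A D J \<longleftrightarrow>
     (\<forall>W X Y. atlas_open A W \<and> W \<subseteq> D \<and> smooth_field A W X \<and> smooth_field A W Y \<longrightarrow>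
        (\<forall>p\<in>W. nijenhuis A J X Y p = 0))"

text \<open>As \<open>\<mu> / lam\<close> is positive, the equation forces \<open>c + K * r\<^sup>2 > 0\<close> on the whole range of \<open>r\<close>.\<close>

definition weight_law ::
    "real \<Rightarrow> real \<Rightarrow> ereal \<Rightarrow> (real \<Rightarrow> real) \<Rightarrow> (real \<Rightarrow> real) \<Rightarrow> bool" where
  "weight_law K c \<rho> \<mu> lam \<longleftrightarrow> (\<forall>r\<ge>0. ereal r < \<rho> \<longrightarrow> \<mu> r / lam r = sqrt (c + K * r\<^sup>2))"

text \<open>The radii \<open>\<rho>\<close> such that the almost-complex structure with \<open>\<mu> / lam = sqrt (c + K * r\<^sup>2)\<close>,
  which depends on \<open>\<mu>\<close> and \<open>lam\<close> only through this quotient, is defined on the whole disk bundle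
  of radius \<open>\<rho>\<close> (i.e. it comes from some weight functions) and is integrable there.\<close>

definition integrable_radii ::
    "('a, 'e::euclidean_space) chart set \<Rightarrow>
     ('a \<Rightarrow> ('a, 'e) tvec \<Rightarrow> ('a, 'e) tvec \<Rightarrow> real) \<Rightarrow> ('a, 'e) connection \<Rightarrow>
     real \<Rightarrow> real \<Rightarrow> ereal set" where
  "integrable_radii A g nabla K c = {\<rho>. 0 < \<rho> \<and>
     (\<exists>\<mu> lam. weight_functions A g \<rho> \<mu> lam \<and> weight_law K c \<rho> \<mu> lam) \<and>
     (\<forall>\<mu> lam. weight_functions A g \<rho> \<mu> lam \<and> weight_law K c \<rho> \<mu> lam \<longrightarrow>
        integrable_on_open (tangent_atlas A) (disk_bundle A g \<rho>) (weighted_J A g nabla \<mu> lam))}"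

end

theory Submission
  imports Defs
begin

text \<open>In a chart, write \<open>F = \<mu> / lam\<close> as a function of \<open>(x, v)\<close>. The Nijenhuis tensor satisfies
  \<open>N(J X, Y) = - J N(X, Y)\<close> and \<open>J\<close> exchanges horizontal and vertical vectors, so \<open>N\<close> vanishes as soon
  as it vanishes on horizontal vectors. There the symmetry of the Christoffel symbols gives, for the
  vertical component,
  \<open>N(a\<^sup>h, b\<^sup>h) = (F (dF(a\<^sup>v) b - dF(b\<^sup>v) a) + R(a, b) v)\<^sup>v\<close>,
  while the horizontal component only involves \<open>dF(a\<^sup>h)\<close> and \<open>dF(b\<^sup>h)\<close>. If \<open>F\<^sup>2 = c + K \<bar>v\<bar>\<^sup>2\<close> then
  \<open>F dF(a\<^sup>v) = K g(a, v)\<close> and \<open>dF(a\<^sup>h) = 0\<close>, and the expression vanishes exactly when the curvature is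
  constantly \<open>K\<close>. Conversely, since \<open>R(a, b) v\<close> is linear in \<open>v\<close>, the equation along a single ray
  forces the derivative of \<open>F\<^sup>2\<close> to be linear in the radius; \<open>F\<close> is the same function of the radius
  at all points, hence so is the resulting curvature \<open>K\<close>.\<close>


section \<open>Calculus of smooth maps\<close>

text \<open>The obstacle is that the definitions are free of charts: \<open>horizontal_lift\<close>
  and \<open>weighted_J\<close> are definite descriptions, meaningful only on tangent vectors.
  Before \<open>J\<close> may be applied to a bracket, the bracket must be known to be tangent,
  which costs the transformation law of derivatives and the symmetry of second derivatives; only
  then can everything be computed in one chart of the tangent bundle. There \<open>N\<close> is
  tensorial, so fields with constant coefficients test integrability at every point. The two notions
  of curvature also differ: the hypothesis concerns sectional curvature of independent pairs, while
  \<open>N\<close> sees the whole tensor \<open>R(a, b) v\<close>. Polarisation with the first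
  Bianchi identity recovers the tensor. Dimension at least two is essential: if \<open>b\<close> is
  a multiple of \<open>a\<close>, both \<open>R(a, b) v\<close> and
  \<open>dF(a^v) b - dF(b^v) a\<close> vanish, so on a curve \<open>F\<close> would be
  unconstrained. The constant \<open>c\<close> is the value of \<open>F^2\<close> on the zero
  section, and for negative \<open>K\<close> the extremal radius is the zero of
  \<open>c + K r^2\<close>, where \<open>F\<close> would lose positivity.\<close>

lemma frechet_derivative_cong_open:
  assumes "open S" "x \<in> S" "\<And>y. y \<in> S \<Longrightarrow> f y = g y"
  shows "frechet_derivative f (at x) = frechet_derivative g (at x)"
proof -
  have "(f has_derivative D) (at x) \<longleftrightarrow> (g has_derivative D) (at x)" for D
    using assms has_derivative_transform_within_open[of f D x UNIV S g]
      has_derivative_transform_within_open[of g D x UNIV S f] by auto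
  then show ?thesis
    unfolding frechet_derivative_def by simp
qed

lemma frechet_derivative_eqI:
  "(f has_derivative f') (at x) \<Longrightarrow> frechet_derivative f (at x) = f'"
  using frechet_derivative_at by metis

lemma differentiable_cong_open:
  assumes "open S" "x \<in> S" "\<And>y. y \<in> S \<Longrightarrow> f y = g y" "f differentiable (at x)"
  shows "g differentiable (at x)"
  using assms(4) has_derivative_transform_within_open[of f _ x UNIV S g] assms(1-3)
  unfolding differentiable_def by auto

lemma Ck_on_cong:
  assumes "open S" "\<And>x. x \<in> S \<Longrightarrow> f x = g x" "Ck_on k S f"
  shows "Ck_on k S g"
  using assms(2,3)
proof (induction k arbitrary: f g)
  case 0
  then show ?case by (auto cong: continuous_on_cong)
next
  case (Suc k)
  have eq: "frechet_derivative f (at x) = frechet_derivative g (at x)" if "x \<in> S" for x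
    using frechet_derivative_cong_open[OF assms(1) that] Suc.prems(1) by blast
  have "Ck_on k S (\<lambda>x. frechet_derivative g (at x) v)" for v
    by (rule Suc.IH[of "\<lambda>x. frechet_derivative f (at x) v"]) (use eq Suc.prems in auto)
  moreover have "g differentiable (at x)" if "x \<in> S" for x
    using differentiable_cong_open[OF assms(1) that] Suc.prems that by auto
  ultimately show ?case by simp
qed

lemma Ck_on_SucD: "Ck_on (Suc k) S f \<Longrightarrow> Ck_on k S f"
proof (induction k arbitrary: f)
  case 0
  then show ?case
    by (simp add: continuous_at_imp_continuous_on differentiable_imp_continuous_within)
next
  case (Suc k)
  from Suc.prems show ?case
    by (subst Ck_on.simps, subst (asm) Ck_on.simps) (auto intro: Suc.IH)
qed

lemma Ck_on_subset: "Ck_on k S f \<Longrightarrow> T \<subseteq> S \<Longrightarrow> Ck_on k T f"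
  by (induction k arbitrary: f) (auto intro: continuous_on_subset)

lemma Ck_on_const: "Ck_on k S (\<lambda>x. c)"
  by (induction k arbitrary: c) auto

lemma Ck_on_bounded_linear:
  assumes "bounded_linear L" shows "Ck_on k S L"
proof (cases k)
  case 0
  then show ?thesis using assms by (simp add: linear_continuous_on)
next
  case (Suc n)
  have "frechet_derivative L (at x) = L" for x
    by (rule frechet_derivative_eqI) (rule bounded_linear_imp_has_derivative[OF assms])
  then show ?thesis
    using Suc assms by (auto simp: Ck_on_const bounded_linear_imp_differentiable)
qed

lemma Ck_on_add:
  assumes "open S" "Ck_on k S f" "Ck_on k S g" shows "Ck_on k S (\<lambda>x. f x + g x)"
  using assms(2,3)
proof (induction k arbitrary: f g)
  case 0
  then show ?case by (simp add: continuous_on_add)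
next
  case (Suc k)
  have "Ck_on k S (\<lambda>x. frechet_derivative (\<lambda>x. f x + g x) (at x) v)" for v
  proof (rule Ck_on_cong[OF assms(1)])
    show "Ck_on k S (\<lambda>x. frechet_derivative f (at x) v + frechet_derivative g (at x) v)"
      using Suc by auto
    fix x assume "x \<in> S"
    then have "((\<lambda>x. f x + g x) has_derivative
        (\<lambda>v. frechet_derivative f (at x) v + frechet_derivative g (at x) v)) (at x)"
      using Suc.prems by (auto intro!: has_derivative_add simp: frechet_derivative_works[symmetric])
    from frechet_derivative_eqI[OF this]
    show "frechet_derivative f (at x) v + frechet_derivative g (at x) v =
      frechet_derivative (\<lambda>x. f x + g x) (at x) v" by simp
  qed
  then show ?case using Suc.prems by auto
qed

text \<open>The derivative of a product contains the undifferentiated factors, so the inductive step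
  also uses them one order lower, through \<open>Ck_on_SucD\<close>.\<close>

lemma Ck_on_bilinear:
  assumes "open S" "bounded_bilinear B" "Ck_on k S f" "Ck_on k S g"
  shows "Ck_on k S (\<lambda>x. B (f x) (g x))"
  using assms(3,4)
proof (induction k arbitrary: f g)
  case 0
  then show ?case by (simp add: bounded_bilinear.continuous_on[OF assms(2)])
next
  case (Suc k)
  have der: "((\<lambda>x. B (f x) (g x)) has_derivative
        (\<lambda>v. B (f x) (frechet_derivative g (at x) v) + B (frechet_derivative f (at x) v) (g x))) (at x)"
    if "x \<in> S" for x
    using Suc.prems that
    by (auto intro!: bounded_bilinear.FDERIV[OF assms(2)] simp: frechet_derivative_works[symmetric])
  have "Ck_on k S (\<lambda>x. frechet_derivative (\<lambda>x. B (f x) (g x)) (at x) v)" for v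
  proof (rule Ck_on_cong[OF assms(1)])
    show "Ck_on k S (\<lambda>x. B (f x) (frechet_derivative g (at x) v) + B (frechet_derivative f (at x) v) (g x))"
      using Suc.prems Ck_on_SucD[OF Suc.prems(1)] Ck_on_SucD[OF Suc.prems(2)]
      by (intro Ck_on_add Suc.IH assms(1)) auto
  qed (simp add: frechet_derivative_eqI[OF der])
  then show ?case using der unfolding Ck_on.simps differentiable_def by blast
qed

lemma Ck_on_linear_compose:
  assumes "open S" "bounded_linear L" "Ck_on k S f"
  shows "Ck_on k S (\<lambda>x. L (f x))"
  using assms(3)
proof (induction k arbitrary: f)
  case 0
  then show ?case using bounded_linear.continuous_on[OF assms(2)] by auto
next
  case (Suc k)
  have der: "((\<lambda>x. L (f x)) has_derivative (\<lambda>v. L (frechet_derivative f (at x) v))) (at x)"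
    if "x \<in> S" for x
    using Suc.prems that
    by (auto intro!: bounded_linear.has_derivative[OF assms(2)] simp: frechet_derivative_works[symmetric])
  have "Ck_on k S (\<lambda>x. frechet_derivative (\<lambda>x. L (f x)) (at x) v)" for v
    by (rule Ck_on_cong[OF assms(1), of "\<lambda>x. L (frechet_derivative f (at x) v)"])
      (use Suc in \<open>auto simp: frechet_derivative_eqI[OF der]\<close>)
  then show ?case using der unfolding Ck_on.simps differentiable_def by blast
qed

lemma Ck_on_sum:
  assumes "open S" "\<And>i. i \<in> I \<Longrightarrow> Ck_on k S (f i)"
  shows "Ck_on k S (\<lambda>x. \<Sum>i\<in>I. f i x)"
  using assms(2)
  by (induction I rule: infinite_finite_induct) (auto intro: Ck_on_add assms(1) Ck_on_const)

lemma linear_basis_expansion: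
  fixes L :: "'a::euclidean_space \<Rightarrow> 'b::real_vector"
  assumes "linear L"
  shows "L v = (\<Sum>i\<in>Basis. (v \<bullet> i) *\<^sub>R L i)"
proof -
  have "L v = L (\<Sum>i\<in>Basis. (v \<bullet> i) *\<^sub>R i)" by (simp add: euclidean_representation)
  also have "\<dots> = (\<Sum>i\<in>Basis. (v \<bullet> i) *\<^sub>R L i)"
    using assms by (simp add: linear_sum linear_cmul)
  finally show ?thesis .
qed

text \<open>The chain rule evaluates the derivative of \<open>f\<close> in a direction that varies
  with \<open>x\<close>, whereas \<open>Ck_on\<close> speaks of fixed directions only. Expanding the
  direction in the basis leaves compositions of \<open>g\<close> with directional derivatives of
  \<open>f\<close>, to which the induction applies because \<open>f\<close> is arbitrary in
  it.\<close>

lemma Ck_on_compose: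
  fixes g :: "'a::euclidean_space \<Rightarrow> 'b::euclidean_space"
  assumes "open S" "open T" "g ` S \<subseteq> T" "Ck_on k T f" "Ck_on k S g"
  shows "Ck_on k S (\<lambda>x. f (g x))"
  using assms(4,5)
proof (induction k arbitrary: f)
  case 0
  then show ?case using continuous_on_compose2[of T f S g] assms(3) by auto
next
  case (Suc k)
  have der: "((\<lambda>x. f (g x)) has_derivative
      (\<lambda>v. frechet_derivative f (at (g x)) (frechet_derivative g (at x) v))) (at x)"
    if "x \<in> S" for x
  proof -
    have "(g has_derivative frechet_derivative g (at x)) (at x)"
      "(f has_derivative frechet_derivative f (at (g x))) (at (g x))"
      using Suc.prems that assms(3) by (auto simp: frechet_derivative_works[symmetric])
    from diff_chain_at[OF this] show ?thesis by (simp add: o_def)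
  qed
  have "Ck_on k S (\<lambda>x. frechet_derivative (\<lambda>x. f (g x)) (at x) v)" for v
  proof (rule Ck_on_cong[OF assms(1)])
    have "Ck_on k S (\<lambda>x. frechet_derivative f (at (g x)) i)" for i
      using Suc.prems Ck_on_SucD[OF Suc.prems(2)] by (intro Suc.IH) auto
    moreover have "Ck_on k S (\<lambda>x. frechet_derivative g (at x) v \<bullet> i)" for i
      using Suc.prems by (intro Ck_on_linear_compose[OF assms(1) bounded_linear_inner_left]) auto
    ultimately show "Ck_on k S (\<lambda>x. \<Sum>i\<in>Basis. (frechet_derivative g (at x) v \<bullet> i) *\<^sub>R frechet_derivative f (at (g x)) i)"
      by (intro Ck_on_sum assms(1) Ck_on_bilinear[OF _ bounded_bilinear_scaleR])
    fix x assume x: "x \<in> S"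
    have "linear (frechet_derivative f (at (g x)))"
      using Suc.prems x assms(3) by (auto intro!: linear_frechet_derivative)
    from linear_basis_expansion[OF this, symmetric]
    show "(\<Sum>i\<in>Basis. (frechet_derivative g (at x) v \<bullet> i) *\<^sub>R frechet_derivative f (at (g x)) i)
      = frechet_derivative (\<lambda>x. f (g x)) (at x) v"
      by (simp add: frechet_derivative_eqI[OF der[OF x]])
  qed
  then show ?case using der unfolding Ck_on.simps differentiable_def by blast
qed

section \<open>Smooth maps and their closure properties\<close>

lemma smooth_onD: "smooth_on S f \<Longrightarrow> x \<in> S \<Longrightarrow> f differentiable (at x)"
  unfolding smooth_on_def by (metis Ck_on.simps(2))

lemma smooth_on_has_derivative:
  "smooth_on S f \<Longrightarrow> x \<in> S \<Longrightarrow> (f has_derivative frechet_derivative f (at x)) (at x)"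
  using smooth_onD frechet_derivative_works by blast

lemma smooth_on_imp_continuous_on: "smooth_on S f \<Longrightarrow> continuous_on S f"
  unfolding smooth_on_def by (metis Ck_on.simps(1))

lemma smooth_on_frechet: "smooth_on S f \<Longrightarrow> smooth_on S (\<lambda>x. frechet_derivative f (at x) v)"
  unfolding smooth_on_def by (metis Ck_on.simps(2))

lemma smooth_on_cong: "open S \<Longrightarrow> (\<And>x. x \<in> S \<Longrightarrow> f x = g x) \<Longrightarrow> smooth_on S f \<Longrightarrow> smooth_on S g"
  unfolding smooth_on_def using Ck_on_cong by blast

lemma smooth_on_subset: "smooth_on S f \<Longrightarrow> T \<subseteq> S \<Longrightarrow> smooth_on T f"
  unfolding smooth_on_def using Ck_on_subset by blast

lemma smooth_on_const: "smooth_on S (\<lambda>x. c)"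
  unfolding smooth_on_def using Ck_on_const by blast

lemma smooth_on_bounded_linear: "bounded_linear L \<Longrightarrow> smooth_on S L"
  unfolding smooth_on_def using Ck_on_bounded_linear by blast

lemma smooth_on_ident: "smooth_on S (\<lambda>x. x)"
  by (rule smooth_on_bounded_linear) (rule bounded_linear_ident)

lemma smooth_on_add:
  "open S \<Longrightarrow> smooth_on S f \<Longrightarrow> smooth_on S g \<Longrightarrow> smooth_on S (\<lambda>x. f x + g x)"
  unfolding smooth_on_def using Ck_on_add by blast

lemma smooth_on_bilinear:
  "open S \<Longrightarrow> bounded_bilinear B \<Longrightarrow> smooth_on S f \<Longrightarrow> smooth_on S g \<Longrightarrow> smooth_on S (\<lambda>x. B (f x) (g x))"
  unfolding smooth_on_def using Ck_on_bilinear by blast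

lemma smooth_on_linear_compose:
  "open S \<Longrightarrow> bounded_linear L \<Longrightarrow> smooth_on S f \<Longrightarrow> smooth_on S (\<lambda>x. L (f x))"
  unfolding smooth_on_def using Ck_on_linear_compose by blast

lemma smooth_on_sum:
  "open S \<Longrightarrow> (\<And>i. i \<in> I \<Longrightarrow> smooth_on S (f i)) \<Longrightarrow> smooth_on S (\<lambda>x. \<Sum>i\<in>I. f i x)"
  by (simp add: smooth_on_def Ck_on_sum)

lemma smooth_on_compose:
  fixes g :: "'a::euclidean_space \<Rightarrow> 'b::euclidean_space"
  shows "open S \<Longrightarrow> open T \<Longrightarrow> g ` S \<subseteq> T \<Longrightarrow> smooth_on T f \<Longrightarrow> smooth_on S g \<Longrightarrow> smooth_on S (\<lambda>x. f (g x))"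
  by (simp add: smooth_on_def Ck_on_compose)

lemma smooth_on_scaleR:
  "open S \<Longrightarrow> smooth_on S f \<Longrightarrow> smooth_on S g \<Longrightarrow> smooth_on S (\<lambda>x. f x *\<^sub>R g x)"
  by (rule smooth_on_bilinear[OF _ bounded_bilinear_scaleR])

lemma smooth_on_inner_const:
  "open S \<Longrightarrow> smooth_on S f \<Longrightarrow> smooth_on S (\<lambda>x. f x \<bullet> a)"
  by (rule smooth_on_linear_compose[OF _ bounded_linear_inner_left])

lemma smooth_on_Pair:
  assumes "open S" "smooth_on S f" "smooth_on S g"
  shows "smooth_on S (\<lambda>x. (f x, g x))"
proof -
  have "smooth_on S (\<lambda>x. (f x, 0) + (0, g x))"
    using assms
    by (intro smooth_on_add smooth_on_linear_compose[of S "\<lambda>y. (y, 0)"]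
        smooth_on_linear_compose[of S "\<lambda>y. (0, y)"])
      (auto intro!: bounded_linear_Pair bounded_linear_ident bounded_linear_zero)
  then show ?thesis by simp
qed

text \<open>For the families used later, smoothness is known for constant arguments; expanding the
  argument in the basis gives a finite sum of smooth products.\<close>

lemma smooth_on_linear_family:
  assumes "open S" "\<And>x. x \<in> S \<Longrightarrow> linear (L x)" "\<And>i. i \<in> Basis \<Longrightarrow> smooth_on S (\<lambda>x. L x i)" "smooth_on S w"
  shows "smooth_on S (\<lambda>x. L x (w x))"
proof (rule smooth_on_cong[OF assms(1)])
  show "smooth_on S (\<lambda>x. \<Sum>i\<in>Basis. (w x \<bullet> i) *\<^sub>R L x i)"
    using assms by (intro smooth_on_sum smooth_on_scaleR smooth_on_inner_const)
  fix x assume "x \<in> S"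
  then show "(\<Sum>i\<in>Basis. (w x \<bullet> i) *\<^sub>R L x i) = L x (w x)"
    by (rule linear_basis_expansion[OF assms(2), symmetric])
qed

lemma smooth_on_frechet_apply:
  assumes "open S" "smooth_on S f" "smooth_on S w"
  shows "smooth_on S (\<lambda>x. frechet_derivative f (at x) (w x))"
  by (rule smooth_on_linear_family[OF assms(1) _ _ assms(3)])
    (auto intro: linear_frechet_derivative smooth_onD[OF assms(2)] smooth_on_frechet[OF assms(2)])

text \<open>The derivative of \<open>inverse\<close> is again a product of copies of
  \<open>inverse\<close>, so the induction on the order of differentiability closes on
  itself.\<close>

lemma smooth_on_inverse:
  fixes f :: "'a::euclidean_space \<Rightarrow> real"
  assumes "open S" "smooth_on S f" "\<And>x. x \<in> S \<Longrightarrow> f x \<noteq> 0"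
  shows "smooth_on S (\<lambda>x. inverse (f x))"
proof -
  have op: "open (- {0::real})" by auto
  have "Ck_on k (- {0}) (inverse :: real \<Rightarrow> real)" for k
  proof (induction k)
    case 0
    then show ?case by (auto intro!: continuous_intros)
  next
    case (Suc k)
    have der: "(inverse has_derivative (\<lambda>v. - (inverse x * v * inverse x))) (at x)" if "x \<noteq> 0" for x :: real
      using that by (rule has_derivative_inverse')
    have "Ck_on k (- {0}) (\<lambda>x::real. frechet_derivative inverse (at x) v)" for v :: real
    proof (rule Ck_on_cong[OF op])
      show "Ck_on k (- {0}) (\<lambda>x::real. (inverse x * inverse x) * (- v))"
        by (intro Ck_on_bilinear[OF op bounded_bilinear_mult] Suc Ck_on_const)
    qed (simp add: frechet_derivative_eqI[OF der])
    then show ?case using der by (auto simp: differentiable_def)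
  qed
  then have "smooth_on (- {0}) (inverse :: real \<Rightarrow> real)" by (simp add: smooth_on_def)
  from smooth_on_compose[OF assms(1) op _ this assms(2)] assms(3) show ?thesis
    by (metis ComplI singletonD image_subsetI)
qed

lemma smooth_on_mult:
  fixes f g :: "'a::euclidean_space \<Rightarrow> real"
  shows "open S \<Longrightarrow> smooth_on S f \<Longrightarrow> smooth_on S g \<Longrightarrow> smooth_on S (\<lambda>x. f x * g x)"
  by (rule smooth_on_bilinear[OF _ bounded_bilinear_mult])

text \<open>The derivative of \<open>sqrt\<close> is a multiple of \<open>inverse\<close> composed
  with \<open>sqrt\<close>, so the induction uses the same function one order lower.\<close>

lemma smooth_on_sqrt:
  fixes f :: "'a::euclidean_space \<Rightarrow> real"
  assumes "open S" "smooth_on S f" "\<And>x. x \<in> S \<Longrightarrow> f x > 0"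
  shows "smooth_on S (\<lambda>x. sqrt (f x))"
proof -
  have op: "open {0::real<..}" by auto
  have "Ck_on k {0<..} sqrt" for k
  proof (induction k)
    case 0
    then show ?case by (auto intro!: continuous_intros)
  next
    case (Suc k)
    have der: "(sqrt has_derivative (\<lambda>v. v * (inverse (sqrt x) / 2))) (at x)" if "x > 0" for x :: real
      using DERIV_real_sqrt[OF that] by (auto simp: has_field_derivative_def mult.commute fun_eq_iff intro: has_derivative_eq_rhs)
    have "Ck_on k {0<..} (\<lambda>x::real. frechet_derivative sqrt (at x) v)" for v :: real
    proof (rule Ck_on_cong[OF op])
      have "Ck_on k (- {0}) (inverse :: real \<Rightarrow> real)"
        using smooth_on_inverse[of "- {0}" "\<lambda>x. x"] by (simp add: smooth_on_ident smooth_on_def open_Compl)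
      then have "Ck_on k {0<..} (\<lambda>x. inverse (sqrt x))"
        by (intro Ck_on_compose[OF op _ _ _ Suc, of "- {0}"]) auto
      then show "Ck_on k {0<..} (\<lambda>x. inverse (sqrt x) * (v / 2))"
        by (intro Ck_on_bilinear[OF op bounded_bilinear_mult] Ck_on_const)
    qed (simp add: frechet_derivative_eqI[OF der])
    then show ?case using der by (auto simp: differentiable_def)
  qed
  then have "smooth_on {0<..} sqrt" by (simp add: smooth_on_def)
  from smooth_on_compose[OF assms(1) op _ this assms(2)] assms(3) show ?thesis
    by (metis greaterThan_iff image_subsetI)
qed

section \<open>Symmetry of second derivatives\<close>

abbreviation fd :: "('a::real_normed_vector \<Rightarrow> 'b::real_normed_vector) \<Rightarrow> 'a \<Rightarrow> 'a \<Rightarrow> 'b" where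
  "fd f x \<equiv> frechet_derivative f (at x)"

text \<open>Two applications of the mean value theorem, along \<open>a\<close> and then along
  \<open>b\<close>. The left side is symmetric in \<open>a\<close> and \<open>b\<close>, while the
  right side is a mixed derivative at an unknown point of the parallelogram; this is the lever for
  the symmetry of mixed derivatives.\<close>

lemma second_difference:
  fixes f :: "'a::euclidean_space \<Rightarrow> real"
  assumes f: "smooth_on S f" and t: "0 < t"
    and sub: "\<And>s r. s \<in> {0..t} \<Longrightarrow> r \<in> {0..t} \<Longrightarrow> x + s *\<^sub>R a + r *\<^sub>R b \<in> S"
  shows "\<exists>s\<in>{0..t}. \<exists>r\<in>{0..t}.
    f (x + t *\<^sub>R a + t *\<^sub>R b) - f (x + t *\<^sub>R a) - f (x + t *\<^sub>R b) + f x
      = t * (t * fd (\<lambda>y. fd f y a) (x + s *\<^sub>R a + r *\<^sub>R b) b)"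
proof -
  have chain: "((\<lambda>s. h (y + s *\<^sub>R c)) has_derivative (\<lambda>s. s * fd h (y + s0 *\<^sub>R c) c)) (at s0 within T)"
    if h: "smooth_on S h" and "y + s0 *\<^sub>R c \<in> S" for h :: "'a \<Rightarrow> real" and y c s0 T
  proof -
    have "((\<lambda>s. h (y + s *\<^sub>R c)) has_derivative (\<lambda>s. fd h (y + s0 *\<^sub>R c) (s *\<^sub>R c))) (at s0)"
    proof (rule has_derivative_compose[of "\<lambda>s. y + s *\<^sub>R c" "\<lambda>s. s *\<^sub>R c" s0 UNIV h "fd h (y + s0 *\<^sub>R c)"])
      show "((\<lambda>s. y + s *\<^sub>R c) has_derivative (\<lambda>s. s *\<^sub>R c)) (at s0)"
        by (auto intro!: derivative_eq_intros)
    qed (rule smooth_on_has_derivative[OF h that(2)])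
    moreover have "linear (fd h (y + s0 *\<^sub>R c))"
      using smooth_onD[OF h that(2)] by (rule linear_frechet_derivative)
    ultimately show ?thesis
      by (simp add: linear_cmul has_derivative_at_withinI)
  qed
  let ?g = "\<lambda>y. fd f y a"
  have 0: "0 \<in> {0..t}" "t \<in> {0..t}" using t by auto
  define \<phi> where "\<phi> = (\<lambda>s. f (x + t *\<^sub>R b + s *\<^sub>R a) - f (x + s *\<^sub>R a))"
  have "(\<phi> has_derivative (\<lambda>h. h * ?g (x + t *\<^sub>R b + s *\<^sub>R a) - h * ?g (x + s *\<^sub>R a))) (at s within {0..t})"
    if "0 \<le> s" "s \<le> t" for s
  proof -
    have "s \<in> {0..t}" using that by simp
    then have "x + t *\<^sub>R b + s *\<^sub>R a \<in> S" "x + s *\<^sub>R a \<in> S"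
      using sub[of s t] sub[of s 0] 0 by (simp_all add: add_ac)
    then show ?thesis
      unfolding \<phi>_def by (intro has_derivative_diff chain[OF f])
  qed
  from mvt_simple[OF t this] obtain s where s: "s \<in> {0<..<t}" and
    eq: "\<phi> t - \<phi> 0 = (t - 0) * ?g (x + t *\<^sub>R b + s *\<^sub>R a) - (t - 0) * ?g (x + s *\<^sub>R a)"
    by blast
  have s': "s \<in> {0..t}" using s by auto
  define \<psi> where "\<psi> = (\<lambda>r. ?g (x + s *\<^sub>R a + r *\<^sub>R b))"
  have "(\<psi> has_derivative (\<lambda>h. h * fd ?g (x + s *\<^sub>R a + r *\<^sub>R b) b)) (at r within {0..t})"
    if "0 \<le> r" "r \<le> t" for r
    unfolding \<psi>_def using sub[OF s', of r] that by (intro chain[OF smooth_on_frechet[OF f]]) simp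
  from mvt_simple[OF t this] obtain r where r: "r \<in> {0<..<t}" and
    eq2: "\<psi> t - \<psi> 0 = (t - 0) * fd ?g (x + s *\<^sub>R a + r *\<^sub>R b) b"
    by blast
  have "f (x + t *\<^sub>R a + t *\<^sub>R b) - f (x + t *\<^sub>R a) - f (x + t *\<^sub>R b) + f x
      = t * (\<psi> t - \<psi> 0)"
    using eq by (simp add: \<phi>_def \<psi>_def algebra_simps)
  then show ?thesis using s' r eq2 by (intro bexI[of _ s] bexI[of _ r]) auto
qed

text \<open>Evaluating the same second difference in both orders gives two points of one small
  parallelogram at which the two mixed derivatives agree. If they differed at \<open>x\<close>,
  continuity would keep them apart on a ball around \<open>x\<close>.\<close>

lemma smooth_on_second_derivative_symmetric_real:
  fixes f :: "'a::euclidean_space \<Rightarrow> real"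
  assumes S: "open S" "x \<in> S" and f: "smooth_on S f"
  shows "fd (\<lambda>y. fd f y a) x b = fd (\<lambda>y. fd f y b) x a"
proof (rule ccontr)
  define P where "P = (\<lambda>y. fd (\<lambda>y. fd f y a) y b)"
  define Q where "Q = (\<lambda>y. fd (\<lambda>y. fd f y b) y a)"
  assume "\<not> ?thesis"
  then have e: "\<bar>P x - Q x\<bar> / 2 > 0" by (simp add: P_def Q_def)
  have "continuous_on S P" "continuous_on S Q"
    unfolding P_def Q_def
    by (intro smooth_on_imp_continuous_on smooth_on_frechet f)+
  then obtain d1 d2 where d: "d1 > 0" "d2 > 0"
    and d1: "\<And>y. y \<in> S \<Longrightarrow> dist y x < d1 \<Longrightarrow> dist (P y) (P x) < \<bar>P x - Q x\<bar> / 2"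
    and d2: "\<And>y. y \<in> S \<Longrightarrow> dist y x < d2 \<Longrightarrow> dist (Q y) (Q x) < \<bar>P x - Q x\<bar> / 2"
    using S(2) e unfolding continuous_on_iff by metis
  obtain d3 where d3: "d3 > 0" "ball x d3 \<subseteq> S" using S open_contains_ball by blast
  define d where "d = min d1 (min d2 d3)"
  \<comment> \<open>This choice keeps the whole parallelogram within distance \<open>d\<close> of
    \<open>x\<close>; the summand \<open>1\<close> keeps the denominator positive when
    \<open>a\<close> and \<open>b\<close> are both zero.\<close>
  define t where "t = d / (2 * (norm a + norm b + 1))"
  have n: "norm a + norm b + 1 > 0" by (simp add: add_nonneg_pos)
  have d0: "d > 0" using d d3 by (simp add: d_def)
  have t: "t > 0" using d0 n by (simp add: t_def)
  have near: "dist (x + s *\<^sub>R a + r *\<^sub>R b) x < d" if "s \<in> {0..t}" "r \<in> {0..t}" for s r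
  proof -
    have "dist (x + s *\<^sub>R a + r *\<^sub>R b) x = norm (s *\<^sub>R a + r *\<^sub>R b)"
      by (simp add: dist_norm add.assoc)
    also have "\<dots> \<le> s * norm a + r * norm b"
      using that norm_triangle_ineq[of "s *\<^sub>R a" "r *\<^sub>R b"] by simp
    also have "\<dots> \<le> t * norm a + t * norm b"
      using that by (intro add_mono mult_right_mono) auto
    also have "\<dots> < t * (2 * (norm a + norm b + 1))"
    proof -
      have "0 < t * (norm a + norm b + 2)" using t by (intro mult_pos_pos add_nonneg_pos) auto
      then show ?thesis by (simp add: algebra_simps)
    qed
    also have "\<dots> = d" using n by (simp add: t_def)
    finally show ?thesis .
  qed
  have sub: "x + s *\<^sub>R a + r *\<^sub>R b \<in> S" "x + r *\<^sub>R b + s *\<^sub>R a \<in> S"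
    if "s \<in> {0..t}" "r \<in> {0..t}" for s r
    using near[OF that] d3(2) by (auto simp: d_def dist_commute add_ac)
  obtain s r where sr: "s \<in> {0..t}" "r \<in> {0..t}" and
    1: "f (x + t *\<^sub>R a + t *\<^sub>R b) - f (x + t *\<^sub>R a) - f (x + t *\<^sub>R b) + f x
      = t * (t * P (x + s *\<^sub>R a + r *\<^sub>R b))"
    using second_difference[OF f t sub(1)] unfolding P_def by blast
  obtain s' r' where sr': "s' \<in> {0..t}" "r' \<in> {0..t}" and
    2: "f (x + t *\<^sub>R b + t *\<^sub>R a) - f (x + t *\<^sub>R b) - f (x + t *\<^sub>R a) + f x
      = t * (t * Q (x + s' *\<^sub>R b + r' *\<^sub>R a))"
    using second_difference[OF f t sub(2)] unfolding Q_def by blast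
  have "t * (t * P (x + s *\<^sub>R a + r *\<^sub>R b)) = t * (t * Q (x + r' *\<^sub>R a + s' *\<^sub>R b))"
    using 1 2 by (simp add: algebra_simps)
  then have "P (x + s *\<^sub>R a + r *\<^sub>R b) = Q (x + r' *\<^sub>R a + s' *\<^sub>R b)"
    using t by simp
  moreover have "dist (P (x + s *\<^sub>R a + r *\<^sub>R b)) (P x) < \<bar>P x - Q x\<bar> / 2"
    using near[OF sr] sub(1)[OF sr] by (intro d1) (auto simp: d_def)
  moreover have "dist (Q (x + r' *\<^sub>R a + s' *\<^sub>R b)) (Q x) < \<bar>P x - Q x\<bar> / 2"
    using near[OF sr'(2,1)] sub(1)[OF sr'(2,1)] by (intro d2) (auto simp: d_def)
  ultimately show False
    unfolding dist_real_def by (smt (verit) field_sum_of_halves)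
qed

lemma fd_linear_compose:
  assumes "bounded_linear L" "f differentiable (at x)"
  shows "fd (\<lambda>y. L (f y)) x v = L (fd f x v)"
proof -
  have "((\<lambda>y. L (f y)) has_derivative (\<lambda>v. L (fd f x v))) (at x)"
    using assms(2) by (intro bounded_linear.has_derivative[OF assms(1)]) (simp add: frechet_derivative_works)
  from frechet_derivative_eqI[OF this] show ?thesis by simp
qed

lemma smooth_on_second_derivative_symmetric:
  fixes f :: "'a::euclidean_space \<Rightarrow> 'b::euclidean_space"
  assumes S: "open S" "x \<in> S" and f: "smooth_on S f"
  shows "fd (\<lambda>y. fd f y a) x b = fd (\<lambda>y. fd f y b) x a"
proof (rule euclidean_eqI)
  fix i :: 'b assume "i \<in> Basis"
  have *: "fd (\<lambda>y. fd f y u) x w \<bullet> i = fd (\<lambda>y. fd (\<lambda>z. f z \<bullet> i) y u) x w" for u w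
  proof -
    have "fd (\<lambda>y. fd f y u) x w \<bullet> i = fd (\<lambda>y. fd f y u \<bullet> i) x w"
      using fd_linear_compose[OF bounded_linear_inner_left[of i] smooth_onD[OF smooth_on_frechet[OF f] S(2)]] by simp
    also have "fd (\<lambda>y. fd f y u \<bullet> i) x = fd (\<lambda>y. fd (\<lambda>z. f z \<bullet> i) y u) x"
      by (rule frechet_derivative_cong_open[OF S])
        (simp add: fd_linear_compose[OF bounded_linear_inner_left smooth_onD[OF f]])
    finally show ?thesis .
  qed
  show "fd (\<lambda>y. fd f y a) x b \<bullet> i = fd (\<lambda>y. fd f y b) x a \<bullet> i"
    unfolding * by (rule smooth_on_second_derivative_symmetric_real[OF S smooth_on_inner_const[OF S(1) f]])
qed

text \<open>A product rule that asks for differentiability of \<open>L\<close> at each fixed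
  argument only, the form in which it is available for Christoffel symbols and for \<open>J\<close>.
  The basis expansion reduces it to finitely many products.\<close>

lemma has_derivative_linear_family:
  fixes L :: "'z::real_normed_vector \<Rightarrow> 'a::euclidean_space \<Rightarrow> 'b::real_normed_vector"
  assumes S: "open S" "z \<in> S"
    and lin: "\<And>y. y \<in> S \<Longrightarrow> linear (L y)"
    and diff: "\<And>a. (\<lambda>y. L y a) differentiable (at z)"
    and w: "(w has_derivative w') (at z)"
  shows "((\<lambda>y. L y (w y)) has_derivative (\<lambda>h. fd (\<lambda>y. L y (w z)) z h + L z (w' h))) (at z)"
proof -
  have d: "((\<lambda>y. L y a) has_derivative fd (\<lambda>y. L y a) z) (at z)" for a
    using diff frechet_derivative_works by blast
  have "((\<lambda>y. \<Sum>i\<in>Basis. (w y \<bullet> i) *\<^sub>R L y i) has_derivative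
      (\<lambda>h. \<Sum>i\<in>Basis. (w z \<bullet> i) *\<^sub>R fd (\<lambda>y. L y i) z h + (w' h \<bullet> i) *\<^sub>R L z i)) (at z)"
    by (intro has_derivative_sum has_derivative_scaleR has_derivative_inner_left w d)
  moreover have "((\<lambda>y. \<Sum>i\<in>Basis. (w z \<bullet> i) *\<^sub>R L y i) has_derivative
      (\<lambda>h. \<Sum>i\<in>Basis. (w z \<bullet> i) *\<^sub>R fd (\<lambda>y. L y i) z h)) (at z)"
    by (intro has_derivative_sum has_derivative_scaleR_right d)
  then have "((\<lambda>y. L y (w z)) has_derivative
      (\<lambda>h. \<Sum>i\<in>Basis. (w z \<bullet> i) *\<^sub>R fd (\<lambda>y. L y i) z h)) (at z)"
    by (rule has_derivative_transform_within_open[OF _ S])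
      (rule linear_basis_expansion[OF lin, symmetric])
  from frechet_derivative_eqI[OF this]
  have "fd (\<lambda>y. L y (w z)) z h = (\<Sum>i\<in>Basis. (w z \<bullet> i) *\<^sub>R fd (\<lambda>y. L y i) z h)" for h
    by simp
  moreover have "L z (w' h) = (\<Sum>i\<in>Basis. (w' h \<bullet> i) *\<^sub>R L z i)" for h
    by (rule linear_basis_expansion[OF lin[OF S(2)]])
  ultimately have "((\<lambda>y. \<Sum>i\<in>Basis. (w y \<bullet> i) *\<^sub>R L y i) has_derivative
      (\<lambda>h. fd (\<lambda>y. L y (w z)) z h + L z (w' h))) (at z)"
    by (simp add: sum.distrib)
  then show ?thesis
    by (rule has_derivative_transform_within_open[OF _ S])
      (rule linear_basis_expansion[OF lin, symmetric])
qed

lemma linear_fd_linear_family: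
  fixes L :: "'z::real_normed_vector \<Rightarrow> 'a::real_vector \<Rightarrow> 'b::real_normed_vector"
  assumes S: "open S" "z \<in> S"
    and lin: "\<And>y. y \<in> S \<Longrightarrow> linear (L y)"
    and diff: "\<And>a. (\<lambda>y. L y a) differentiable (at z)"
  shows "linear (\<lambda>a. fd (\<lambda>y. L y a) z h)"
proof (rule linearI)
  have d: "((\<lambda>y. L y a) has_derivative fd (\<lambda>y. L y a) z) (at z)" for a
    using diff frechet_derivative_works by blast
  fix a b c
  have "((\<lambda>y. L y (a + b)) has_derivative (\<lambda>h. fd (\<lambda>y. L y a) z h + fd (\<lambda>y. L y b) z h)) (at z)"
    by (rule has_derivative_transform_within_open[OF has_derivative_add[OF d d] S])
      (simp add: linear_add[OF lin])
  from frechet_derivative_eqI[OF this]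
  show "fd (\<lambda>y. L y (a + b)) z h = fd (\<lambda>y. L y a) z h + fd (\<lambda>y. L y b) z h" by simp
  have "((\<lambda>y. L y (c *\<^sub>R b)) has_derivative (\<lambda>h. c *\<^sub>R fd (\<lambda>y. L y b) z h)) (at z)"
    by (rule has_derivative_transform_within_open[OF has_derivative_scaleR_right[OF d] S])
      (simp add: linear_cmul[OF lin])
  from frechet_derivative_eqI[OF this]
  show "fd (\<lambda>y. L y (c *\<^sub>R b)) z h = c *\<^sub>R fd (\<lambda>y. L y b) z h" by simp
qed

lemma bilinear_linear_left: "bilinear B \<Longrightarrow> linear (\<lambda>a. B a b)"
  and bilinear_linear_right: "bilinear B \<Longrightarrow> linear (B a)"
  by (auto simp: bilinear_def)

lemma has_derivative_bilinear_family:
  fixes B :: "'z::real_normed_vector \<Rightarrow> 'a::euclidean_space \<Rightarrow> 'b::euclidean_space \<Rightarrow> 'c::real_normed_vector"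
  assumes S: "open S" "z \<in> S"
    and bil: "\<And>y. y \<in> S \<Longrightarrow> bilinear (B y)"
    and diff: "\<And>a b. (\<lambda>y. B y a b) differentiable (at z)"
    and f: "(f has_derivative f') (at z)" and g: "(g has_derivative g') (at z)"
  shows "((\<lambda>y. B y (f y) (g y)) has_derivative
    (\<lambda>h. fd (\<lambda>y. B y (f z) (g z)) z h + B z (f' h) (g z) + B z (f z) (g' h))) (at z)"
proof -
  have 1: "((\<lambda>y. B y (f y) b) has_derivative (\<lambda>h. fd (\<lambda>y. B y (f z) b) z h + B z (f' h) b)) (at z)" for b
    using bil diff by (intro has_derivative_linear_family[OF S _ _ f]) (auto intro: bilinear_linear_left)
  have "((\<lambda>y. B y (f y) (g y)) has_derivative
    (\<lambda>h. fd (\<lambda>y. B y (f y) (g z)) z h + B z (f z) (g' h))) (at z)"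
    using bil 1 by (intro has_derivative_linear_family[OF S _ _ g]) (auto intro: bilinear_linear_right simp: differentiable_def)
  then show ?thesis by (simp add: frechet_derivative_eqI[OF 1])
qed

lemma smooth_on_bilinear_family:
  fixes B :: "'z::euclidean_space \<Rightarrow> 'a::euclidean_space \<Rightarrow> 'b::euclidean_space \<Rightarrow> 'c::real_normed_vector"
  assumes S: "open S" and bil: "\<And>y. y \<in> S \<Longrightarrow> bilinear (B y)"
    and sm: "\<And>a b. smooth_on S (\<lambda>y. B y a b)" and f: "smooth_on S f" and g: "smooth_on S g"
  shows "smooth_on S (\<lambda>y. B y (f y) (g y))"
proof (rule smooth_on_linear_family[OF S _ _ g])
  show "smooth_on S (\<lambda>y. B y (f y) b)" for b
    by (rule smooth_on_linear_family[OF S _ sm f]) (rule bilinear_linear_left[OF bil])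
qed (rule bilinear_linear_right[OF bil])


section \<open>Riemannian curvature in a chart\<close>

text \<open>The classical fact that sectional curvature determines the curvature tensor. Polarising
  \<open>zero\<close> in the outer and then in the inner slots makes \<open>B\<close> alternating in
  its first three arguments; the three terms of the Bianchi identity are then equal, so three times
  \<open>B\<close> vanishes.\<close>

lemma curvature_like_form_eq_0:
  fixes B :: "'a::ab_group_add \<Rightarrow> 'a \<Rightarrow> 'a \<Rightarrow> 'a \<Rightarrow> real"
  assumes add1: "\<And>a a' b c d. B (a + a') b c d = B a b c d + B a' b c d"
    and add3: "\<And>a b c c' d. B a b (c + c') d = B a b c d + B a b c' d"
    and anti12: "\<And>a b c d. B b a c d = - B a b c d"
    and anti34: "\<And>a b c d. B a b d c = - B a b c d"
    and bianchi: "\<And>a b c d. B a b c d + B b c a d + B c a b d = 0"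
    and zero: "\<And>a b. B a b b a = 0"
  shows "B a b c d = 0"
proof -
  have add2: "B a (b + b') c d = B a b c d + B a b' c d" for a b b' c d
    using add1[of b b' a c d] anti12[of a "b + b'" c d] anti12[of a b c d] anti12[of a b' c d] by simp
  have add4: "B a b c (d + d') = B a b c d + B a b c d'" for a b c d d'
    using add3[of a b d d' c] anti34[of a b c "d + d'"] anti34[of a b c d] anti34[of a b c d'] by simp
  \<comment> \<open>The four Bianchi identities, one for each choice of the last argument, combine
    linearly to the symmetry in pairs.\<close>
  have pair: "B a b c d = B c d a b" for a b c d
  proof -
    have "B a b c d + B b c a d + B c a b d = 0" "B b c d a + B c d b a + B d b c a = 0"
      "B c d a b + B d a c b + B a c d b = 0" "B d a b c + B a b d c + B b d a c = 0"
      by (rule bianchi)+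
    moreover have "B b c d a = - B b c a d" "B c d b a = - B c d a b" "B d b c a = B b d a c"
      "B d a c b = - B d a b c" "B a c d b = B c a b d" "B a b d c = - B a b c d"
      using anti12 anti34 by (metis minus_minus)+
    ultimately show ?thesis by linarith
  qed
  have 1: "B a b b d = 0" for a b d
  proof -
    have "B (a + d) b b (a + d) = B a b b a + B a b b d + (B d b b a + B d b b d)"
      by (simp add: add1 add4)
    then have "B a b b d + B d b b a = 0" by (simp add: zero)
    moreover have "B d b b a = B a b b d"
      using pair[of d b b a] anti12[of b a d b] anti34[of a b b d] by simp
    ultimately show ?thesis by simp
  qed
  have 2: "B a b c d = - B a c b d" for a b c d
  proof -
    have "B a (b + c) (b + c) d = B a b b d + B a b c d + (B a c b d + B a c c d)"
      by (simp only: add2 add3)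
    then show ?thesis by (simp only: 1)
  qed
  have "B b c a d = B a b c d" "B c a b d = B a b c d"
    using 2 anti12 by (metis minus_minus)+
  then show ?thesis using bianchi[of a b c d] by simp
qed

text \<open>Coordinates of a metric and its Levi-Civita connection over a chart image:
  \<open>\<Gamma> x w b\<close> stands for the covariant derivative of the constant field
  \<open>b\<close> in direction \<open>w\<close>, so \<open>\<Gamma>_sym\<close> expresses the
  absence of torsion.\<close>

locale chart_geometry =
  fixes U :: "'e::euclidean_space set"
    and \<Gamma> :: "'e \<Rightarrow> 'e \<Rightarrow> 'e \<Rightarrow> 'e"
    and q :: "'e \<Rightarrow> 'e \<Rightarrow> 'e \<Rightarrow> real"
  assumes open_U: "open U"
    and bilinear_\<Gamma>: "x \<in> U \<Longrightarrow> bilinear (\<Gamma> x)"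
    and smooth_\<Gamma>: "smooth_on U (\<lambda>x. \<Gamma> x a b)"
    and \<Gamma>_sym: "x \<in> U \<Longrightarrow> \<Gamma> x a b = \<Gamma> x b a"
    and bilinear_q: "x \<in> U \<Longrightarrow> bilinear (q x)"
    and smooth_q: "smooth_on U (\<lambda>x. q x a b)"
    and q_sym: "x \<in> U \<Longrightarrow> q x a b = q x b a"
    and q_pos: "x \<in> U \<Longrightarrow> a \<noteq> 0 \<Longrightarrow> q x a a > 0"
    and metric_compat: "x \<in> U \<Longrightarrow> fd (\<lambda>y. q y a b) x w = q x (\<Gamma> x w a) b + q x a (\<Gamma> x w b)"
begin

lemmas \<Gamma>_simps = bilinear_ladd[OF bilinear_\<Gamma>] bilinear_radd[OF bilinear_\<Gamma>]
  bilinear_lmul[OF bilinear_\<Gamma>] bilinear_rmul[OF bilinear_\<Gamma>]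
  bilinear_lneg[OF bilinear_\<Gamma>] bilinear_rneg[OF bilinear_\<Gamma>]
  bilinear_lzero[OF bilinear_\<Gamma>] bilinear_rzero[OF bilinear_\<Gamma>]
  bilinear_lsub[OF bilinear_\<Gamma>] bilinear_rsub[OF bilinear_\<Gamma>]

lemmas q_simps = bilinear_ladd[OF bilinear_q] bilinear_radd[OF bilinear_q]
  bilinear_lmul[OF bilinear_q] bilinear_rmul[OF bilinear_q]
  bilinear_lneg[OF bilinear_q] bilinear_rneg[OF bilinear_q]
  bilinear_lzero[OF bilinear_q] bilinear_rzero[OF bilinear_q]
  bilinear_lsub[OF bilinear_q] bilinear_rsub[OF bilinear_q]

lemma differentiable_\<Gamma>: "x \<in> U \<Longrightarrow> (\<lambda>y. \<Gamma> y a b) differentiable (at x)"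
  by (rule smooth_onD[OF smooth_\<Gamma>])

lemma differentiable_q: "x \<in> U \<Longrightarrow> (\<lambda>y. q y a b) differentiable (at x)"
  by (rule smooth_onD[OF smooth_q])

lemma linear_fd_\<Gamma>:
  assumes "x \<in> U"
  shows "linear (fd (\<lambda>y. \<Gamma> y a b) x)" "linear (\<lambda>a. fd (\<lambda>y. \<Gamma> y a b) x h)" "linear (\<lambda>b. fd (\<lambda>y. \<Gamma> y a b) x h)"
proof -
  show "linear (fd (\<lambda>y. \<Gamma> y a b) x)"
    by (rule linear_frechet_derivative[OF differentiable_\<Gamma>[OF assms]])
  show "linear (\<lambda>a. fd (\<lambda>y. \<Gamma> y a b) x h)"
    by (rule linear_fd_linear_family[OF open_U assms _ differentiable_\<Gamma>[OF assms]])
      (rule bilinear_linear_left[OF bilinear_\<Gamma>])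
  show "linear (\<lambda>b. fd (\<lambda>y. \<Gamma> y a b) x h)"
    by (rule linear_fd_linear_family[OF open_U assms _ differentiable_\<Gamma>[OF assms]])
      (rule bilinear_linear_right[OF bilinear_\<Gamma>])
qed

lemmas fd_\<Gamma>_simps = linear_add[OF linear_fd_\<Gamma>(1)] linear_add[OF linear_fd_\<Gamma>(2)] linear_add[OF linear_fd_\<Gamma>(3)]
  linear_cmul[OF linear_fd_\<Gamma>(1)] linear_cmul[OF linear_fd_\<Gamma>(2)] linear_cmul[OF linear_fd_\<Gamma>(3)]

text \<open>The commutator of covariant derivatives in directions \<open>a\<close> and
  \<open>b\<close>, evaluated on constant fields, for which the bracket term is absent.\<close>

definition Rm :: "'e \<Rightarrow> 'e \<Rightarrow> 'e \<Rightarrow> 'e \<Rightarrow> 'e" where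
  "Rm x a b v = fd (\<lambda>y. \<Gamma> y b v) x a - fd (\<lambda>y. \<Gamma> y a v) x b + \<Gamma> x a (\<Gamma> x b v) - \<Gamma> x b (\<Gamma> x a v)"

lemma Rm_antisym: "Rm x b a v = - Rm x a b v"
  by (simp add: Rm_def)

lemma Rm_add:
  assumes "x \<in> U"
  shows "Rm x (a + a') b v = Rm x a b v + Rm x a' b v" "Rm x a b (v + v') = Rm x a b v + Rm x a b v'"
  unfolding Rm_def using assms by (simp_all add: \<Gamma>_simps fd_\<Gamma>_simps)

lemma Rm_scale:
  assumes "x \<in> U" shows "Rm x a b (s *\<^sub>R v) = s *\<^sub>R Rm x a b v"
  unfolding Rm_def using assms by (simp add: \<Gamma>_simps fd_\<Gamma>_simps algebra_simps)

text \<open>Once \<open>\<Gamma>\<close> is symmetric, the derivative terms and the quadratic terms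
  each cancel in pairs over the cyclic sum.\<close>

lemma Rm_bianchi:
  assumes "x \<in> U" shows "Rm x a b c + Rm x b c a + Rm x c a b = 0"
proof -
  have "fd (\<lambda>y. \<Gamma> y a b) x h = fd (\<lambda>y. \<Gamma> y b a) x h" for a b h
    using frechet_derivative_cong_open[OF open_U assms, of "\<lambda>y. \<Gamma> y a b" "\<lambda>y. \<Gamma> y b a"] \<Gamma>_sym by simp
  then show ?thesis
    unfolding Rm_def using \<Gamma>_sym[OF assms, of a b] \<Gamma>_sym[OF assms, of a c] \<Gamma>_sym[OF assms, of b c]
    by (simp add: algebra_simps)
qed

text \<open>Metric compatibility expresses the second derivatives of \<open>q y v w\<close> through \<open>\<Gamma>\<close>; the claim is
  their symmetry in the two directions.\<close>

lemma Rm_skew: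
  assumes x: "x \<in> U" shows "q x (Rm x a b v) w = - q x v (Rm x a b w)"
proof -
  have fq: "fd (\<lambda>y. fd (\<lambda>z. q z v w) y b) x a =
      q x (\<Gamma> x a (\<Gamma> x b v)) w + q x (\<Gamma> x b v) (\<Gamma> x a w) + q x (fd (\<lambda>y. \<Gamma> y b v) x a) w
      + (q x (\<Gamma> x a v) (\<Gamma> x b w) + q x v (\<Gamma> x a (\<Gamma> x b w)) + q x v (fd (\<lambda>y. \<Gamma> y b w) x a))" for a b
  proof -
    have d\<Gamma>: "((\<lambda>y. \<Gamma> y b v) has_derivative fd (\<lambda>y. \<Gamma> y b v) x) (at x)" for v
      by (rule smooth_on_has_derivative[OF smooth_\<Gamma> x])
    have "fd (\<lambda>y. fd (\<lambda>z. q z v w) y b) x a = fd (\<lambda>y. q y (\<Gamma> y b v) w + q y v (\<Gamma> y b w)) x a"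
      using frechet_derivative_cong_open[OF open_U x, of "\<lambda>y. fd (\<lambda>z. q z v w) y b"
          "\<lambda>y. q y (\<Gamma> y b v) w + q y v (\<Gamma> y b w)"] metric_compat by simp
    moreover have "((\<lambda>y. q y (\<Gamma> y b v) w + q y v (\<Gamma> y b w)) has_derivative
      (\<lambda>h. (fd (\<lambda>y. q y (\<Gamma> x b v) w) x h + q x (fd (\<lambda>y. \<Gamma> y b v) x h) w + q x (\<Gamma> x b v) 0)
         + (fd (\<lambda>y. q y v (\<Gamma> x b w)) x h + q x 0 (\<Gamma> x b w) + q x v (fd (\<lambda>y. \<Gamma> y b w) x h)))) (at x)"
      by (intro has_derivative_add has_derivative_bilinear_family[OF open_U x bilinear_q differentiable_q[OF x]]
          d\<Gamma> has_derivative_const)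
    ultimately show ?thesis
      by (simp add: frechet_derivative_eqI metric_compat[OF x] q_simps x)
  qed
  have "fd (\<lambda>y. fd (\<lambda>z. q z v w) y b) x a = fd (\<lambda>y. fd (\<lambda>z. q z v w) y a) x b"
    by (rule smooth_on_second_derivative_symmetric_real[OF open_U x smooth_q])
  then show ?thesis
    unfolding fq Rm_def using x by (simp add: q_simps)
qed

lemma q_nondegenerate:
  assumes "x \<in> U" "\<And>w. q x v w = 0" shows "v = 0"
  using q_pos[OF assms(1), of v] assms(2)[of v] by force

text \<open>\<open>B\<close> measures the deviation from the tensor of constant curvature
  \<open>K\<close>. It has the algebraic symmetries of a curvature tensor and vanishes on sectional
  arguments, hence everywhere; nondegeneracy of \<open>q\<close> removes the last argument.\<close>

lemma Rm_of_sectional: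
  assumes x: "x \<in> U"
    and sec: "\<And>a b. q x (Rm x a b b) a = K * (q x a a * q x b b - (q x a b)\<^sup>2)"
  shows "Rm x a b v = K *\<^sub>R (q x b v *\<^sub>R a - q x a v *\<^sub>R b)"
proof -
  define B where "B = (\<lambda>a b v w. q x (Rm x a b v) w - K * (q x b v * q x a w - q x a v * q x b w))"
  have "B a b v w = 0" for w
  proof (rule curvature_like_form_eq_0[of B])
    fix a a' b c d
    show "B (a + a') b c d = B a b c d + B a' b c d" "B a b (c + a') d = B a b c d + B a b a' d"
      by (simp_all add: B_def q_simps x Rm_add algebra_simps)
    show "B b a c d = - B a b c d"
      by (simp add: B_def q_simps x Rm_antisym[of x b a] algebra_simps)
    show "B a b d c = - B a b c d"
      using Rm_skew[OF x, of a b d c] q_sym[OF x, of d "Rm x a b c"]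
      by (simp add: B_def algebra_simps)
    have "q x (Rm x a b c) d + q x (Rm x b c a) d + q x (Rm x c a b) d = q x (Rm x a b c + Rm x b c a + Rm x c a b) d"
      by (simp add: q_simps x)
    then have "q x (Rm x a b c) d + q x (Rm x b c a) d + q x (Rm x c a b) d = 0"
      by (simp only: Rm_bianchi[OF x] bilinear_lzero[OF bilinear_q[OF x]])
    then show "B a b c d + B b c a d + B c a b d = 0"
      using q_sym[OF x, of a b] q_sym[OF x, of a c] q_sym[OF x, of b c]
      by (simp add: B_def q_simps x algebra_simps)
    show "B a b b a = 0"
      using q_sym[OF x, of a b] by (simp add: B_def sec power2_eq_square algebra_simps)
  qed
  then have "q x (Rm x a b v - K *\<^sub>R (q x b v *\<^sub>R a - q x a v *\<^sub>R b)) w = 0" for w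
    by (simp add: B_def q_simps x)
  from q_nondegenerate[OF x this] show ?thesis by simp
qed

lemma gram_determinant_pos:
  assumes x: "x \<in> U" and indep: "\<And>s t. s *\<^sub>R a + t *\<^sub>R b = 0 \<Longrightarrow> s = 0 \<and> t = 0"
  shows "q x a a * q x b b - (q x a b)\<^sup>2 > 0"
proof -
  have "b \<noteq> 0" using indep[of 0 1] by auto
  then have b: "q x b b > 0" by (rule q_pos[OF x])
  \<comment> \<open>This is \<open>q x b b\<close> times the component of \<open>a\<close>
    orthogonal to \<open>b\<close>, so its squared length is \<open>q x b b\<close> times the Gram
    determinant.\<close>
  let ?c = "q x b b *\<^sub>R a - q x a b *\<^sub>R b"
  have "?c \<noteq> 0" using indep[of "q x b b" "- q x a b"] b by auto
  then have "0 < q x ?c ?c" by (rule q_pos[OF x])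
  also have "q x ?c ?c = q x b b * (q x a a * q x b b - (q x a b)\<^sup>2)"
    using q_sym[OF x, of b a] by (simp add: q_simps x power2_eq_square algebra_simps)
  finally show ?thesis using b by (simp add: zero_less_mult_iff)
qed

lemma Rm_scale_left:
  assumes "x \<in> U" shows "Rm x (s *\<^sub>R a) b v = s *\<^sub>R Rm x a b v"
  unfolding Rm_def using assms by (simp add: \<Gamma>_simps fd_\<Gamma>_simps algebra_simps)

text \<open>Sectional curvature is a quotient with meaning for independent pairs only. For dependent
  pairs the curvature term vanishes by antisymmetry or linearity and the Gram determinant by
  degeneracy, so the polynomial identity behind \<open>Rm_of_sectional\<close> extends to
  them.\<close>

lemma Rm_of_sectional_independent:
  assumes x: "x \<in> U"
    and sec: "\<And>a b. (\<And>s t. s *\<^sub>R a + t *\<^sub>R b = 0 \<Longrightarrow> s = 0 \<and> t = 0) \<Longrightarrow>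
      q x (Rm x a b b) a / (q x a a * q x b b - (q x a b)\<^sup>2) = K"
  shows "Rm x a b v = K *\<^sub>R (q x b v *\<^sub>R a - q x a v *\<^sub>R b)"
proof (rule Rm_of_sectional[OF x])
  fix a b
  show "q x (Rm x a b b) a = K * (q x a a * q x b b - (q x a b)\<^sup>2)"
  proof (cases "\<forall>s t. s *\<^sub>R a + t *\<^sub>R b = 0 \<longrightarrow> s = 0 \<and> t = 0")
    case True
    then have indep: "s = 0 \<and> t = 0" if "s *\<^sub>R a + t *\<^sub>R b = 0" for s t using that by blast
    show ?thesis using sec[of a b, OF indep] gram_determinant_pos[OF x, of a b, OF indep] by (simp add: divide_eq_eq)
  next
    case False
    have zero: "q x (Rm x (k *\<^sub>R b) b v) w = 0" for k v w
    proof -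
      have "Rm x b b v = - Rm x b b v" by (rule Rm_antisym)
      then have "Rm x b b v + Rm x b b v = 0" by (simp only: eq_neg_iff_add_eq_0)
      then have "Rm x b b v = 0" by (simp add: scaleR_2[symmetric])
      then show ?thesis by (simp add: Rm_scale_left x q_simps)
    qed
    from False obtain s t where st: "s *\<^sub>R a + t *\<^sub>R b = 0" "s \<noteq> 0 \<or> t \<noteq> 0" by blast
    show ?thesis
    proof (cases "s = 0")
      case True
      then have "b = 0" using st by simp
      then show ?thesis
        using Rm_scale[OF x, of a 0 0 0] by (simp add: q_simps x)
    next
      case False
      have "a = (- t / s) *\<^sub>R b"
      proof -
        have "s *\<^sub>R a = - t *\<^sub>R b" using st(1) by (simp add: eq_neg_iff_add_eq_0)
        then have "(1 / s) *\<^sub>R (s *\<^sub>R a) = (1 / s) *\<^sub>R (- t *\<^sub>R b)" by simp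
        then show ?thesis using False by simp
      qed
      then obtain k where k: "a = k *\<^sub>R b" by blast
      show ?thesis unfolding k zero by (simp add: q_simps x power2_eq_square)
    qed
  qed
qed

lemma smooth_on_norm_sq:
  assumes "open S" "S \<subseteq> U \<times> UNIV" shows "smooth_on S (\<lambda>z. q (fst z) (snd z) (snd z))"
proof (rule smooth_on_bilinear_family[where B = "\<lambda>z. q (fst z)" and f = snd and g = snd, OF assms(1)])
  show "bilinear (q (fst z))" if "z \<in> S" for z using subsetD[OF assms(2) that] by (intro bilinear_q) (simp add: mem_Times_iff)
  show "smooth_on S (\<lambda>z. q (fst z) a b)" for a b
    by (rule smooth_on_compose[OF assms(1) open_U _ smooth_q smooth_on_bounded_linear[OF bounded_linear_fst]])
      (use assms(2) in auto)
qed (rule smooth_on_bounded_linear[OF bounded_linear_snd])+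

end


section \<open>The Nijenhuis tensor in a chart\<close>

definition chart_bracket :: "('v::euclidean_space \<Rightarrow> 'v) \<Rightarrow> ('v \<Rightarrow> 'v) \<Rightarrow> 'v \<Rightarrow> 'v" where
  "chart_bracket X Y z = fd Y z (X z) - fd X z (Y z)"

section \<open>Almost-complex structures on an open set\<close>

locale almost_complex_chart =
  fixes S :: "'v::euclidean_space set" and J :: "'v \<Rightarrow> 'v \<Rightarrow> 'v"
  assumes open_S: "open S"
    and linear_J: "z \<in> S \<Longrightarrow> linear (J z)"
    and J_J: "z \<in> S \<Longrightarrow> J z (J z w) = - w"
    and smooth_J: "smooth_on S (\<lambda>z. J z w)"
begin

definition dJ :: "'v \<Rightarrow> 'v \<Rightarrow> 'v \<Rightarrow> 'v" where
  "dJ z h w = fd (\<lambda>y. J y w) z h"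

definition chart_nijenhuis :: "('v \<Rightarrow> 'v) \<Rightarrow> ('v \<Rightarrow> 'v) \<Rightarrow> 'v \<Rightarrow> 'v" where
  "chart_nijenhuis X Y z = chart_bracket (\<lambda>y. J y (X y)) (\<lambda>y. J y (Y y)) z - J z (chart_bracket (\<lambda>y. J y (X y)) Y z)
     - J z (chart_bracket X (\<lambda>y. J y (Y y)) z) - chart_bracket X Y z"

text \<open>What remains of \<open>chart_nijenhuis\<close> after the product rule, once the derivatives of the two
  fields have cancelled.\<close>

definition nijenhuis_tensor :: "'v \<Rightarrow> 'v \<Rightarrow> 'v \<Rightarrow> 'v" where
  "nijenhuis_tensor z a b = dJ z (J z a) b - dJ z (J z b) a + J z (dJ z b a - dJ z a b)"

lemma has_derivative_J_apply:
  assumes z: "z \<in> S" and w: "(w has_derivative w') (at z)"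
  shows "((\<lambda>y. J y (w y)) has_derivative (\<lambda>h. dJ z h (w z) + J z (w' h))) (at z)"
  unfolding dJ_def
  by (rule has_derivative_linear_family[OF open_S z linear_J smooth_onD[OF smooth_J z] w])

lemma linear_dJ:
  assumes z: "z \<in> S"
  shows "linear (\<lambda>h. dJ z h w)" "linear (dJ z h)"
proof -
  show "linear (\<lambda>h. dJ z h w)"
    unfolding dJ_def by (rule linear_frechet_derivative[OF smooth_onD[OF smooth_J z]])
  show "linear (dJ z h)"
    unfolding dJ_def
    by (rule linear_fd_linear_family[OF open_S z linear_J smooth_onD[OF smooth_J z]])
qed

text \<open>This is the derivative of \<open>J y (J y w) = - w\<close> with respect to
  \<open>y\<close>, with \<open>w\<close> held fixed.\<close>

lemma dJ_J:
  assumes z: "z \<in> S" shows "dJ z h (J z w) = - J z (dJ z h w)"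
proof -
  have "((\<lambda>y. J y w) has_derivative (\<lambda>h. dJ z h w)) (at z)"
    unfolding dJ_def by (rule smooth_on_has_derivative[OF smooth_J z])
  from has_derivative_J_apply[OF z this]
  have "((\<lambda>y. - w) has_derivative (\<lambda>h. dJ z h (J z w) + J z (dJ z h w))) (at z)"
    by (rule has_derivative_transform_within_open[OF _ open_S z]) (rule J_J)
  then have "(\<lambda>h. dJ z h (J z w) + J z (dJ z h w)) = (\<lambda>h. 0)"
    by (rule has_derivative_unique[OF _ has_derivative_const])
  then show ?thesis by (metis eq_neg_iff_add_eq_0)
qed

text \<open>Tensoriality: each derivative of \<open>X\<close> or \<open>Y\<close> occurs twice with
  opposite signs, either behind a single \<open>J\<close> or with \<open>J J = -1\<close> used once.
  Hence only the values at \<open>z\<close> matter, and constant fields test all of them.\<close>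

lemma chart_nijenhuis_eq_nijenhuis_tensor:
  assumes z: "z \<in> S" and X: "X differentiable (at z)" and Y: "Y differentiable (at z)"
  shows "chart_nijenhuis X Y z = nijenhuis_tensor z (X z) (Y z)"
proof -
  have "fd (\<lambda>y. J y (W y)) z h = dJ z h (W z) + J z (fd W z h)" if "W differentiable (at z)" for W h
    using frechet_derivative_eqI[OF has_derivative_J_apply[OF z, of W "fd W z"]] that
    by (simp add: frechet_derivative_works)
  then show ?thesis
    unfolding chart_nijenhuis_def nijenhuis_tensor_def chart_bracket_def
    by (simp add: X Y linear_add[OF linear_J[OF z]] linear_diff[OF linear_J[OF z]] J_J[OF z])
qed

lemma nijenhuis_tensor_antisym:
  assumes z: "z \<in> S" shows "nijenhuis_tensor z b a = - nijenhuis_tensor z a b"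
  unfolding nijenhuis_tensor_def by (simp add: linear_diff[OF linear_J[OF z]])

lemma nijenhuis_tensor_J_left:
  assumes z: "z \<in> S" shows "nijenhuis_tensor z (J z a) b = - J z (nijenhuis_tensor z a b)"
proof -
  have "dJ z (- a) b = - dJ z a b" by (rule linear_neg[OF linear_dJ(1)[OF z]])
  then show ?thesis
    unfolding nijenhuis_tensor_def
    by (simp add: J_J[OF z] dJ_J[OF z] linear_add[OF linear_J[OF z]] linear_diff[OF linear_J[OF z]]
        linear_neg[OF linear_J[OF z]])
qed

lemma nijenhuis_tensor_add_left:
  assumes z: "z \<in> S" shows "nijenhuis_tensor z (a + a') b = nijenhuis_tensor z a b + nijenhuis_tensor z a' b"
  unfolding nijenhuis_tensor_def
  by (simp add: linear_add[OF linear_J[OF z]] linear_diff[OF linear_J[OF z]]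
      linear_add[OF linear_dJ(1)[OF z]] linear_add[OF linear_dJ(2)[OF z]])

text \<open>Conjugate linearity carries the vanishing from \<open>H\<close> to its image under
  \<open>J\<close>, additivity to sums, and antisymmetry to the second slot. \<open>H\<close> will
  be the set of horizontal vectors.\<close>

lemma nijenhuis_tensor_eq_0:
  assumes z: "z \<in> S" and span: "\<And>w. \<exists>a\<in>H. \<exists>b\<in>H. w = a + J z b"
    and H: "\<And>a b. a \<in> H \<Longrightarrow> b \<in> H \<Longrightarrow> nijenhuis_tensor z a b = 0"
  shows "nijenhuis_tensor z w w' = 0"
proof -
  have J0: "J z 0 = 0" by (rule linear_0[OF linear_J[OF z]])
  have 1: "nijenhuis_tensor z w b = 0" if "b \<in> H" for w b
  proof -
    obtain a a' where "a \<in> H" "a' \<in> H" "w = a + J z a'" using span by blast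
    then show ?thesis using that by (simp add: nijenhuis_tensor_add_left[OF z] nijenhuis_tensor_J_left[OF z] H J0)
  qed
  have 2: "nijenhuis_tensor z b w = 0" if "b \<in> H" for w b
    by (simp add: nijenhuis_tensor_antisym[OF z, of b w] 1[OF that])
  obtain a a' where "a \<in> H" "a' \<in> H" "w = a + J z a'" using span by blast
  then show ?thesis by (simp add: nijenhuis_tensor_add_left[OF z] nijenhuis_tensor_J_left[OF z] 2 J0)
qed

end

text \<open>A tangent vector of the tangent bundle at \<open>(x, v)\<close> has chart components \<open>(a, b)\<close>; since
  \<open>a\<^sup>h = (a, - \<Gamma>(a, v))\<close>, it is \<open>a\<^sup>h + B\<^sup>v\<close> with \<open>B = b + \<Gamma>(a, v)\<close>.\<close>

definition vertical_part ::
    "('e \<Rightarrow> 'e \<Rightarrow> 'e \<Rightarrow> 'e) \<Rightarrow> 'e \<times> 'e \<Rightarrow> 'e::real_vector \<times> 'e \<Rightarrow> 'e" where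
  "vertical_part \<Gamma> z w = snd w + \<Gamma> (fst z) (fst w) (snd z)"

text \<open>The rule \<open>J(a^h + B^v) = F a^v - B^h / F\<close> in components, where
  \<open>B^h = (B, - \<Gamma>(B, v))\<close> accounts for the positive Christoffel term.\<close>

definition coord_J ::
    "('e \<Rightarrow> 'e \<Rightarrow> 'e \<Rightarrow> 'e) \<Rightarrow> ('e \<times> 'e \<Rightarrow> real) \<Rightarrow> 'e \<times> 'e \<Rightarrow> 'e::real_vector \<times> 'e \<Rightarrow> 'e \<times> 'e" where
  "coord_J \<Gamma> F z w = (- (inverse (F z) *\<^sub>R vertical_part \<Gamma> z w),
     F z *\<^sub>R fst w + inverse (F z) *\<^sub>R \<Gamma> (fst z) (vertical_part \<Gamma> z w) (snd z))"

section \<open>The weighted structure over one chart\<close>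

locale weighted_chart = chart_geometry U \<Gamma> q
  for U :: "'e::euclidean_space set" and \<Gamma> q +
  fixes S :: "('e \<times> 'e) set" and F :: "'e \<times> 'e \<Rightarrow> real"
  assumes open_S: "open S" and S_subset: "S \<subseteq> U \<times> UNIV"
    and smooth_F: "smooth_on S F" and F_pos: "z \<in> S \<Longrightarrow> F z > 0"
begin

abbreviation vert :: "'e \<times> 'e \<Rightarrow> 'e \<times> 'e \<Rightarrow> 'e" where
  "vert \<equiv> vertical_part \<Gamma>"

abbreviation Jc :: "'e \<times> 'e \<Rightarrow> 'e \<times> 'e \<Rightarrow> 'e \<times> 'e" where
  "Jc \<equiv> coord_J \<Gamma> F"

definition hor :: "'e \<times> 'e \<Rightarrow> 'e \<Rightarrow> 'e \<times> 'e" where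
  "hor z a = (a, - \<Gamma> (fst z) a (snd z))"

lemma in_U: "z \<in> S \<Longrightarrow> fst z \<in> U"
  using S_subset by auto

lemma smooth_on_\<Gamma>_fst: "smooth_on S (\<lambda>z. \<Gamma> (fst z) a b)"
  by (rule smooth_on_compose[OF open_S open_U _ smooth_\<Gamma> smooth_on_bounded_linear[OF bounded_linear_fst]])
    (use S_subset in auto)

lemma smooth_on_\<Gamma>_family:
  "smooth_on S f \<Longrightarrow> smooth_on S g \<Longrightarrow> smooth_on S (\<lambda>z. \<Gamma> (fst z) (f z) (g z))"
  by (rule smooth_on_bilinear_family[OF open_S bilinear_\<Gamma>[OF in_U] smooth_on_\<Gamma>_fst])

lemma vert_linear: "z \<in> S \<Longrightarrow> linear (vert z)"
  by (rule linearI) (simp_all add: vertical_part_def \<Gamma>_simps in_U algebra_simps)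

lemma vert_hor: "vert z (hor z a) = 0"
  by (simp add: vertical_part_def hor_def)

lemma almost_complex: "almost_complex_chart S Jc"
proof (rule almost_complex_chart.intro)
  show "open S" by (rule open_S)
next
  fix z w assume z: "z \<in> S"
  show "linear (Jc z)"
    by (rule linearI)
      (simp_all add: coord_J_def linear_add[OF vert_linear[OF z]] linear_cmul[OF vert_linear[OF z]]
        \<Gamma>_simps in_U[OF z] algebra_simps)
  \<comment> \<open>The Christoffel terms coming from the two components of \<open>Jc z w\<close>
    cancel, so the second application of \<open>Jc\<close> acts on known horizontal and vertical
    parts.\<close>
  have "vert z (Jc z w) = F z *\<^sub>R fst w"
    by (simp add: vertical_part_def[of \<Gamma> z "Jc z w"]) (simp add: coord_J_def \<Gamma>_simps in_U[OF z])
  then have "Jc z (Jc z w) = (- (inverse (F z) *\<^sub>R F z *\<^sub>R fst w),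
     F z *\<^sub>R - (inverse (F z) *\<^sub>R vert z w) + inverse (F z) *\<^sub>R \<Gamma> (fst z) (F z *\<^sub>R fst w) (snd z))"
    by (subst coord_J_def) (simp add: coord_J_def)
  then show "Jc z (Jc z w) = - w"
    using F_pos[OF z] by (simp add: vertical_part_def \<Gamma>_simps in_U[OF z] prod_eq_iff)
next
  fix w
  have fst: "smooth_on S fst" and snd: "smooth_on S snd"
    by (rule smooth_on_bounded_linear[OF bounded_linear_fst] smooth_on_bounded_linear[OF bounded_linear_snd])+
  have v: "smooth_on S (\<lambda>z. vert z w)"
    unfolding vertical_part_def by (intro smooth_on_add[OF open_S] smooth_on_const smooth_on_\<Gamma>_family snd)
  have i: "smooth_on S (\<lambda>z. inverse (F z))"
    by (rule smooth_on_inverse[OF open_S smooth_F]) (use F_pos in force)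
  have "smooth_on S (\<lambda>z. ((- inverse (F z)) *\<^sub>R vert z w,
      F z *\<^sub>R fst w + inverse (F z) *\<^sub>R \<Gamma> (fst z) (vert z w) (snd z)))"
    by (intro smooth_on_Pair smooth_on_scaleR smooth_on_add open_S v i smooth_F smooth_on_\<Gamma>_family snd
        smooth_on_const smooth_on_linear_compose[OF open_S _ i, of uminus] bounded_linear_minus bounded_linear_ident)
  then show "smooth_on S (\<lambda>z. Jc z w)" by (simp add: coord_J_def)
qed

end

sublocale weighted_chart \<subseteq> J: almost_complex_chart S Jc
  by (rule almost_complex)

context weighted_chart
begin

text \<open>The derivative in direction \<open>h\<close> of the vertical part of a vector held
  constant in coordinates, with first component \<open>b\<close>: only the Christoffel term depends
  on the base point.\<close>

definition dvert :: "'e \<times> 'e \<Rightarrow> 'e \<times> 'e \<Rightarrow> 'e \<Rightarrow> 'e" where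
  "dvert z h b = fd (\<lambda>y. \<Gamma> y b (snd z)) (fst z) (fst h) + \<Gamma> (fst z) b (snd h)"

lemma has_derivative_\<Gamma>_family:
  assumes z: "z \<in> S" and f: "(f has_derivative f') (at z)" and g: "(g has_derivative g') (at z)"
  shows "((\<lambda>y. \<Gamma> (fst y) (f y) (g y)) has_derivative
    (\<lambda>h. fd (\<lambda>y. \<Gamma> y (f z) (g z)) (fst z) (fst h) + \<Gamma> (fst z) (f' h) (g z) + \<Gamma> (fst z) (f z) (g' h))) (at z)"
proof -
  have "((\<lambda>y. \<Gamma> (fst y) a b) has_derivative (\<lambda>h. fd (\<lambda>y. \<Gamma> y a b) (fst z) (fst h))) (at z)" for a b
    by (rule has_derivative_compose[OF bounded_linear_imp_has_derivative[OF bounded_linear_fst]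
          smooth_on_has_derivative[OF smooth_\<Gamma> in_U[OF z]]])
  from has_derivative_bilinear_family[OF open_S z bilinear_\<Gamma>[OF in_U] smooth_onD[OF smooth_on_\<Gamma>_fst z] f g]
    frechet_derivative_eqI[OF this[of "f z" "g z"]]
  show ?thesis by simp
qed

text \<open>The vector \<open>hor z b\<close> is frozen while the point moves. Its vertical part
  vanishes at \<open>z\<close> but varies nearby, so \<open>dvert\<close> appears and every term
  containing the derivative of \<open>inverse (F z)\<close> drops out.\<close>

lemma dJ_hor:
  assumes z: "z \<in> S"
  shows "J.dJ z h (hor z b) = (- (inverse (F z) *\<^sub>R dvert z h b),
    fd F z h *\<^sub>R b + inverse (F z) *\<^sub>R \<Gamma> (fst z) (dvert z h b) (snd z))"
proof -
  let ?c = "hor z b"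
  have snd: "(snd has_derivative snd) (at z)"
    by (rule bounded_linear_imp_has_derivative[OF bounded_linear_snd])
  have F: "(F has_derivative fd F z) (at z)" by (rule smooth_on_has_derivative[OF smooth_F z])
  have v: "((\<lambda>y. vert y ?c) has_derivative (\<lambda>h. dvert z h b)) (at z)"
  proof -
    have "((\<lambda>y. snd ?c + \<Gamma> (fst y) b (snd y)) has_derivative
      (\<lambda>h. 0 + (fd (\<lambda>y. \<Gamma> y b (snd z)) (fst z) (fst h) + \<Gamma> (fst z) 0 (snd z) + \<Gamma> (fst z) b (snd h)))) (at z)"
      by (intro has_derivative_add has_derivative_const has_derivative_\<Gamma>_family[OF z _ snd])
    then show ?thesis by (simp add: vertical_part_def hor_def dvert_def[abs_def] \<Gamma>_simps in_U[OF z])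
  qed
  have i: "((\<lambda>y. inverse (F y)) has_derivative (\<lambda>h. - (inverse (F z) * fd F z h * inverse (F z)))) (at z)"
    by (rule Deriv.has_derivative_inverse[OF _ F]) (use F_pos[OF z] in simp)
  have "((\<lambda>y. (- (inverse (F y) *\<^sub>R vert y ?c), F y *\<^sub>R b + inverse (F y) *\<^sub>R \<Gamma> (fst y) (vert y ?c) (snd y)))
    has_derivative (\<lambda>h. (- (inverse (F z) *\<^sub>R dvert z h b + (- (inverse (F z) * fd F z h * inverse (F z))) *\<^sub>R vert z ?c),
      (F z *\<^sub>R 0 + fd F z h *\<^sub>R b) +
      (inverse (F z) *\<^sub>R (fd (\<lambda>y. \<Gamma> y (vert z ?c) (snd z)) (fst z) (fst h)
         + \<Gamma> (fst z) (dvert z h b) (snd z) + \<Gamma> (fst z) (vert z ?c) (snd h))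
       + (- (inverse (F z) * fd F z h * inverse (F z))) *\<^sub>R \<Gamma> (fst z) (vert z ?c) (snd z))))) (at z)"
    by (intro has_derivative_Pair has_derivative_minus has_derivative_add has_derivative_scaleR
        F i v has_derivative_const has_derivative_\<Gamma>_family[OF z _ snd])
  from frechet_derivative_eqI[OF this]
  have "fd (\<lambda>y. Jc y ?c) z h = (- (inverse (F z) *\<^sub>R dvert z h b),
      fd F z h *\<^sub>R b + inverse (F z) *\<^sub>R (fd (\<lambda>y. \<Gamma> y 0 (snd z)) (fst z) (fst h) + \<Gamma> (fst z) (dvert z h b) (snd z)))"
    by (simp add: coord_J_def[abs_def] vert_hor \<Gamma>_simps in_U[OF z]) (simp add: hor_def)
  then show ?thesis
    by (simp add: J.dJ_def linear_0[OF linear_fd_\<Gamma>(2)[OF in_U[OF z]]])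
qed

lemma Jc_hor: "z \<in> S \<Longrightarrow> Jc z (hor z a) = (0, F z *\<^sub>R a)"
  unfolding coord_J_def vert_hor by (simp add: \<Gamma>_simps in_U) (simp add: hor_def)

text \<open>Here curvature enters, as the failure of the horizontal distribution to be integrable:
  the second component of \<open>hor\<close> supplies the products of Christoffel symbols in
  \<open>Rm\<close>.\<close>

lemma dvert_Rm:
  assumes "z \<in> S"
  shows "dvert z (hor z a) b - dvert z (hor z b) a = Rm (fst z) a b (snd z)"
  using in_U[OF assms] by (simp add: dvert_def hor_def Rm_def \<Gamma>_simps)

text \<open>Read invariantly, the value is \<open>- e^h / F\<close> plus a vertical lift; the last
  Christoffel term of the second component belongs to the horizontal lift of
  \<open>e\<close>.\<close>

lemma nijenhuis_tensor_hor:
  assumes z: "z \<in> S"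
  defines "e \<equiv> \<lambda>a b. fd F z (hor z b) *\<^sub>R a - fd F z (hor z a) *\<^sub>R b"
  shows "J.nijenhuis_tensor z (hor z a) (hor z b) = (- (inverse (F z) *\<^sub>R e a b),
    F z *\<^sub>R (fd F z (0, a) *\<^sub>R b - fd F z (0, b) *\<^sub>R a) + Rm (fst z) a b (snd z)
      + inverse (F z) *\<^sub>R \<Gamma> (fst z) (e a b) (snd z))"
proof -
  have Fp: "F z \<noteq> 0" using F_pos[OF z] by simp
  have x: "fst z \<in> U" by (rule in_U[OF z])
  have linF: "linear (fd F z)" by (rule linear_frechet_derivative[OF smooth_onD[OF smooth_F z]])
  have dF: "fd F z (0, F z *\<^sub>R a) = F z * fd F z (0, a)" for a
    using linear_cmul[OF linF, of "F z" "(0, a)"] by simp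
  have dv: "dvert z (0, F z *\<^sub>R a) b = F z *\<^sub>R \<Gamma> (fst z) b a" for a b
    by (simp add: dvert_def \<Gamma>_simps x linear_0[OF linear_fd_\<Gamma>(1)[OF x]])
  \<comment> \<open>Each \<open>dJ\<close> in the difference contributes a term with
    \<open>\<Gamma>\<close> of \<open>a\<close> and \<open>b\<close>, in opposite orders; their
    symmetry makes them cancel.\<close>
  have 1: "J.dJ z (Jc z (hor z a)) (hor z b) - J.dJ z (Jc z (hor z b)) (hor z a)
    = (0, F z *\<^sub>R (fd F z (0, a) *\<^sub>R b - fd F z (0, b) *\<^sub>R a))"
    by (simp add: Jc_hor[OF z] dJ_hor[OF z] dv dF \<Gamma>_sym[OF x, of a b] algebra_simps)
  \<comment> \<open>Invariantly this is \<open>R^h / F + e^v\<close>, which the remaining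
    application of \<open>Jc\<close> turns into \<open>R^v - e^h / F\<close>.\<close>
  have 2: "J.dJ z (hor z b) (hor z a) - J.dJ z (hor z a) (hor z b)
    = (inverse (F z) *\<^sub>R Rm (fst z) a b (snd z),
       e a b - inverse (F z) *\<^sub>R \<Gamma> (fst z) (Rm (fst z) a b (snd z)) (snd z))"
    by (simp add: dJ_hor[OF z] dvert_Rm[OF z, symmetric] e_def \<Gamma>_simps x algebra_simps)
  have "Jc z (inverse (F z) *\<^sub>R Rm (fst z) a b (snd z),
       e a b - inverse (F z) *\<^sub>R \<Gamma> (fst z) (Rm (fst z) a b (snd z)) (snd z))
    = (- (inverse (F z) *\<^sub>R e a b), Rm (fst z) a b (snd z) + inverse (F z) *\<^sub>R \<Gamma> (fst z) (e a b) (snd z))"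
    using Fp by (simp add: coord_J_def vertical_part_def \<Gamma>_simps x)
  then show ?thesis
    unfolding J.nijenhuis_tensor_def 1 2 by (simp add: algebra_simps)
qed

text \<open>The first component of the tensor forces \<open>e = 0\<close>, after which the
  Christoffel term leaves the second component and the curvature equation remains.\<close>

lemma Rm_of_integrable:
  assumes z: "(x, v) \<in> S" and 0: "\<And>a b. J.nijenhuis_tensor (x, v) a b = 0"
  shows "Rm x a b v = F (x, v) *\<^sub>R (fd F (x, v) (0, b) *\<^sub>R a - fd F (x, v) (0, a) *\<^sub>R b)"
proof -
  let ?z = "(x, v)"
  define e where "e = fd F ?z (hor ?z b) *\<^sub>R a - fd F ?z (hor ?z a) *\<^sub>R b"
  have "e = 0"
    using nijenhuis_tensor_hor[OF z, of a b] 0[of "hor ?z a" "hor ?z b"] F_pos[OF z] by (simp add: e_def zero_prod_def)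
  then have "F ?z *\<^sub>R (fd F ?z (0, a) *\<^sub>R b - fd F ?z (0, b) *\<^sub>R a) + Rm x a b v = 0"
    using nijenhuis_tensor_hor[OF z, of a b] 0[of "hor ?z a" "hor ?z b"] in_U[OF z]
    by (simp add: e_def[symmetric] zero_prod_def \<Gamma>_simps)
  then show ?thesis by (simp add: algebra_simps add_eq_0_iff)
qed

text \<open>Metric compatibility turns the derivative in the base point into Christoffel terms that
  complete \<open>snd h\<close> to \<open>vert z h\<close>. In particular the norm is stationary in
  horizontal directions.\<close>

lemma q_fst_derivative:
  assumes z: "z \<in> S"
  shows "((\<lambda>y. q (fst y) (snd y) (snd y)) has_derivative
    (\<lambda>h. 2 * q (fst z) (vert z h) (snd z))) (at z)"
proof -
  have x: "fst z \<in> U" by (rule in_U[OF z])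
  have snd: "(snd has_derivative snd) (at z)"
    by (rule bounded_linear_imp_has_derivative[OF bounded_linear_snd])
  have d: "((\<lambda>y. q (fst y) a b) has_derivative (\<lambda>h. fd (\<lambda>y. q y a b) (fst z) (fst h))) (at z)" for a b
    by (rule has_derivative_compose[OF bounded_linear_imp_has_derivative[OF bounded_linear_fst]
          smooth_on_has_derivative[OF smooth_q x]])
  have "((\<lambda>y. q (fst y) (snd y) (snd y)) has_derivative
    (\<lambda>h. fd (\<lambda>y. q (fst y) (snd z) (snd z)) z h + q (fst z) (snd h) (snd z) + q (fst z) (snd z) (snd h))) (at z)"
    using d by (intro has_derivative_bilinear_family[OF open_S z bilinear_q[OF in_U] _ snd snd])
      (auto simp: differentiable_def)
  moreover have "fd (\<lambda>y. q (fst y) (snd z) (snd z)) z h + q (fst z) (snd h) (snd z) + q (fst z) (snd z) (snd h)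
    = 2 * q (fst z) (vert z h) (snd z)" for h
    unfolding frechet_derivative_eqI[OF d] metric_compat[OF x]
    using q_sym[OF x, of "snd z" "\<Gamma> (fst z) (fst h) (snd z)"] q_sym[OF x, of "snd z" "snd h"]
    by (simp add: vertical_part_def q_simps x)
  ultimately show ?thesis by simp
qed

text \<open>Half of the differentiated law. It gives \<open>dF\<close> on horizontal and on vertical
  vectors at once.\<close>

lemma law_derivative:
  assumes law: "\<And>y. y \<in> S \<Longrightarrow> (F y)\<^sup>2 = c + K * q (fst y) (snd y) (snd y)" and z: "z \<in> S"
  shows "F z * fd F z h = K * q (fst z) (vert z h) (snd z)"
proof -
  have "((\<lambda>y. (F y)\<^sup>2) has_derivative (\<lambda>h. 2 * fd F z h * F z)) (at z)"
    using has_derivative_power[OF smooth_on_has_derivative[OF smooth_F z], of 2]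
    by (simp add: mult_ac)
  moreover have "((\<lambda>y. (F y)\<^sup>2) has_derivative (\<lambda>h. 0 + K * (2 * q (fst z) (vert z h) (snd z)))) (at z)"
    by (rule has_derivative_transform_within_open[OF _ open_S z law[symmetric]])
      (intro has_derivative_add has_derivative_const has_derivative_mult_right q_fst_derivative[OF z])
  ultimately have "(\<lambda>h. 2 * fd F z h * F z) = (\<lambda>h. 0 + K * (2 * q (fst z) (vert z h) (snd z)))"
    by (rule has_derivative_unique)
  then have "2 * fd F z h * F z = 0 + K * (2 * q (fst z) (vert z h) (snd z))" by (rule fun_cong)
  then show ?thesis by (simp add: algebra_simps)
qed

lemma integrable_of_constant_curvature:
  assumes law: "\<And>y. y \<in> S \<Longrightarrow> (F y)\<^sup>2 = c + K * q (fst y) (snd y) (snd y)"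
    and Rm: "\<And>x a b v. x \<in> U \<Longrightarrow> Rm x a b v = K *\<^sub>R (q x b v *\<^sub>R a - q x a v *\<^sub>R b)"
    and z: "z \<in> S"
  shows "J.nijenhuis_tensor z a b = 0"
proof (rule J.nijenhuis_tensor_eq_0[OF z, of "range (hor z)"])
  have x: "fst z \<in> U" by (rule in_U[OF z])
  note FF = law_derivative[OF law z]
  have 0: "fd F z (hor z a) = 0" for a
    using FF[of "hor z a"] F_pos[OF z] by (simp add: vert_hor q_simps x)
  have 1: "F z * fd F z (0, a) = K * q (fst z) a (snd z)" for a
    using FF[of "(0, a)"] by (simp add: vertical_part_def \<Gamma>_simps x)
  fix a b assume "a \<in> range (hor z)" "b \<in> range (hor z)"
  then obtain a' b' where "a = hor z a'" "b = hor z b'" by blast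
  then show "J.nijenhuis_tensor z a b = 0"
    by (simp add: nijenhuis_tensor_hor[OF z] 0 Rm[OF x] scaleR_diff_right 1 \<Gamma>_simps x zero_prod_def)
next
  fix w
  \<comment> \<open>Since \<open>Jc\<close> sends \<open>hor z a\<close> to the vertical vector
    \<open>F a\<close>, the vertical part of \<open>w\<close> has to be divided by
    \<open>F z\<close>.\<close>
  have "w = hor z (fst w) + Jc z (hor z (inverse (F z) *\<^sub>R vert z w))"
    using F_pos[OF z] by (simp add: Jc_hor[OF z]) (simp add: hor_def vertical_part_def prod_eq_iff)
  then show "\<exists>a\<in>range (hor z). \<exists>b\<in>range (hor z). w = a + Jc z b" by blast
qed

text \<open>A disk bundle contains only short vectors, so the condition is tested at a multiple of
  \<open>v\<close>. Both sides are linear in \<open>v\<close>, which allows \<open>t\<close> to be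
  cancelled.\<close>

lemma Rm_of_law:
  assumes law: "\<And>y. y \<in> S \<Longrightarrow> (F y)\<^sup>2 = c + K * q (fst y) (snd y) (snd y)"
    and int: "\<And>z a b. z \<in> S \<Longrightarrow> J.nijenhuis_tensor z a b = 0"
    and x: "x \<in> U" and t: "t > 0" "(x, t *\<^sub>R v) \<in> S"
  shows "Rm x a b v = K *\<^sub>R (q x b v *\<^sub>R a - q x a v *\<^sub>R b)"
proof -
  have F: "F (x, t *\<^sub>R v) * fd F (x, t *\<^sub>R v) (0, a) = t * (K * q x a v)" for a
    using law_derivative[OF law t(2), of "(0, a)"] by (simp add: vertical_part_def \<Gamma>_simps q_simps x)
  have "t *\<^sub>R Rm x a b v = Rm x a b (t *\<^sub>R v)" by (simp add: Rm_scale x)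
  also have "\<dots> = t *\<^sub>R K *\<^sub>R (q x b v *\<^sub>R a - q x a v *\<^sub>R b)"
    by (simp add: Rm_of_integrable[OF t(2) int[OF t(2)]] scaleR_diff_right F)
  finally show ?thesis by (rule scaleR_left_imp_eq[rotated]) (use t(1) in simp)
qed

text \<open>Along a ray \<open>r e\<close> the integrability condition, compared with its value at one fixed radius,
  says that \<open>F\<^sup>2\<close> has derivative \<open>2 k r\<close>; a direction \<open>j\<close> independent of \<open>e\<close> is needed to read
  this off.\<close>

lemma radial_law:
  fixes f :: "real \<Rightarrow> real" and \<rho> :: ereal
  assumes dim: "DIM('e) > 1" and \<rho>: "0 < \<rho>" and x: "x \<in> U"
    and S: "S = {z. fst z \<in> U \<and> ereal (sqrt (q (fst z) (snd z) (snd z))) < \<rho>}"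
    and F: "\<And>z. z \<in> S \<Longrightarrow> F z = f (sqrt (q (fst z) (snd z) (snd z)))"
    and int: "\<And>z a b. z \<in> S \<Longrightarrow> J.nijenhuis_tensor z a b = 0"
  shows "\<exists>K. \<exists>c>0. \<forall>r\<ge>0. ereal r < \<rho> \<longrightarrow> f r = sqrt (c + K * r\<^sup>2)"
proof -
  obtain e :: 'e where e: "e \<in> Basis" using nonempty_Basis by blast
  obtain j :: 'e where j: "j \<in> Basis" "j \<noteq> e"
  proof -
    have "\<not> (Basis :: 'e set) \<subseteq> {e}" using dim card_mono[of "{e}" "Basis :: 'e set"] by auto
    then show ?thesis using that by blast
  qed
  \<comment> \<open>The vector \<open>e\<close> has unit length in the coordinate inner product but
    not for \<open>q\<close>: the ray parameter \<open>r\<close> corresponds to the Riemannian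
    radius \<open>\<bar>r\<bar> * n\<close>.\<close>
  define n where "n = sqrt (q x e e)"
  have "q x e e > 0" using e nonzero_Basis by (intro q_pos x) auto
  then have n: "n > 0" "n\<^sup>2 = q x e e" by (simp_all add: n_def)
  have norm_re: "sqrt (q x (r *\<^sub>R e) (r *\<^sub>R e)) = \<bar>r\<bar> * n" for r
  proof -
    have "q x (r *\<^sub>R e) (r *\<^sub>R e) = (r * n)\<^sup>2" using n by (simp add: q_simps x power2_eq_square)
    then show ?thesis using n by (simp add: abs_mult)
  qed
  have inS: "(x, r *\<^sub>R e) \<in> S \<longleftrightarrow> ereal (\<bar>r\<bar> * n) < \<rho>" for r
    unfolding S using x norm_re by simp
  \<comment> \<open>Half the derivative of \<open>F^2\<close> at \<open>(x, r e)\<close> in the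
    vertical direction \<open>b\<close>.\<close>
  define \<omega> where "\<omega> = (\<lambda>r b. F (x, r *\<^sub>R e) * fd F (x, r *\<^sub>R e) (0, b))"
  have R: "r *\<^sub>R Rm x j e e = \<omega> r e *\<^sub>R j - \<omega> r j *\<^sub>R e" if "(x, r *\<^sub>R e) \<in> S" for r
    using Rm_of_integrable[OF that int[OF that], of j e]
    by (simp add: Rm_scale x \<omega>_def scaleR_diff_right)
  \<comment> \<open>A finite reference radius strictly below \<open>\<rho>\<close>, which may be
    infinite.\<close>
  obtain R0 where R0: "0 < ereal R0" "ereal R0 < \<rho>" using ereal_dense2[OF \<rho>] by blast
  define r0 where "r0 = R0 / n"
  have r0: "r0 > 0" "(x, r0 *\<^sub>R e) \<in> S"
  proof -
    show "r0 > 0" using R0 n by (simp add: r0_def)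
    then have "\<bar>r0\<bar> * n = R0" using n by (simp only: abs_of_pos) (simp add: r0_def)
    then show "(x, r0 *\<^sub>R e) \<in> S" using R0 by (simp add: inS)
  qed
  define k where "k = \<omega> r0 e / r0"
  have \<omega>: "\<omega> r e = k * r" if "(x, r *\<^sub>R e) \<in> S" for r
  proof -
    have "r0 *\<^sub>R (\<omega> r e *\<^sub>R j - \<omega> r j *\<^sub>R e) = r *\<^sub>R (\<omega> r0 e *\<^sub>R j - \<omega> r0 j *\<^sub>R e)"
      unfolding R[OF that, symmetric] R[OF r0(2), symmetric] by simp
    \<comment> \<open>Both vectors equal \<open>r0 * r\<close> times \<open>Rm x j e e\<close>.
      Pairing with \<open>j\<close>, orthogonal to \<open>e\<close> in the coordinate inner product,
      discards the unknown \<open>\<omega> r j\<close>.\<close>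
    then have "(r0 *\<^sub>R (\<omega> r e *\<^sub>R j - \<omega> r j *\<^sub>R e)) \<bullet> j = (r *\<^sub>R (\<omega> r0 e *\<^sub>R j - \<omega> r0 j *\<^sub>R e)) \<bullet> j"
      by simp
    then have "r0 * \<omega> r e = r * \<omega> r0 e"
      using e j by (simp add: inner_diff_left inner_Basis)
    then show ?thesis using r0(1) by (simp add: k_def field_simps)
  qed
  define \<Phi> where "\<Phi> = (\<lambda>r. (F (x, r *\<^sub>R e))\<^sup>2)"
  have \<Phi>: "\<Phi> r = \<Phi> 0 + k * r\<^sup>2" if r: "r \<ge> 0" "(x, r *\<^sub>R e) \<in> S" for r
  proof (cases "r = 0")
    case False
    with r have r_pos: "0 < r" by simp
    have der: "((\<lambda>s. \<Phi> s - k * s\<^sup>2) has_derivative (\<lambda>h. 0)) (at s within {0..r})" if s: "0 \<le> s" "s \<le> r" for s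
    proof -
      have "\<bar>s\<bar> * n \<le> \<bar>r\<bar> * n" using s n by (intro mult_right_mono) auto
      then have sS: "(x, s *\<^sub>R e) \<in> S"
        using r(2) unfolding inS by (meson ereal_less_eq(3) le_less_trans)
      have lin: "linear (fd F (x, s *\<^sub>R e))"
        by (rule linear_frechet_derivative[OF smooth_onD[OF smooth_F sS]])
      have "((\<lambda>s. (x, s *\<^sub>R e)) has_derivative (\<lambda>h. (0, h *\<^sub>R e))) (at s)"
        by (auto intro!: derivative_eq_intros)
      from has_derivative_compose[OF this smooth_on_has_derivative[OF smooth_F sS]]
      have "((\<lambda>s. F (x, s *\<^sub>R e)) has_derivative (\<lambda>h. h * fd F (x, s *\<^sub>R e) (0, e))) (at s)"
        using linear_cmul[OF lin, of _ "(0, e)"] by simp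
      from has_derivative_power[OF this, of 2]
      have 1: "(\<Phi> has_derivative (\<lambda>h. 2 * h * \<omega> s e)) (at s)"
        by (simp add: \<Phi>_def \<omega>_def mult_ac)
      have 2: "((\<lambda>s. k * s\<^sup>2) has_derivative (\<lambda>h. k * (2 * h * s))) (at s)"
        by (auto intro!: derivative_eq_intros)
      from has_derivative_diff[OF 1 2] show ?thesis
        by (simp add: \<omega>[OF sS] algebra_simps has_derivative_at_withinI)
    qed
    from mvt_simple[OF r_pos der] show ?thesis by auto
  qed simp
  have S0: "(x, 0 *\<^sub>R e) \<in> S" using \<rho> by (simp only: inS) (simp add: zero_ereal_def)
  have c: "\<Phi> 0 > 0" using F_pos[OF S0] by (simp add: \<Phi>_def)
  \<comment> \<open>The Riemannian radius \<open>r\<close> is reached at ray parameter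
    \<open>r / n\<close>, which turns the slope \<open>k\<close> into the constant
    \<open>k / n\<^sup>2\<close>.\<close>
  have "f r = sqrt (\<Phi> 0 + (k / n\<^sup>2) * r\<^sup>2)" if r: "r \<ge> 0" "ereal r < \<rho>" for r
  proof -
    have "\<bar>r / n\<bar> * n = r" using r n by simp
    then have rS: "(x, (r / n) *\<^sub>R e) \<in> S" and fr: "F (x, (r / n) *\<^sub>R e) = f r"
      using r F[of "(x, (r / n) *\<^sub>R e)"] norm_re[of "r / n"] by (simp_all only: inS fst_conv snd_conv)
    have "(f r)\<^sup>2 = \<Phi> 0 + k * (r / n)\<^sup>2" "f r > 0"
      using \<Phi>[OF _ rS] F_pos[OF rS] r n by (simp_all add: \<Phi>_def fr)
    then show ?thesis using real_sqrt_unique[of "f r" "\<Phi> 0 + (k / n\<^sup>2) * r\<^sup>2"] by (simp add: power_divide)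
  qed
  then show ?thesis using c by blast
qed

end


section \<open>Tangent vectors and fields in charts\<close>

text \<open>These axioms hold for the tangent atlas as well, so every result of this locale is also
  available for vectors and fields on the tangent bundle.\<close>

locale smooth_atlas =
  fixes A :: "('a, 'e::euclidean_space) chart set"
  assumes inj: "c \<in> A \<Longrightarrow> inj_on (snd c) (fst c)"
    and open_overlap: "c \<in> A \<Longrightarrow> d \<in> A \<Longrightarrow> open (snd c ` (fst c \<inter> fst d))"
    and smooth_transition: "c \<in> A \<Longrightarrow> d \<in> A \<Longrightarrow> smooth_on (snd c ` (fst c \<inter> fst d)) (snd d \<circ> chart_inv c)"
begin

lemma charts_at_iff: "c \<in> charts_at A p \<longleftrightarrow> c \<in> A \<and> p \<in> fst c"
  by (auto simp: charts_at_def)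

lemma chart_inv_chart: "c \<in> A \<Longrightarrow> p \<in> fst c \<Longrightarrow> chart_inv c (snd c p) = p"
  unfolding chart_inv_def by (rule inv_into_f_f[OF inj])

lemma chart_inv_in: "c \<in> A \<Longrightarrow> x \<in> snd c ` (fst c \<inter> W) \<Longrightarrow> chart_inv c x \<in> fst c \<inter> W"
  by (auto simp: chart_inv_chart)

lemma open_chart_image: "c \<in> A \<Longrightarrow> atlas_open A W \<Longrightarrow> open (snd c ` (fst c \<inter> W))"
  by (auto simp: atlas_open_def)

lemma atlas_open_domain: "c \<in> A \<Longrightarrow> atlas_open A (fst c)"
  unfolding atlas_open_def points_def using open_overlap by auto

lemma atlas_open_Int:
  assumes "atlas_open A V" "atlas_open A W" shows "atlas_open A (V \<inter> W)"
  unfolding atlas_open_def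
proof (intro conjI ballI)
  show "V \<inter> W \<subseteq> points A" using assms by (auto simp: atlas_open_def)
  fix c assume c: "c \<in> A"
  have "snd c ` (fst c \<inter> (V \<inter> W)) = snd c ` (fst c \<inter> V) \<inter> snd c ` (fst c \<inter> W)"
    using inj[OF c] by (auto simp: inj_on_def)
  then show "open (snd c ` (fst c \<inter> (V \<inter> W)))"
    using assms open_chart_image[OF c] by auto
qed

section \<open>Transition maps and tangent vectors\<close>

definition transition_deriv :: "('a, 'e) chart \<Rightarrow> ('a, 'e) chart \<Rightarrow> 'a \<Rightarrow> 'e \<Rightarrow> 'e" where
  "transition_deriv c d p = fd (snd d \<circ> chart_inv c) (snd c p)"

lemma has_derivative_transition:
  assumes "c \<in> A" "d \<in> A" "p \<in> fst c" "p \<in> fst d"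
  shows "((snd d \<circ> chart_inv c) has_derivative transition_deriv c d p) (at (snd c p))"
  unfolding transition_deriv_def by (rule smooth_on_has_derivative[OF smooth_transition]) (use assms in auto)

lemma linear_transition_deriv:
  assumes "c \<in> A" "d \<in> A" "p \<in> fst c" "p \<in> fst d" shows "linear (transition_deriv c d p)"
  using has_derivative_linear[OF has_derivative_transition[OF assms]] .

lemma chart_change_derivative:
  assumes ce: "c \<in> A" "e \<in> A" "p \<in> fst c" "p \<in> fst e"
    and G: "(G \<circ> chart_inv c) differentiable (at (snd c p))"
  shows "((G \<circ> chart_inv e) has_derivative (\<lambda>h. fd (G \<circ> chart_inv c) (snd c p) (transition_deriv e c p h))) (at (snd e p))"
proof -
  have inv: "chart_inv e (snd e p) = p" using ce chart_inv_chart by blast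
  have "((G \<circ> chart_inv c) has_derivative fd (G \<circ> chart_inv c) (snd c p))
      (at ((snd c \<circ> chart_inv e) (snd e p)))"
    using G by (simp add: inv frechet_derivative_works)
  from has_derivative_compose[OF has_derivative_transition[OF ce(2,1,4,3)] this]
  show ?thesis
    by (rule has_derivative_transform_within_open[OF _ open_overlap[OF ce(2,1)]])
      (use ce in \<open>auto simp: chart_inv_chart\<close>)
qed

lemma transition_deriv_comp:
  assumes "c \<in> A" "d \<in> A" "e \<in> A" "p \<in> fst c" "p \<in> fst d" "p \<in> fst e"
  shows "transition_deriv d e p (transition_deriv c d p \<alpha>) = transition_deriv c e p \<alpha>"
  using frechet_derivative_eqI[OF chart_change_derivative[of d c p "snd e"]] assms
    has_derivative_transition[of d e p] unfolding transition_deriv_def differentiable_def by metis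

lemma transition_deriv_self:
  assumes "c \<in> A" "p \<in> fst c" shows "transition_deriv c c p \<alpha> = \<alpha>"
proof -
  have "((snd c \<circ> chart_inv c) has_derivative (\<lambda>x. x)) (at (snd c p))"
    by (rule has_derivative_transform_within_open[OF has_derivative_ident open_overlap[OF assms(1,1)]])
      (use assms in \<open>auto simp: chart_inv_chart\<close>)
  from frechet_derivative_eqI[OF this] show ?thesis by (simp add: transition_deriv_def)
qed

lemma tangent_transform:
  "v \<in> tangent_space A p \<Longrightarrow> c \<in> charts_at A p \<Longrightarrow> d \<in> charts_at A p \<Longrightarrow> v d = transition_deriv c d p (v c)"
  unfolding tangent_space_def transition_deriv_def by blast

lemma tangent_outside: "v \<in> tangent_space A p \<Longrightarrow> c \<notin> charts_at A p \<Longrightarrow> v c = 0"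
  unfolding tangent_space_def by blast

lemma tangent_spaceI:
  assumes "\<And>c d. c \<in> charts_at A p \<Longrightarrow> d \<in> charts_at A p \<Longrightarrow> v d = transition_deriv c d p (v c)"
    and "\<And>c. c \<notin> charts_at A p \<Longrightarrow> v c = 0"
  shows "v \<in> tangent_space A p"
  using assms unfolding tangent_space_def transition_deriv_def by blast

lemma tangent_eqI:
  assumes "v \<in> tangent_space A p" "w \<in> tangent_space A p" "c \<in> charts_at A p" "v c = w c"
  shows "v = w"
proof
  fix d show "v d = w d"
  proof (cases "d \<in> charts_at A p")
    case True
    then show ?thesis using assms tangent_transform by metis
  next
    case False
    then show ?thesis using assms tangent_outside by metis
  qed
qed

lemma tangent_eq_0I:
  assumes "c \<in> charts_at A p" "v \<in> tangent_space A p" "v c = 0" shows "v = 0"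
proof (rule tangent_eqI[OF assms(2) _ assms(1)])
  show "0 \<in> tangent_space A p"
  proof (rule tangent_spaceI)
    fix c d assume "c \<in> charts_at A p" "d \<in> charts_at A p"
    then show "(0::('a, 'e) tvec) d = transition_deriv c d p (0 c)"
      using linear_0[OF linear_transition_deriv[of c d p]] by (simp add: charts_at_iff)
  qed simp
qed (simp add: assms(3))

lemma tangent_space_lincomb:
  assumes "v \<in> tangent_space A p" "w \<in> tangent_space A p"
  shows "a *\<^sub>T v + b *\<^sub>T w \<in> tangent_space A p"
proof (rule tangent_spaceI)
  fix c d assume c: "c \<in> charts_at A p" and d: "d \<in> charts_at A p"
  then have "linear (transition_deriv c d p)" by (auto intro!: linear_transition_deriv simp: charts_at_iff)
  then show "(a *\<^sub>T v + b *\<^sub>T w) d = transition_deriv c d p ((a *\<^sub>T v + b *\<^sub>T w) c)"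
    using tangent_transform[OF assms(1) c d] tangent_transform[OF assms(2) c d]
    by (simp add: linear_add linear_cmul)
qed (simp add: tangent_outside[OF assms(1)] tangent_outside[OF assms(2)])

lemma tangent_space_add: "v \<in> tangent_space A p \<Longrightarrow> w \<in> tangent_space A p \<Longrightarrow> v + w \<in> tangent_space A p"
  and tangent_space_scale: "v \<in> tangent_space A p \<Longrightarrow> a *\<^sub>T v \<in> tangent_space A p"
  and tangent_space_diff: "v \<in> tangent_space A p \<Longrightarrow> w \<in> tangent_space A p \<Longrightarrow> v - w \<in> tangent_space A p"
  using tangent_space_lincomb[of v p w 1 1] tangent_space_lincomb[of v p v a 0]
    tangent_space_lincomb[of v p w 1 "-1"]
  by (simp_all add: plus_fun_def fun_diff_def)

text \<open>The value off the chart domain is \<open>0\<close>, so that the map is linear in \<open>\<alpha>\<close> at every point and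
  constant-coefficient fields add up globally.\<close>

definition tvec_of :: "('a, 'e) chart \<Rightarrow> 'a \<Rightarrow> 'e \<Rightarrow> ('a, 'e) tvec" where
  "tvec_of c p \<alpha> = (\<lambda>d. if p \<in> fst c \<and> d \<in> charts_at A p then transition_deriv c d p \<alpha> else 0)"

lemma tvec_of_tangent: "c \<in> charts_at A p \<Longrightarrow> tvec_of c p \<alpha> \<in> tangent_space A p"
  by (rule tangent_spaceI) (auto simp: tvec_of_def charts_at_iff transition_deriv_comp)

lemma tvec_of_self: "c \<in> charts_at A p \<Longrightarrow> tvec_of c p \<alpha> c = \<alpha>"
  by (simp add: tvec_of_def charts_at_iff transition_deriv_self)

lemma tvec_of_eq: "v \<in> tangent_space A p \<Longrightarrow> c \<in> charts_at A p \<Longrightarrow> tvec_of c p (v c) = v"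
  using tangent_eqI[of "tvec_of c p (v c)" p v c] tvec_of_tangent[of c p] tvec_of_self[of c p] by blast

lemma tvec_of_add: "c \<in> A \<Longrightarrow> tvec_of c p (\<alpha> + \<beta>) = tvec_of c p \<alpha> + tvec_of c p \<beta>"
  by (rule ext) (simp add: tvec_of_def charts_at_iff linear_add[OF linear_transition_deriv])

lemma tvec_of_scale: "c \<in> A \<Longrightarrow> tvec_of c p (s *\<^sub>R \<alpha>) = s *\<^sub>T tvec_of c p \<alpha>"
  by (rule ext) (simp add: tvec_of_def charts_at_iff linear_cmul[OF linear_transition_deriv])

lemma smooth_field_tangent: "smooth_field A W X \<Longrightarrow> p \<in> W \<Longrightarrow> X p \<in> tangent_space A p"
  by (simp add: smooth_field_def)

lemma smooth_field_chart:
  "smooth_field A W X \<Longrightarrow> c \<in> A \<Longrightarrow> smooth_on (snd c ` (fst c \<inter> W)) (\<lambda>x. X (chart_inv c x) c)"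
  by (simp add: smooth_field_def)

lemma smooth_field_subset: "smooth_field A W X \<Longrightarrow> V \<subseteq> W \<Longrightarrow> smooth_field A V X"
  unfolding smooth_field_def by (auto intro: smooth_on_subset)

lemma smooth_on_chart_change:
  assumes c: "c \<in> A" and d: "d \<in> A" and W: "atlas_open A W" "W \<subseteq> fst c"
    and h: "smooth_on (snd c ` W) h"
  shows "smooth_on (snd d ` (fst d \<inter> W)) (\<lambda>y. h (snd c (chart_inv d y)))"
proof (rule smooth_on_compose[OF open_chart_image[OF d W(1)] _ _ h])
  show "open (snd c ` W)" using open_chart_image[OF c W(1)] W(2) by (simp add: Int_absorb1)
  show "(\<lambda>y. snd c (chart_inv d y)) ` snd d ` (fst d \<inter> W) \<subseteq> snd c ` W"
    using chart_inv_in[OF d] by auto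
  show "smooth_on (snd d ` (fst d \<inter> W)) (\<lambda>y. snd c (chart_inv d y))"
    by (rule smooth_on_subset[OF smooth_transition[OF d c, unfolded o_def]]) (use W(2) in auto)
qed

lemma smooth_function_of_coords:
  assumes c: "c \<in> A" and W: "atlas_open A W" "W \<subseteq> fst c" and h: "smooth_on (snd c ` W) h"
  shows "smooth_function A W (\<lambda>p. h (snd c p))"
  unfolding smooth_function_def using smooth_on_chart_change[OF c _ W h] by (simp add: o_def)

text \<open>The source of all explicit fields: constant coefficients give the coordinate frames,
  affine ones the sections that are parallel at a point. In another chart the component is the
  transition derivative applied to the coefficient.\<close>

lemma smooth_field_of_coords:
  assumes c: "c \<in> A" and W: "atlas_open A W" "W \<subseteq> fst c" and h: "smooth_on (snd c ` W) h"
  shows "smooth_field A W (\<lambda>p. tvec_of c p (h (snd c p)))"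
  unfolding smooth_field_def
proof (intro conjI ballI)
  fix p assume "p \<in> W"
  then show "tvec_of c p (h (snd c p)) \<in> tangent_space A p"
    using c W by (intro tvec_of_tangent) (auto simp: charts_at_iff)
next
  fix d assume d: "d \<in> A"
  have S: "open (snd c ` W)" using open_chart_image[OF c W(1)] W(2) by (simp add: Int_absorb1)
  have op: "open (snd c ` (fst c \<inter> (fst d \<inter> W)))"
    by (rule open_chart_image[OF c atlas_open_Int[OF atlas_open_domain[OF d] W(1)]])
  have eq: "fst c \<inter> (fst d \<inter> W) = fst d \<inter> W" using W(2) by auto
  have "smooth_on (snd c ` (fst d \<inter> W)) (\<lambda>x. fd (snd d \<circ> chart_inv c) x (h x))"
    using W(2) op unfolding eq
    by (intro smooth_on_frechet_apply smooth_on_subset[OF smooth_transition[OF c d]] smooth_on_subset[OF h]) auto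
  from smooth_on_chart_change[OF c d _ _ this]
  have "smooth_on (snd d ` (fst d \<inter> W)) (\<lambda>y. fd (snd d \<circ> chart_inv c) (snd c (chart_inv d y)) (h (snd c (chart_inv d y))))"
    using W(2) atlas_open_Int[OF atlas_open_domain[OF d] W(1)] by (auto simp: Int_assoc[symmetric])
  then show "smooth_on (snd d ` (fst d \<inter> W)) (\<lambda>y. tvec_of c (chart_inv d y) (h (snd c (chart_inv d y))) d)"
  proof (rule smooth_on_cong[OF open_chart_image[OF d W(1)], rotated])
    fix y assume "y \<in> snd d ` (fst d \<inter> W)"
    then have "chart_inv d y \<in> fst d \<inter> W" by (rule chart_inv_in[OF d])
    then show "fd (snd d \<circ> chart_inv c) (snd c (chart_inv d y)) (h (snd c (chart_inv d y)))
      = tvec_of c (chart_inv d y) (h (snd c (chart_inv d y))) d"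
      using W(2) d by (auto simp: tvec_of_def transition_deriv_def charts_at_iff)
  qed
qed

lemma smooth_field_const:
  assumes "c \<in> A" shows "smooth_field A (fst c) (\<lambda>p. tvec_of c p \<alpha>)"
  by (rule smooth_field_of_coords[OF assms atlas_open_domain[OF assms] order_refl smooth_on_const])

text \<open>This justifies the arbitrary choice of chart in \<open>dir_deriv\<close> and
  \<open>differential\<close>: the transformation of \<open>v\<close> undoes the chain rule for the
  change of chart.\<close>

lemma chart_independent_derivative:
  assumes v: "v \<in> tangent_space A p" and c: "c \<in> charts_at A p" and e: "e \<in> charts_at A p"
    and G: "(G \<circ> chart_inv c) differentiable (at (snd c p))"
  shows "fd (G \<circ> chart_inv e) (snd e p) (v e) = fd (G \<circ> chart_inv c) (snd c p) (v c)"
  using frechet_derivative_eqI[OF chart_change_derivative[OF _ _ _ _ G, of e]]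
    tangent_transform[OF v e c] c e by (simp add: charts_at_iff)

lemma some_chart: "c \<in> charts_at A p \<Longrightarrow> (SOME c. c \<in> charts_at A p) \<in> charts_at A p"
  by (rule someI)

lemma dir_deriv_chart:
  assumes f: "smooth_function A W f" and p: "p \<in> W" and v: "v \<in> tangent_space A p" and c: "c \<in> charts_at A p"
  shows "dir_deriv A f p v = fd (f \<circ> chart_inv c) (snd c p) (v c)"
  unfolding dir_deriv_def Let_def
  by (rule chart_independent_derivative[OF v c some_chart[OF c]])
    (rule smooth_onD[of "snd c ` (fst c \<inter> W)"],
      use f p c in \<open>auto simp: smooth_function_def charts_at_iff\<close>)

lemma differential_chart:
  assumes v: "v \<in> tangent_space A p" and c: "c \<in> charts_at A p" and d: "d \<in> charts_at B (G p)"
    and G: "(snd d \<circ> G \<circ> chart_inv c) differentiable (at (snd c p))"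
  shows "differential A B G p v d = fd (snd d \<circ> G \<circ> chart_inv c) (snd c p) (v c)"
  unfolding differential_def Let_def using d
  by (simp add: chart_independent_derivative[OF v c some_chart[OF c] G])

lemma field_transform:
  assumes X: "\<And>q. q \<in> W \<Longrightarrow> X q \<in> tangent_space A q" and W: "atlas_open A W" "p \<in> W"
    and c: "c \<in> charts_at A p" and d: "d \<in> charts_at A p"
    and dc: "(\<lambda>x. X (chart_inv c x) c) differentiable (at (snd c p))"
    and dd: "(\<lambda>x. X (chart_inv d x) d) differentiable (at (snd d p))"
  shows "fd (\<lambda>x. X (chart_inv d x) d) (snd d p) (transition_deriv c d p h)
    = fd (\<lambda>x. fd (snd d \<circ> chart_inv c) x (X p c)) (snd c p) h + transition_deriv c d p (fd (\<lambda>x. X (chart_inv c x) c) (snd c p) h)"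
proof -
  have cA: "c \<in> A" "p \<in> fst c" and dA: "d \<in> A" "p \<in> fst d" using c d by (auto simp: charts_at_iff)
  have inv: "chart_inv c (snd c p) = p" by (rule chart_inv_chart[OF cA])
  let ?\<tau> = "snd d \<circ> chart_inv c"
  let ?V = "snd c ` (fst c \<inter> (fst d \<inter> W))"
  have V: "open ?V"
    by (rule open_chart_image[OF cA(1) atlas_open_Int[OF atlas_open_domain[OF dA(1)] W(1)]])
  have pV: "snd c p \<in> ?V" using cA dA W(2) by auto
  have sm: "smooth_on ?V ?\<tau>" by (rule smooth_on_subset[OF smooth_transition[OF cA(1) dA(1)]]) auto
  have "((\<lambda>x. (\<lambda>x. X (chart_inv d x) d) (?\<tau> x)) has_derivative
      (\<lambda>h. fd (\<lambda>x. X (chart_inv d x) d) (snd d p) (transition_deriv c d p h))) (at (snd c p))"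
    using dd by (intro has_derivative_compose[OF has_derivative_transition[OF cA(1) dA(1) cA(2) dA(2)]])
      (simp add: inv frechet_derivative_works)
  then have 1: "((\<lambda>x. fd ?\<tau> x (X (chart_inv c x) c)) has_derivative
      (\<lambda>h. fd (\<lambda>x. X (chart_inv d x) d) (snd d p) (transition_deriv c d p h))) (at (snd c p))"
  proof (rule has_derivative_transform_within_open[OF _ V pV])
    fix x assume "x \<in> ?V"
    then obtain q where q: "q \<in> fst c" "q \<in> fst d" "q \<in> W" "x = snd c q" by auto
    have "X q d = transition_deriv c d q (X q c)"
      using q cA dA by (intro tangent_transform[OF X]) (auto simp: charts_at_iff)
    then show "X (chart_inv d (?\<tau> x)) d = fd ?\<tau> x (X (chart_inv c x) c)"
      by (simp add: q chart_inv_chart[OF cA(1)] chart_inv_chart[OF dA(1)] transition_deriv_def)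
  qed
  have 2: "((\<lambda>x. fd ?\<tau> x (X (chart_inv c x) c)) has_derivative
      (\<lambda>h. fd (\<lambda>x. fd ?\<tau> x (X (chart_inv c (snd c p)) c)) (snd c p) h
        + fd ?\<tau> (snd c p) (fd (\<lambda>x. X (chart_inv c x) c) (snd c p) h))) (at (snd c p))"
    using dc
    by (intro has_derivative_linear_family[OF V pV] linear_frechet_derivative smooth_onD[OF sm]
        smooth_onD[OF smooth_on_frechet[OF sm] pV]) (simp_all add: frechet_derivative_works)
  from fun_cong[OF has_derivative_unique[OF 1 2], of h] show ?thesis by (simp add: inv transition_deriv_def)
qed

text \<open>The second derivatives of the transition map cancel in the bracket by their symmetry.
  The hypotheses are tangency near \<open>p\<close> and differentiability at \<open>p\<close>, so
  that the lemma applies to the fields \<open>J q (X q)\<close>.\<close>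

lemma lie_bracket_tangent:
  assumes W: "atlas_open A W" "p \<in> W"
    and X: "\<And>q. q \<in> W \<Longrightarrow> X q \<in> tangent_space A q" and Y: "\<And>q. q \<in> W \<Longrightarrow> Y q \<in> tangent_space A q"
    and dX: "\<And>c. c \<in> charts_at A p \<Longrightarrow> (\<lambda>x. X (chart_inv c x) c) differentiable (at (snd c p))"
    and dY: "\<And>c. c \<in> charts_at A p \<Longrightarrow> (\<lambda>x. Y (chart_inv c x) c) differentiable (at (snd c p))"
  shows "lie_bracket A X Y p \<in> tangent_space A p"
proof (rule tangent_spaceI)
  fix c d assume c: "c \<in> charts_at A p" and d: "d \<in> charts_at A p"
  have cd: "c \<in> A" "d \<in> A" "p \<in> fst c" "p \<in> fst d" using c d by (auto simp: charts_at_iff)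
  have lin: "linear (transition_deriv c d p)" by (rule linear_transition_deriv[OF cd])
  have "fd (\<lambda>x. fd (snd d \<circ> chart_inv c) x (X p c)) (snd c p) (Y p c)
      = fd (\<lambda>x. fd (snd d \<circ> chart_inv c) x (Y p c)) (snd c p) (X p c)"
    by (rule smooth_on_second_derivative_symmetric[OF open_overlap[OF cd(1,2)] _ smooth_transition[OF cd(1,2)]])
      (use cd in auto)
  then show "lie_bracket A X Y p d = transition_deriv c d p (lie_bracket A X Y p c)"
    using field_transform[OF Y W c d dY[OF c] dY[OF d], of "X p c"]
      field_transform[OF X W c d dX[OF c] dX[OF d], of "Y p c"]
      tangent_transform[OF X[OF W(2)] c d] tangent_transform[OF Y[OF W(2)] c d] c d
    by (simp add: lie_bracket_def linear_diff[OF lin])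
qed (simp add: lie_bracket_def)

end

lemma smooth_manifold_imp_smooth_atlas: "smooth_manifold A \<Longrightarrow> smooth_atlas A"
  unfolding smooth_manifold_def by (intro smooth_atlas.intro) auto


section \<open>The Levi-Civita connection in charts\<close>

locale riemannian_atlas = smooth_atlas A for A :: "('a, 'e::euclidean_space) chart set" +
  fixes g :: "'a \<Rightarrow> ('a, 'e) tvec \<Rightarrow> ('a, 'e) tvec \<Rightarrow> real" and nabla :: "('a, 'e) connection"
  assumes metric: "riemannian_metric A g" and levi: "levi_civita A g nabla"
begin

section \<open>Consequences of the metric and connection axioms\<close>

lemma chart_in_points: "c \<in> charts_at A p \<Longrightarrow> p \<in> points A"
  unfolding charts_at_def points_def by blast

lemma g_facts:
  assumes "c \<in> charts_at A p" "u \<in> tangent_space A p" "v \<in> tangent_space A p" "w \<in> tangent_space A p"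
  shows g_sym: "g p v w = g p w v"
    and g_lincomb: "g p (a *\<^sub>T u + b *\<^sub>T v) w = a * g p u w + b * g p v w"
    and g_pos: "v \<noteq> 0 \<Longrightarrow> g p v v > 0"
  using conjunct1[OF metric[unfolded riemannian_metric_def]] chart_in_points[OF assms(1)] assms(2-4)
  by blast+

lemma g_smooth:
  "atlas_open A W \<Longrightarrow> smooth_field A W X \<Longrightarrow> smooth_field A W Y \<Longrightarrow> smooth_function A W (\<lambda>p. g p (X p) (Y p))"
  using conjunct2[OF metric[unfolded riemannian_metric_def]] by blast

lemma nabla_facts:
  assumes W: "atlas_open A W" and Y: "smooth_field A W Y"
  shows nabla_tangent: "p \<in> W \<Longrightarrow> v \<in> tangent_space A p \<Longrightarrow> nabla p v Y \<in> tangent_space A p"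
    and nabla_lincomb: "p \<in> W \<Longrightarrow> v \<in> tangent_space A p \<Longrightarrow> w \<in> tangent_space A p \<Longrightarrow>
           nabla p (a *\<^sub>T v + b *\<^sub>T w) Y = a *\<^sub>T nabla p v Y + b *\<^sub>T nabla p w Y"
    and nabla_add: "smooth_field A W Z \<Longrightarrow> p \<in> W \<Longrightarrow> v \<in> tangent_space A p \<Longrightarrow>
           nabla p v (Y + Z) = nabla p v Y + nabla p v Z"
    and nabla_leibniz: "smooth_function A W f \<Longrightarrow> p \<in> W \<Longrightarrow> v \<in> tangent_space A p \<Longrightarrow>
           nabla p v (\<lambda>q. f q *\<^sub>T Y q) = f p *\<^sub>T nabla p v Y + dir_deriv A f p v *\<^sub>T Y p"
    and nabla_cong: "smooth_field A W Z \<Longrightarrow> (\<And>q. q \<in> W \<Longrightarrow> Y q = Z q) \<Longrightarrow> p \<in> W \<Longrightarrow> v \<in> tangent_space A p \<Longrightarrow>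
           nabla p v Y = nabla p v Z"
    and nabla_smooth: "smooth_field A W X \<Longrightarrow> smooth_field A W (\<lambda>p. nabla p (X p) Y)"
proof -
  note * = conjunct1[OF levi[unfolded levi_civita_def], unfolded affine_connection_def,
      THEN spec, THEN spec, THEN mp, OF conjI[OF W Y]]
  note 2 = conjunct2[OF *]
  note 3 = conjunct2[OF 2]
  note 4 = conjunct2[OF 3]
  note 5 = conjunct2[OF 4]
  show "p \<in> W \<Longrightarrow> v \<in> tangent_space A p \<Longrightarrow> nabla p v Y \<in> tangent_space A p"
    using conjunct1[OF *] by blast
  show "p \<in> W \<Longrightarrow> v \<in> tangent_space A p \<Longrightarrow> w \<in> tangent_space A p \<Longrightarrow>
           nabla p (a *\<^sub>T v + b *\<^sub>T w) Y = a *\<^sub>T nabla p v Y + b *\<^sub>T nabla p w Y"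
    using conjunct1[OF 2] by blast
  show "smooth_field A W Z \<Longrightarrow> p \<in> W \<Longrightarrow> v \<in> tangent_space A p \<Longrightarrow>
           nabla p v (Y + Z) = nabla p v Y + nabla p v Z"
    using conjunct1[OF 3] by blast
  show "smooth_function A W f \<Longrightarrow> p \<in> W \<Longrightarrow> v \<in> tangent_space A p \<Longrightarrow>
           nabla p v (\<lambda>q. f q *\<^sub>T Y q) = f p *\<^sub>T nabla p v Y + dir_deriv A f p v *\<^sub>T Y p"
    using conjunct1[OF 4] by blast
  show "smooth_field A W Z \<Longrightarrow> (\<And>q. q \<in> W \<Longrightarrow> Y q = Z q) \<Longrightarrow> p \<in> W \<Longrightarrow> v \<in> tangent_space A p \<Longrightarrow>
           nabla p v Y = nabla p v Z"
    using conjunct1[OF 5] by blast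
  show "smooth_field A W X \<Longrightarrow> smooth_field A W (\<lambda>p. nabla p (X p) Y)"
    using conjunct2[OF 5] by blast
qed

lemma levi_facts:
  assumes W: "atlas_open A W" and X: "smooth_field A W X" and Y: "smooth_field A W Y" and p: "p \<in> W"
  shows torsion_free: "nabla p (X p) Y - nabla p (Y p) X = lie_bracket A X Y p"
    and dir_deriv_metric: "v \<in> tangent_space A p \<Longrightarrow>
      dir_deriv A (\<lambda>q. g q (X q) (Y q)) p v = g p (nabla p v X) (Y p) + g p (X p) (nabla p v Y)"
  using conjunct2[OF levi[unfolded levi_civita_def], THEN spec, THEN spec, THEN spec, THEN mp, OF conjI[OF W conjI[OF X Y]]] p
  by blast+

lemma zero_tangent: "(\<lambda>c. 0) \<in> tangent_space A p"
  by (rule tangent_spaceI) (simp_all add: charts_at_iff linear_0[OF linear_transition_deriv])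

lemma smooth_function_const: "smooth_function A W (\<lambda>q. k)"
  by (simp add: smooth_function_def o_def smooth_on_const)

lemma smooth_field_zero: "smooth_field A W (\<lambda>q d. 0)"
  by (simp add: smooth_field_def smooth_on_const zero_tangent)

lemma smooth_field_add:
  assumes W: "atlas_open A W" and X: "smooth_field A W X" and Y: "smooth_field A W Y"
  shows "smooth_field A W (\<lambda>q d. X q d + Y q d)"
  unfolding smooth_field_def
proof (intro conjI ballI)
  fix p assume "p \<in> W"
  then show "(\<lambda>d. X p d + Y p d) \<in> tangent_space A p"
    using tangent_space_add[of "X p" p "Y p"] smooth_field_tangent X Y by (simp add: plus_fun_def)
next
  fix c assume "c \<in> A"
  then show "smooth_on (snd c ` (fst c \<inter> W)) (\<lambda>x. X (chart_inv c x) c + Y (chart_inv c x) c)"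
    by (intro smooth_on_add open_chart_image W smooth_field_chart X Y)
qed

lemma smooth_field_scale:
  assumes W: "atlas_open A W" and f: "smooth_function A W f" and Y: "smooth_field A W Y"
  shows "smooth_field A W (\<lambda>q d. f q *\<^sub>R Y q d)"
  unfolding smooth_field_def
proof (intro conjI ballI)
  fix p assume "p \<in> W"
  then show "(\<lambda>d. f p *\<^sub>R Y p d) \<in> tangent_space A p"
    using tangent_space_scale smooth_field_tangent Y by blast
next
  fix c assume c: "c \<in> A"
  then have "smooth_on (snd c ` (fst c \<inter> W)) (\<lambda>x. f (chart_inv c x))"
    using f by (auto simp: smooth_function_def o_def)
  then show "smooth_on (snd c ` (fst c \<inter> W)) (\<lambda>x. f (chart_inv c x) *\<^sub>R Y (chart_inv c x) c)"
    by (intro smooth_on_scaleR open_chart_image W smooth_field_chart Y c)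
qed

text \<open>Additivity and the Leibniz rule for a field expanded in a frame. Smoothness of the
  partial sums is carried along because additivity is available for smooth fields only.\<close>

lemma nabla_sum:
  assumes W: "atlas_open A W" and f: "\<And>j. smooth_function A W (f j)" and E: "\<And>j. smooth_field A W (E j)"
    and p: "p \<in> W" and v: "v \<in> tangent_space A p" and J: "finite J"
  shows "smooth_field A W (\<lambda>q d. \<Sum>j\<in>J. f j q *\<^sub>R E j q d) \<and>
    nabla p v (\<lambda>q d. \<Sum>j\<in>J. f j q *\<^sub>R E j q d)
      = (\<lambda>d. \<Sum>j\<in>J. f j p *\<^sub>R nabla p v (E j) d + dir_deriv A (f j) p v *\<^sub>R E j p d)"
  using J
proof induction
  case empty
  have "nabla p v (\<lambda>q d. 0) = (\<lambda>d. 0)"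
    using nabla_leibniz[OF W smooth_field_zero smooth_function_const[of _ 0] p v]
    by (simp add: plus_fun_def)
  then show ?case by (simp add: smooth_field_zero)
next
  case (insert j J)
  have s: "smooth_field A W (\<lambda>q d. f j q *\<^sub>R E j q d)" by (rule smooth_field_scale[OF W f E])
  have "(\<lambda>q d. \<Sum>j\<in>insert j J. f j q *\<^sub>R E j q d)
      = (\<lambda>q d. f j q *\<^sub>R E j q d) + (\<lambda>q d. \<Sum>j\<in>J. f j q *\<^sub>R E j q d)"
    using insert.hyps by (simp add: plus_fun_def)
  then have "nabla p v (\<lambda>q d. \<Sum>j\<in>insert j J. f j q *\<^sub>R E j q d)
     = nabla p v (\<lambda>q d. f j q *\<^sub>R E j q d) + nabla p v (\<lambda>q d. \<Sum>j\<in>J. f j q *\<^sub>R E j q d)"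
    using nabla_add[OF W s _ p v] insert.IH by simp
  moreover have "nabla p v (\<lambda>q d. f j q *\<^sub>R E j q d)
      = f j p *\<^sub>T nabla p v (E j) + dir_deriv A (f j) p v *\<^sub>T E j p"
    by (rule nabla_leibniz[OF W E f p v])
  ultimately show ?case
    using insert smooth_field_add[OF W s conjunct1[OF insert.IH]] by (simp add: plus_fun_def)
qed

section \<open>Christoffel symbols and metric coefficients\<close>

lemma linear_tvec_of: "c \<in> A \<Longrightarrow> linear (\<lambda>\<alpha>. tvec_of c p \<alpha> d)"
  by (rule linearI) (simp_all add: tvec_of_add tvec_of_scale)

definition christoffel :: "('a, 'e) chart \<Rightarrow> 'e \<Rightarrow> 'e \<Rightarrow> 'e \<Rightarrow> 'e" where
  "christoffel c x a b = nabla (chart_inv c x) (tvec_of c (chart_inv c x) a) (\<lambda>q. tvec_of c q b) c"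

definition chart_metric :: "('a, 'e) chart \<Rightarrow> 'e \<Rightarrow> 'e \<Rightarrow> 'e \<Rightarrow> real" where
  "chart_metric c x a b = g (chart_inv c x) (tvec_of c (chart_inv c x) a) (tvec_of c (chart_inv c x) b)"

lemma in_chart_image:
  assumes "c \<in> A" "x \<in> snd c ` fst c" shows "c \<in> charts_at A (chart_inv c x)" "snd c (chart_inv c x) = x"
  using assms by (auto simp: charts_at_iff chart_inv_chart)

lemma bilinear_christoffel:
  assumes c: "c \<in> A" and x: "x \<in> snd c ` fst c" shows "bilinear (christoffel c x)"
proof -
  let ?p = "chart_inv c x"
  note W = atlas_open_domain[OF c]
  note E = smooth_field_const[OF c]
  have cp: "c \<in> charts_at A ?p" by (rule in_chart_image[OF c x])
  then have p: "?p \<in> fst c" by (simp add: charts_at_iff)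
  note t = tvec_of_tangent[OF cp]
  have "linear (\<lambda>a. christoffel c x a b)" for b
  proof (rule linearI)
    fix a a' s
    have "nabla ?p (1 *\<^sub>T tvec_of c ?p a + 1 *\<^sub>T tvec_of c ?p a') (\<lambda>q. tvec_of c q b)
        = 1 *\<^sub>T nabla ?p (tvec_of c ?p a) (\<lambda>q. tvec_of c q b) + 1 *\<^sub>T nabla ?p (tvec_of c ?p a') (\<lambda>q. tvec_of c q b)"
      by (rule nabla_lincomb[OF W E p t t])
    then show "christoffel c x (a + a') b = christoffel c x a b + christoffel c x a' b"
      by (simp add: christoffel_def tvec_of_add[OF c])
    have "nabla ?p (s *\<^sub>T tvec_of c ?p a + 0 *\<^sub>T tvec_of c ?p a) (\<lambda>q. tvec_of c q b)
        = s *\<^sub>T nabla ?p (tvec_of c ?p a) (\<lambda>q. tvec_of c q b) + 0 *\<^sub>T nabla ?p (tvec_of c ?p a) (\<lambda>q. tvec_of c q b)"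
      by (rule nabla_lincomb[OF W E p t t])
    then show "christoffel c x (s *\<^sub>R a) b = s *\<^sub>R christoffel c x a b"
      by (simp add: christoffel_def tvec_of_scale[OF c] plus_fun_def)
  qed
  moreover have "linear (christoffel c x a)" for a
  proof (rule linearI)
    fix b b' s
    have "nabla ?p (tvec_of c ?p a) ((\<lambda>q. tvec_of c q b) + (\<lambda>q. tvec_of c q b'))
      = nabla ?p (tvec_of c ?p a) (\<lambda>q. tvec_of c q b) + nabla ?p (tvec_of c ?p a) (\<lambda>q. tvec_of c q b')"
      by (rule nabla_add[OF W E E p t])
    then show "christoffel c x a (b + b') = christoffel c x a b + christoffel c x a b'"
      by (simp add: christoffel_def tvec_of_add[OF c] plus_fun_def)
    \<comment> \<open>Homogeneity in the second argument is the Leibniz rule for a constant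
      function.\<close>
    have "dir_deriv A (\<lambda>q. s) ?p (tvec_of c ?p a) = 0"
      using dir_deriv_chart[OF smooth_function_const p t cp] by (simp add: o_def)
    then have "nabla ?p (tvec_of c ?p a) (\<lambda>q. s *\<^sub>T tvec_of c q b) = s *\<^sub>T nabla ?p (tvec_of c ?p a) (\<lambda>q. tvec_of c q b)"
      using nabla_leibniz[OF W E[of b] smooth_function_const[where k = s] p t[of a]] by (simp add: plus_fun_def)
    then show "christoffel c x a (s *\<^sub>R b) = s *\<^sub>R christoffel c x a b"
      by (simp add: christoffel_def tvec_of_scale[OF c])
  qed
  ultimately show ?thesis by (simp add: bilinear_def)
qed

lemma nabla_const_field:
  assumes c: "c \<in> charts_at A p" and v: "v \<in> tangent_space A p"
  shows "nabla p v (\<lambda>q. tvec_of c q b) c = christoffel c (snd c p) (v c) b"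
  using c by (simp add: christoffel_def charts_at_iff chart_inv_chart tvec_of_eq[OF v])

text \<open>On the chart domain \<open>Y\<close> is a combination of constant-coefficient fields.
  Locality of \<open>nabla\<close> permits the replacement, and \<open>nabla_sum\<close> splits the
  result into derivatives of the coefficients and Christoffel symbols.\<close>

lemma nabla_chart:
  assumes W: "atlas_open A W" and Y: "smooth_field A W Y" and p: "p \<in> W"
    and v: "v \<in> tangent_space A p" and c: "c \<in> charts_at A p"
  shows "nabla p v Y c = fd (\<lambda>x. Y (chart_inv c x) c) (snd c p) (v c) + christoffel c (snd c p) (v c) (Y p c)"
proof -
  have cA: "c \<in> A" "p \<in> fst c" using c by (auto simp: charts_at_iff)
  have inv: "chart_inv c (snd c p) = p" by (rule chart_inv_chart[OF cA])
  let ?V = "fst c \<inter> W"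
  let ?Yc = "\<lambda>x. Y (chart_inv c x) c"
  have V: "atlas_open A ?V" by (rule atlas_open_Int[OF atlas_open_domain[OF cA(1)] W])
  have pV: "p \<in> ?V" using cA p by simp
  have opV: "open (snd c ` ?V)" by (rule open_chart_image[OF cA(1) W])
  have xV: "snd c p \<in> snd c ` ?V" using pV by simp
  have smY: "smooth_on (snd c ` ?V) ?Yc" by (rule smooth_field_chart[OF Y cA(1)])
  define f where "f = (\<lambda>j q. ?Yc (snd c q) \<bullet> j)"
  have f: "smooth_function A ?V (f j)" for j
    unfolding f_def
    by (rule smooth_function_of_coords[OF cA(1) V _ smooth_on_inner_const[OF opV smY]]) simp
  have E: "smooth_field A ?V (\<lambda>q. tvec_of c q j)" for j
    by (rule smooth_field_subset[OF smooth_field_const[OF cA(1)]]) simp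
  note sum = nabla_sum[where f = f and E = "\<lambda>j q. tvec_of c q j", OF V f E pV v finite_Basis]
  have eq: "Y q = (\<lambda>d. \<Sum>j\<in>Basis. f j q *\<^sub>R tvec_of c q j d)" if q: "q \<in> ?V" for q
  proof
    fix d
    have cq: "c \<in> charts_at A q" using q cA by (simp add: charts_at_iff)
    have "Y q d = tvec_of c q (Y q c) d"
      using tvec_of_eq[OF smooth_field_tangent[OF Y] cq] q by simp
    also have "\<dots> = (\<Sum>j\<in>Basis. (Y q c \<bullet> j) *\<^sub>R tvec_of c q j d)"
      by (rule linear_basis_expansion[OF linear_tvec_of[OF cA(1)]])
    also have "Y q c = ?Yc (snd c q)" using q by (simp add: chart_inv_chart[OF cA(1)])
    finally show "Y q d = (\<Sum>j\<in>Basis. f j q *\<^sub>R tvec_of c q j d)" by (simp add: f_def)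
  qed
  have "nabla p v Y = nabla p v (\<lambda>q d. \<Sum>j\<in>Basis. f j q *\<^sub>R tvec_of c q j d)"
    by (rule nabla_cong[OF V smooth_field_subset[OF Y] conjunct1[OF sum] eq pV v]) auto
  then have "nabla p v Y c = (\<Sum>j\<in>Basis. f j p *\<^sub>R nabla p v (\<lambda>q. tvec_of c q j) c + dir_deriv A (f j) p v *\<^sub>R tvec_of c p j c)"
    using conjunct2[OF sum] by simp
  also have "\<dots> = (\<Sum>j\<in>Basis. (Y p c \<bullet> j) *\<^sub>R christoffel c (snd c p) (v c) j) + (\<Sum>j\<in>Basis. (fd ?Yc (snd c p) (v c) \<bullet> j) *\<^sub>R j)"
  proof -
    have "dir_deriv A (f j) p v = fd ?Yc (snd c p) (v c) \<bullet> j" for j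
    proof -
      have "dir_deriv A (f j) p v = fd (f j \<circ> chart_inv c) (snd c p) (v c)"
        by (rule dir_deriv_chart[OF f pV v c])
      also have "fd (f j \<circ> chart_inv c) (snd c p) = fd (\<lambda>x. ?Yc x \<bullet> j) (snd c p)"
        by (rule frechet_derivative_cong_open[OF opV xV]) (auto simp: f_def chart_inv_chart[OF cA(1)])
      also have "\<dots> (v c) = fd ?Yc (snd c p) (v c) \<bullet> j"
        by (rule fd_linear_compose[OF bounded_linear_inner_left smooth_onD[OF smY xV]])
      finally show ?thesis .
    qed
    then show ?thesis
      by (simp add: sum.distrib nabla_const_field[OF c v] tvec_of_self[OF c] f_def inv)
  qed
  also have "(\<Sum>j\<in>Basis. (Y p c \<bullet> j) *\<^sub>R christoffel c (snd c p) (v c) j) = christoffel c (snd c p) (v c) (Y p c)"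
    using linear_basis_expansion[OF bilinear_linear_right[OF bilinear_christoffel[OF cA(1)]], of "snd c p" "v c" "Y p c"] cA(2)
    by simp
  finally show ?thesis by (simp add: euclidean_representation)
qed

lemma g_tvec_of_bilinear:
  assumes cp: "c \<in> charts_at A p" shows "bilinear (\<lambda>a b. g p (tvec_of c p a) (tvec_of c p b))"
proof -
  have c: "c \<in> A" using cp by (simp add: charts_at_iff)
  note t = tvec_of_tangent[OF cp]
  have l: "linear (\<lambda>a. g p (tvec_of c p a) (tvec_of c p b))" for b
  proof (rule linearI)
    fix a a' s
    show "g p (tvec_of c p (a + a')) (tvec_of c p b) = g p (tvec_of c p a) (tvec_of c p b) + g p (tvec_of c p a') (tvec_of c p b)"
      using g_lincomb[OF cp t[of a] t[of a'] t[of b], of 1 1] by (simp add: tvec_of_add[OF c])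
    show "g p (tvec_of c p (s *\<^sub>R a)) (tvec_of c p b) = s *\<^sub>R g p (tvec_of c p a) (tvec_of c p b)"
      using g_lincomb[OF cp t[of a] t[of a] t[of b], of s 0] by (simp add: tvec_of_scale[OF c] plus_fun_def)
  qed
  moreover have "(\<lambda>b. g p (tvec_of c p a) (tvec_of c p b)) = (\<lambda>b. g p (tvec_of c p b) (tvec_of c p a))" for a
    using g_sym[OF cp t t t] by auto
  ultimately show ?thesis by (simp add: bilinear_def)
qed

lemma tvec_of_nonzero: "c \<in> charts_at A p \<Longrightarrow> a \<noteq> 0 \<Longrightarrow> tvec_of c p a \<noteq> 0"
  using tvec_of_self[of c p a] by (metis zero_fun_apply)

text \<open>All axioms are tested on constant-coefficient fields. Their brackets vanish in the
  chart, so torsion-freeness becomes symmetry of the Christoffel symbols.\<close>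

lemma geometry_in_chart:
  assumes c: "c \<in> A" shows "chart_geometry (snd c ` fst c) (christoffel c) (chart_metric c)"
proof (rule chart_geometry.intro)
  note W = atlas_open_domain[OF c]
  note E = smooth_field_const[OF c]
  show "open (snd c ` fst c)" using open_chart_image[OF c W] by simp
  show "smooth_on (snd c ` fst c) (\<lambda>x. christoffel c x a b)" for a b
    using smooth_field_chart[OF nabla_smooth[OF W E E] c, of a b] by (simp add: christoffel_def)
  show "smooth_on (snd c ` fst c) (\<lambda>x. chart_metric c x a b)" for a b
    using g_smooth[OF W E E, of a b] c by (auto simp: chart_metric_def smooth_function_def o_def)
  fix x assume x: "x \<in> snd c ` fst c"
  let ?p = "chart_inv c x"
  have cp: "c \<in> charts_at A ?p" and px: "snd c ?p = x" by (rule in_chart_image[OF c x])+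
  have p: "?p \<in> fst c" using cp by (simp add: charts_at_iff)
  note t = tvec_of_tangent[OF cp]
  show "bilinear (christoffel c x)" by (rule bilinear_christoffel[OF c x])
  show "bilinear (chart_metric c x)" unfolding chart_metric_def[abs_def] by (rule g_tvec_of_bilinear[OF cp])
  fix a b
  have const: "fd (\<lambda>x. tvec_of c (chart_inv c x) b c) x h = 0" for b h
  proof -
    have "fd (\<lambda>x. tvec_of c (chart_inv c x) b c) x = fd (\<lambda>x. b) x"
      using open_chart_image[OF c W] x tvec_of_self in_chart_image[OF c]
      by (intro frechet_derivative_cong_open[of "snd c ` fst c"]) auto
    then show ?thesis by simp
  qed
  have "lie_bracket A (\<lambda>q. tvec_of c q a) (\<lambda>q. tvec_of c q b) ?p c = 0"
    using cp by (simp add: lie_bracket_def px const)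
  then show "christoffel c x a b = christoffel c x b a"
    using fun_cong[OF torsion_free[OF W E[of a] E[of b] p], of c]
      nabla_const_field[OF cp t[of a], of b] nabla_const_field[OF cp t[of b], of a]
    by (simp add: px tvec_of_self[OF cp])
  show "chart_metric c x a b = chart_metric c x b a" unfolding chart_metric_def by (rule g_sym[OF cp t t t])
  show "chart_metric c x a a > 0" if "a \<noteq> 0"
    unfolding chart_metric_def by (rule g_pos[OF cp t t t tvec_of_nonzero[OF cp that]])
  fix w
  have n: "nabla ?p (tvec_of c ?p w) (\<lambda>q. tvec_of c q a) = tvec_of c ?p (christoffel c x w a)" for a
    using tvec_of_eq[OF nabla_tangent[OF W E[of a] p t[of w]] cp] nabla_const_field[OF cp t, of w a]
    by (simp add: px tvec_of_self[OF cp])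
  show "fd (\<lambda>y. chart_metric c y a b) x w = chart_metric c x (christoffel c x w a) b + chart_metric c x a (christoffel c x w b)"
    using dir_deriv_metric[OF W E[of a] E[of b] p t[of w]] dir_deriv_chart[OF g_smooth[OF W E[of a] E[of b]] p t[of w] cp]
    by (simp add: n px tvec_of_self[OF cp]) (simp add: chart_metric_def[abs_def] o_def)
qed

definition chart_curvature :: "('a, 'e) chart \<Rightarrow> 'e \<Rightarrow> 'e \<Rightarrow> 'e \<Rightarrow> 'e \<Rightarrow> 'e" where
  "chart_curvature c = chart_geometry.Rm (christoffel c)"

text \<open>Applying \<open>nabla_chart\<close> twice, the second derivatives of \<open>Z\<close>
  cancel by symmetry and the derivatives of \<open>X\<close> and \<open>Y\<close> are absorbed by
  the bracket term. What remains is the expression \<open>Rm\<close> in the values at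
  \<open>p\<close>.\<close>

lemma curvature_chart:
  assumes W: "atlas_open A W" and X: "smooth_field A W X" and Y: "smooth_field A W Y" and Z: "smooth_field A W Z"
    and p: "p \<in> W" and c: "c \<in> charts_at A p"
  shows "curvature A nabla X Y Z p c = chart_curvature c (snd c p) (X p c) (Y p c) (Z p c)"
proof -
  have cA: "c \<in> A" "p \<in> fst c" using c by (auto simp: charts_at_iff)
  interpret chart_geometry "snd c ` fst c" "christoffel c" "chart_metric c" by (rule geometry_in_chart[OF cA(1)])
  let ?x = "snd c p" and ?V = "snd c ` (fst c \<inter> W)"
  have inv: "chart_inv c ?x = p" by (rule chart_inv_chart[OF cA])
  have V: "open ?V" by (rule open_chart_image[OF cA(1) W])
  have xV: "?x \<in> ?V" and xU: "?x \<in> snd c ` fst c" using cA p by auto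
  let ?c = "\<lambda>Y x. Y (chart_inv c x) c"
  have ext: "nabla p (X p) (\<lambda>q. nabla q (Y q) Z) c =
      fd (\<lambda>x. fd (?c Z) x (Y p c)) ?x (X p c) + fd (?c Z) ?x (fd (?c Y) ?x (X p c))
      + (fd (\<lambda>x. christoffel c x (Y p c) (Z p c)) ?x (X p c) + christoffel c ?x (fd (?c Y) ?x (X p c)) (Z p c)
         + christoffel c ?x (Y p c) (fd (?c Z) ?x (X p c)))
      + christoffel c ?x (X p c) (fd (?c Z) ?x (Y p c) + christoffel c ?x (Y p c) (Z p c))"
    if X: "smooth_field A W X" and Y: "smooth_field A W Y" for X Y
  proof -
    have smY: "smooth_on ?V (?c Y)" by (rule smooth_field_chart[OF Y cA(1)])
    have smZ: "smooth_on ?V (?c Z)" by (rule smooth_field_chart[OF Z cA(1)])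
    note dY = smooth_on_has_derivative[OF smY xV] and dZ = smooth_on_has_derivative[OF smZ xV]
    have nab: "nabla q (Y q) Z c = fd (?c Z) (snd c q) (Y q c) + christoffel c (snd c q) (Y q c) (Z q c)"
      if "q \<in> fst c \<inter> W" for q
      using that cA by (intro nabla_chart[OF W Z] smooth_field_tangent[OF Y]) (auto simp: charts_at_iff)
    have d1: "((\<lambda>x. fd (?c Z) x (?c Y x)) has_derivative
        (\<lambda>h. fd (\<lambda>x. fd (?c Z) x (?c Y ?x)) ?x h + fd (?c Z) ?x (fd (?c Y) ?x h))) (at ?x)"
      by (intro has_derivative_linear_family[OF V xV _ _ dY] linear_frechet_derivative smooth_onD[OF smZ]
        smooth_onD[OF smooth_on_frechet[OF smZ] xV])
    have d2: "((\<lambda>x. christoffel c x (?c Y x) (?c Z x)) has_derivative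
        (\<lambda>h. fd (\<lambda>x. christoffel c x (?c Y ?x) (?c Z ?x)) ?x h + christoffel c ?x (fd (?c Y) ?x h) (?c Z ?x)
          + christoffel c ?x (?c Y ?x) (fd (?c Z) ?x h))) (at ?x)"
      by (rule has_derivative_bilinear_family[OF open_U xU bilinear_\<Gamma> differentiable_\<Gamma>[OF xU] dY dZ])
    have "fd (\<lambda>x. nabla (chart_inv c x) (Y (chart_inv c x)) Z c) ?x
      = fd (\<lambda>x. fd (?c Z) x (?c Y x) + christoffel c x (?c Y x) (?c Z x)) ?x"
      by (rule frechet_derivative_cong_open[OF V xV]) (auto simp: chart_inv_chart[OF cA(1)] nab)
    moreover have "nabla p (X p) (\<lambda>q. nabla q (Y q) Z) c =
      fd (\<lambda>x. nabla (chart_inv c x) (Y (chart_inv c x)) Z c) ?x (X p c) + christoffel c ?x (X p c) (nabla p (Y p) Z c)"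
      by (rule nabla_chart[OF W nabla_smooth[OF W Z Y] p smooth_field_tangent[OF X p] c])
    moreover have "nabla p (Y p) Z c = fd (?c Z) ?x (Y p c) + christoffel c ?x (Y p c) (Z p c)"
      using nab[of p] cA p by simp
    ultimately show ?thesis
      by (simp add: frechet_derivative_eqI[OF has_derivative_add[OF d1 d2]] inv)
  qed
  let ?L = "lie_bracket A X Y p"
  have L: "?L \<in> tangent_space A p"
    unfolding torsion_free[OF W X Y p, symmetric]
    by (intro tangent_space_diff nabla_tangent[OF W _ p] X Y smooth_field_tangent[OF _ p])
  have Lc: "?L c = fd (?c Y) ?x (X p c) - fd (?c X) ?x (Y p c)"
    using c by (simp add: lie_bracket_def)
  have sym: "fd (\<lambda>x. fd (?c Z) x (Y p c)) ?x (X p c) = fd (\<lambda>x. fd (?c Z) x (X p c)) ?x (Y p c)"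
    by (rule smooth_on_second_derivative_symmetric[OF V xV smooth_field_chart[OF Z cA(1)]])
  have linZ: "linear (fd (?c Z) ?x)"
    by (rule linear_frechet_derivative[OF smooth_onD[OF smooth_field_chart[OF Z cA(1)] xV]])
  show ?thesis
    unfolding curvature_def chart_curvature_def Rm_def
    using nabla_chart[OF W Z p L c] ext[OF X Y] ext[OF Y X] sym
    by (simp add: Lc linear_diff[OF linZ] \<Gamma>_simps xU)
qed

end


section \<open>The tangent bundle\<close>

context smooth_atlas
begin

lemma in_tangent_chart: "(p, v) \<in> fst (tangent_chart A c) \<longleftrightarrow> p \<in> fst c \<and> v \<in> tangent_space A p"
  by (simp add: tangent_chart_def)

lemma tangent_chart_apply: "snd (tangent_chart A c) (p, v) = (snd c p, v c)"
  by (simp add: tangent_chart_def)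

lemma inj_tangent_chart:
  assumes c: "c \<in> A" shows "inj_on (snd (tangent_chart A c)) (fst (tangent_chart A c))"
proof (rule inj_onI)
  fix u u' assume "u \<in> fst (tangent_chart A c)" "u' \<in> fst (tangent_chart A c)"
    and eq: "snd (tangent_chart A c) u = snd (tangent_chart A c) u'"
  moreover obtain p v p' v' where "u = (p, v)" "u' = (p', v')" by (cases u, cases u') auto
  moreover have "p = p'"
    using inj[OF c] calculation by (auto simp: in_tangent_chart tangent_chart_apply inj_on_def)
  ultimately show "u = u'"
    using tangent_eqI[of v p v' c] c by (auto simp: in_tangent_chart tangent_chart_apply charts_at_iff)
qed

lemma tangent_chart_inv:
  assumes c: "c \<in> A" and x: "x \<in> snd c ` fst c"
  shows "chart_inv (tangent_chart A c) (x, w) = (chart_inv c x, tvec_of c (chart_inv c x) w)"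
proof -
  let ?p = "chart_inv c x"
  have p: "?p \<in> fst c" "snd c ?p = x" using x c by (auto simp: chart_inv_chart)
  then have cp: "c \<in> charts_at A ?p" using c by (simp add: charts_at_iff)
  have "chart_inv (tangent_chart A c) (snd (tangent_chart A c) (?p, tvec_of c ?p w)) = (?p, tvec_of c ?p w)"
    unfolding chart_inv_def[of "tangent_chart A c"]
    by (rule inv_into_f_f[OF inj_tangent_chart[OF c]]) (simp add: in_tangent_chart p tvec_of_tangent[OF cp])
  then show ?thesis by (simp add: tangent_chart_apply p tvec_of_self[OF cp])
qed

lemma tangent_chart_image:
  assumes c: "c \<in> A"
  shows "snd (tangent_chart A c) ` (fst (tangent_chart A c) \<inter> W)
    = {(x, w). x \<in> snd c ` fst c \<and> (chart_inv c x, tvec_of c (chart_inv c x) w) \<in> W}"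
proof (intro equalityI subsetI)
  fix z assume "z \<in> snd (tangent_chart A c) ` (fst (tangent_chart A c) \<inter> W)"
  then obtain p v where "z = (snd c p, v c)" "p \<in> fst c" "v \<in> tangent_space A p" "(p, v) \<in> W"
    by (auto simp: in_tangent_chart tangent_chart_apply)
  then show "z \<in> {(x, w). x \<in> snd c ` fst c \<and> (chart_inv c x, tvec_of c (chart_inv c x) w) \<in> W}"
    using c by (simp add: chart_inv_chart tvec_of_eq charts_at_iff)
next
  fix z assume "z \<in> {(x, w). x \<in> snd c ` fst c \<and> (chart_inv c x, tvec_of c (chart_inv c x) w) \<in> W}"
  then obtain p w where z: "z = (snd c p, w)" "p \<in> fst c" "(p, tvec_of c p w) \<in> W"
    using c by (auto simp: chart_inv_chart)
  then have cp: "c \<in> charts_at A p" using c by (simp add: charts_at_iff)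
  show "z \<in> snd (tangent_chart A c) ` (fst (tangent_chart A c) \<inter> W)"
    by (rule image_eqI[where x = "(p, tvec_of c p w)"])
      (use z in \<open>simp_all add: tangent_chart_apply in_tangent_chart tvec_of_self[OF cp] tvec_of_tangent[OF cp]\<close>)
qed

lemma tangent_chart_overlap:
  assumes c: "c \<in> A" and d: "d \<in> A"
  shows "snd (tangent_chart A c) ` (fst (tangent_chart A c) \<inter> fst (tangent_chart A d))
    = (snd c ` (fst c \<inter> fst d)) \<times> UNIV"
proof -
  have "x \<in> snd c ` (fst c \<inter> fst d)" if "x \<in> snd c ` fst c" "chart_inv c x \<in> fst d" for x
    using that c by (auto simp: chart_inv_chart)
  then show ?thesis
    unfolding tangent_chart_image[OF c] using c tvec_of_tangent[of c]
    by (auto simp: in_tangent_chart chart_inv_chart charts_at_iff)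
qed

text \<open>The transition map is \<open>(x, w)\<close> to the pair of the base transition at
  \<open>x\<close> and its derivative applied to \<open>w\<close>; the second entry is a smooth
  family of linear maps.\<close>

lemma smooth_atlas_tangent: "smooth_atlas (tangent_atlas A)"
proof (rule smooth_atlas.intro)
  fix c' assume "c' \<in> tangent_atlas A"
  then obtain c where c: "c \<in> A" "c' = tangent_chart A c" by (auto simp: tangent_atlas_def)
  show "inj_on (snd c') (fst c')" using inj_tangent_chart c by simp
  fix d' assume "d' \<in> tangent_atlas A"
  then obtain d where d: "d \<in> A" "d' = tangent_chart A d" by (auto simp: tangent_atlas_def)
  let ?V = "snd c ` (fst c \<inter> fst d)"
  have img: "snd c' ` (fst c' \<inter> fst d') = ?V \<times> UNIV"
    using tangent_chart_overlap c d by simp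
  have V: "open ?V" by (rule open_overlap[OF c(1) d(1)])
  then show op: "open (snd c' ` (fst c' \<inter> fst d'))" unfolding img by (rule open_Times) simp
  have op': "open (?V \<times> (UNIV :: 'e set))" using op img by simp
  have sm: "smooth_on ?V (snd d \<circ> chart_inv c)" by (rule smooth_transition[OF c(1) d(1)])
  have fst: "smooth_on (?V \<times> (UNIV :: 'e set)) fst" and snd: "smooth_on (?V \<times> (UNIV :: 'e set)) snd"
    by (rule smooth_on_bounded_linear[OF bounded_linear_fst] smooth_on_bounded_linear[OF bounded_linear_snd])+
  have "smooth_on (?V \<times> UNIV) (\<lambda>z. ((snd d \<circ> chart_inv c) (fst z), fd (snd d \<circ> chart_inv c) (fst z) (snd z)))"
  proof (rule smooth_on_Pair[OF op'])
    show "smooth_on (?V \<times> (UNIV :: 'e set)) (\<lambda>z. (snd d \<circ> chart_inv c) (fst z))"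
      by (rule smooth_on_compose[OF op' V _ sm fst]) auto
    show "smooth_on (?V \<times> UNIV) (\<lambda>z. fd (snd d \<circ> chart_inv c) (fst z) (snd z))"
    proof (rule smooth_on_linear_family[OF op' _ _ snd])
      show "smooth_on (?V \<times> (UNIV :: 'e set)) (\<lambda>z. fd (snd d \<circ> chart_inv c) (fst z) i)" for i
        by (rule smooth_on_compose[OF op' V _ smooth_on_frechet[OF sm] fst]) auto
      show "linear (fd (snd d \<circ> chart_inv c) (fst z))" if "z \<in> ?V \<times> UNIV" for z :: "'e \<times> 'e"
        using that by (intro linear_frechet_derivative smooth_onD[OF sm]) auto
    qed
  qed
  then show "smooth_on (snd c' ` (fst c' \<inter> fst d')) (snd d' \<circ> chart_inv c')"
    unfolding img
  proof (rule smooth_on_cong[OF op', rotated])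
    fix z :: "'e \<times> 'e" assume "z \<in> ?V \<times> UNIV"
    then obtain p w where p: "z = (snd c p, w)" "p \<in> fst c" "p \<in> fst d" by auto
    then show "((snd d \<circ> chart_inv c) (fst z), fd (snd d \<circ> chart_inv c) (fst z) (snd z)) = (snd d' \<circ> chart_inv c') z"
      using c d by (simp add: tangent_chart_inv chart_inv_chart tangent_chart_apply tvec_of_def charts_at_iff transition_deriv_def)
  qed
qed

lemma charts_at_tangent:
  "d' \<in> charts_at (tangent_atlas A) (p, v) \<longleftrightarrow> v \<in> tangent_space A p \<and> (\<exists>c\<in>charts_at A p. d' = tangent_chart A c)"
  unfolding charts_at_def tangent_atlas_def using in_tangent_chart by blast

lemma tangent_chart_at:
  "c \<in> charts_at A p \<Longrightarrow> v \<in> tangent_space A p \<Longrightarrow> tangent_chart A c \<in> charts_at (tangent_atlas A) (p, v)"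
  by (auto simp: charts_at_tangent)

text \<open>The curve is required to stay in every chart around its point; vertical curves do so
  because they remain in one fibre.\<close>

lemma velocity_tangent:
  assumes \<gamma>: "\<And>c s. c \<in> charts_at A (\<gamma> t) \<Longrightarrow> \<gamma> s \<in> fst c"
    and d: "\<And>c. c \<in> charts_at A (\<gamma> t) \<Longrightarrow> (snd c \<circ> \<gamma>) differentiable (at t)"
  shows "velocity A \<gamma> t \<in> tangent_space A (\<gamma> t)"
proof (rule tangent_spaceI)
  fix c d assume c: "c \<in> charts_at A (\<gamma> t)" and d': "d \<in> charts_at A (\<gamma> t)"
  have cd: "c \<in> A" "d \<in> A" "\<gamma> t \<in> fst c" "\<gamma> t \<in> fst d" using c d' by (auto simp: charts_at_iff)
  have 1: "((snd c \<circ> \<gamma>) has_vector_derivative vector_derivative (snd c \<circ> \<gamma>) (at t)) (at t)"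
    using d[OF c] vector_derivative_works by blast
  have "((snd d \<circ> chart_inv c) has_derivative transition_deriv c d (\<gamma> t)) (at ((snd c \<circ> \<gamma>) t))"
    using has_derivative_transition[OF cd] by simp
  from has_derivative_compose[OF 1[unfolded has_vector_derivative_def] this]
  have "((\<lambda>s. (snd d \<circ> chart_inv c) ((snd c \<circ> \<gamma>) s)) has_vector_derivative
      transition_deriv c d (\<gamma> t) (vector_derivative (snd c \<circ> \<gamma>) (at t))) (at t)"
    by (simp add: has_vector_derivative_def linear_cmul[OF linear_transition_deriv[OF cd]])
  moreover have "(\<lambda>s. (snd d \<circ> chart_inv c) ((snd c \<circ> \<gamma>) s)) = snd d \<circ> \<gamma>"
    using \<gamma>[OF c] by (auto simp: chart_inv_chart[OF cd(1)])
  ultimately show "velocity A \<gamma> t d = transition_deriv c d (\<gamma> t) (velocity A \<gamma> t c)"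
    using c d' by (simp add: velocity_def vector_derivative_at)
qed (simp add: velocity_def)

end

context riemannian_atlas
begin

sublocale T: smooth_atlas "tangent_atlas A"
  by (rule smooth_atlas_tangent)

section \<open>Vertical and horizontal lifts in tangent charts\<close>

lemma vertical_lift_facts:
  assumes v: "v \<in> tangent_space A p" and w: "w \<in> tangent_space A p"
  shows vertical_lift_tangent: "vertical_lift A (p, v) w \<in> tangent_space (tangent_atlas A) (p, v)"
    and vertical_lift_chart: "c \<in> charts_at A p \<Longrightarrow> vertical_lift A (p, v) w (tangent_chart A c) = (0, w c)"
proof -
  let ?\<gamma> = "\<lambda>t. (fst (p, v), snd (p, v) + t *\<^sub>T w)"
  have \<gamma>0: "?\<gamma> 0 = (p, v)" by (simp add: plus_fun_def)
  have t: "v + s *\<^sub>T w \<in> tangent_space A p" for s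
    by (intro tangent_space_add v tangent_space_scale w)
  have der: "((snd (tangent_chart A c) \<circ> ?\<gamma>) has_vector_derivative (0, w c)) (at 0)" for c
  proof -
    have "((\<lambda>t. (snd c p, v c + t *\<^sub>R w c)) has_vector_derivative (0, w c)) (at 0)"
      unfolding has_vector_derivative_def by (auto intro!: derivative_eq_intros)
    then show ?thesis by (simp add: o_def tangent_chart_apply)
  qed
  have "velocity (tangent_atlas A) ?\<gamma> 0 \<in> tangent_space (tangent_atlas A) (?\<gamma> 0)"
  proof (rule T.velocity_tangent)
    fix c' s assume "c' \<in> charts_at (tangent_atlas A) (?\<gamma> 0)"
    then obtain c where c: "c \<in> charts_at A p" "c' = tangent_chart A c"
      unfolding \<gamma>0 charts_at_tangent by blast
    then show "?\<gamma> s \<in> fst c'" using t by (simp add: in_tangent_chart charts_at_iff)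
    show "(snd c' \<circ> ?\<gamma>) differentiable (at 0)"
      unfolding c(2) using der by (rule differentiableI_vector)
  qed
  then show "vertical_lift A (p, v) w \<in> tangent_space (tangent_atlas A) (p, v)"
    unfolding vertical_lift_def \<gamma>0 .
  show "vertical_lift A (p, v) w (tangent_chart A c) = (0, w c)" if "c \<in> charts_at A p"
    unfolding vertical_lift_def velocity_def \<gamma>0
    using tangent_chart_at[OF that v] vector_derivative_at[OF der[of c]] by simp
qed

text \<open>Members of \<open>horizontal_space\<close> are given as differentials of sections; the
  second component found here is the derivative that the parallel condition expresses through
  Christoffel symbols.\<close>

lemma section_facts:
  assumes W: "atlas_open A W" and Y: "smooth_field A W Y" and p: "p \<in> W" and w: "w \<in> tangent_space A p"
  defines "\<xi> \<equiv> differential A (tangent_atlas A) (\<lambda>q. (q, Y q)) p w"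
  shows section_chart: "c \<in> charts_at A p \<Longrightarrow>
      \<xi> (tangent_chart A c) = (w c, fd (\<lambda>x. Y (chart_inv c x) c) (snd c p) (w c))"
    and section_tangent: "\<xi> \<in> tangent_space (tangent_atlas A) (p, Y p)"
proof -
  let ?s = "\<lambda>q. (q, Y q)"
  let ?Yc = "\<lambda>c x. Y (chart_inv c x) c"
  have Yp: "Y p \<in> tangent_space A p" by (rule smooth_field_tangent[OF Y p])
  have s_der: "((snd (tangent_chart A c) \<circ> ?s \<circ> chart_inv c) has_derivative
      (\<lambda>h. (h, fd (?Yc c) (snd c p) h))) (at (snd c p))" if c: "c \<in> charts_at A p" for c
  proof -
    have cA: "c \<in> A" "p \<in> fst c" using c by (auto simp: charts_at_iff)
    have "((\<lambda>x. (x, ?Yc c x)) has_derivative (\<lambda>h. (h, fd (?Yc c) (snd c p) h))) (at (snd c p))"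
      by (intro has_derivative_Pair has_derivative_ident smooth_on_has_derivative[OF smooth_field_chart[OF Y cA(1)]])
        (use cA p in auto)
    then show ?thesis
      by (rule has_derivative_transform_within_open[OF _ open_chart_image[OF cA(1) W]])
        (use cA p in \<open>auto simp: tangent_chart_apply chart_inv_chart[OF cA(1)]\<close>)
  qed
  show chart: "\<xi> (tangent_chart A c) = (w c, fd (?Yc c) (snd c p) (w c))" if c: "c \<in> charts_at A p" for c
  proof -
    have "\<xi> (tangent_chart A c) = fd (snd (tangent_chart A c) \<circ> ?s \<circ> chart_inv c) (snd c p) (w c)"
      unfolding \<xi>_def
      by (rule differential_chart[where G = ?s, OF w c tangent_chart_at[OF c Yp]])
        (use s_der[OF c] in \<open>auto simp: differentiable_def\<close>)
    then show ?thesis by (simp add: frechet_derivative_eqI[OF s_der[OF c]])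
  qed
  show "\<xi> \<in> tangent_space (tangent_atlas A) (p, Y p)"
  proof (rule T.tangent_spaceI)
    fix c' d' assume c': "c' \<in> charts_at (tangent_atlas A) (p, Y p)" and d': "d' \<in> charts_at (tangent_atlas A) (p, Y p)"
    obtain c where c: "c \<in> charts_at A p" "c' = tangent_chart A c" using c' charts_at_tangent by blast
    obtain d where d: "d \<in> charts_at A p" "d' = tangent_chart A d" using d' charts_at_tangent by blast
    have cA: "c \<in> A" "p \<in> fst c" "d \<in> A" "p \<in> fst d" using c d by (auto simp: charts_at_iff)
    have inv: "chart_inv c (snd c p) = p" by (rule chart_inv_chart[OF cA(1,2)])
    let ?V = "snd c ` (fst c \<inter> (fst d \<inter> W))"
    have "((snd d' \<circ> chart_inv c') has_derivative T.transition_deriv c' d' (p, Y p))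
        (at ((snd c' \<circ> ?s \<circ> chart_inv c) (snd c p)))"
      using T.has_derivative_transition[of c' d' "(p, Y p)"] c' d' by (simp add: T.charts_at_iff inv)
    from has_derivative_compose[OF s_der[OF c(1)] this[unfolded c(2)]]
    have "((snd d' \<circ> ?s \<circ> chart_inv c) has_derivative (\<lambda>h. T.transition_deriv c' d' (p, Y p) (h, fd (?Yc c) (snd c p) h))) (at (snd c p))"
      unfolding c(2)
    proof (rule has_derivative_transform_within_open
        [OF _ open_chart_image[OF cA(1) atlas_open_Int[OF atlas_open_domain[OF cA(3)] W]]])
      show "snd c p \<in> ?V" using cA p by auto
      fix x assume "x \<in> ?V"
      then obtain q where q: "x = snd c q" "q \<in> fst c" "q \<in> W" by auto
      have cq: "c \<in> charts_at A q" using q cA by (simp add: charts_at_iff)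
      show "(snd d' \<circ> chart_inv (tangent_chart A c)) ((snd (tangent_chart A c) \<circ> ?s \<circ> chart_inv c) x)
        = (snd d' \<circ> ?s \<circ> chart_inv c) x"
        using q cA tvec_of_eq[OF smooth_field_tangent[OF Y q(3)] cq]
        by (simp add: chart_inv_chart tangent_chart_apply tangent_chart_inv)
    qed
    note der = this
    have "\<xi> d' = fd (snd d' \<circ> ?s \<circ> chart_inv c) (snd c p) (w c)"
      unfolding \<xi>_def using d' der by (intro differential_chart[OF w c(1)]) (auto intro: differentiableI)
    also have "\<dots> = T.transition_deriv c' d' (p, Y p) (\<xi> c')"
      by (simp add: frechet_derivative_eqI[OF der] chart[OF c(1)] c(2))
    finally show "\<xi> d' = T.transition_deriv c' d' (p, Y p) (\<xi> c')" .
  qed (simp add: \<xi>_def differential_def)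
qed

lemma projection_chart:
  assumes v: "v \<in> tangent_space A p" and \<xi>: "\<xi> \<in> tangent_space (tangent_atlas A) (p, v)" and c: "c \<in> charts_at A p"
  shows "differential (tangent_atlas A) A fst (p, v) \<xi> c = fst (\<xi> (tangent_chart A c))"
proof -
  have cA: "c \<in> A" "p \<in> fst c" using c by (auto simp: charts_at_iff)
  have V: "open (snd c ` fst c \<times> (UNIV :: 'e set))"
    using open_chart_image[OF cA(1) atlas_open_domain[OF cA(1)]] by (intro open_Times) auto
  have d: "((snd c \<circ> fst \<circ> chart_inv (tangent_chart A c)) has_derivative fst) (at (snd (tangent_chart A c) (p, v)))"
    by (rule has_derivative_transform_within_open[OF bounded_linear_imp_has_derivative[OF bounded_linear_fst] V])
      (use cA in \<open>auto simp: tangent_chart_apply tangent_chart_inv chart_inv_chart\<close>)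
  have "differential (tangent_atlas A) A fst (p, v) \<xi> c
    = fd (snd c \<circ> fst \<circ> chart_inv (tangent_chart A c)) (snd (tangent_chart A c) (p, v)) (\<xi> (tangent_chart A c))"
    using c d by (intro T.differential_chart[OF \<xi> tangent_chart_at[OF c v]]) (auto intro: differentiableI)
  then show ?thesis by (simp add: frechet_derivative_eqI[OF d])
qed

text \<open>This gives existence of horizontal lifts, since horizontal vectors are defined through
  sections parallel at a point.\<close>

lemma parallel_section_exists:
  assumes c: "c \<in> charts_at A p" and v: "v \<in> tangent_space A p" and w: "w \<in> tangent_space A p"
  shows "\<exists>Y. smooth_field A (fst c) Y \<and> Y p = v \<and> nabla p w Y = 0"
proof -
  have cA: "c \<in> A" "p \<in> fst c" using c by (auto simp: charts_at_iff)
  note W = atlas_open_domain[OF cA(1)]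
  let ?x = "snd c p"
  \<comment> \<open>An affine coefficient with value \<open>v\<close> at \<open>p\<close>, whose
    derivative there is chosen to cancel the Christoffel term in every direction.\<close>
  define h where "h = (\<lambda>x. v c - christoffel c ?x (x - ?x) (v c))"
  have lin: "linear (\<lambda>a. christoffel c ?x a (v c))"
    using bilinear_linear_left[OF bilinear_christoffel[OF cA(1)]] cA(2) by blast
  have bl: "bounded_linear (\<lambda>a. christoffel c ?x a (v c))" using lin by (simp add: linear_conv_bounded_linear)
  have h_eq: "h = (\<lambda>x. (v c + christoffel c ?x ?x (v c)) + - christoffel c ?x x (v c))"
    using linear_diff[OF lin] by (auto simp: h_def)
  have op: "open (snd c ` fst c)" using open_chart_image[OF cA(1) W] by simp
  have sm: "smooth_on (snd c ` fst c) h"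
    unfolding h_eq
    by (intro smooth_on_add[OF op] smooth_on_const smooth_on_bounded_linear bounded_linear_minus bl)
  define Y where "Y = (\<lambda>q. tvec_of c q (h (snd c q)))"
  have Y: "smooth_field A (fst c) Y"
    unfolding Y_def by (rule smooth_field_of_coords[OF cA(1) W order_refl sm])
  have Yp: "Y p = v" using linear_0[OF lin] tvec_of_eq[OF v c] by (simp add: Y_def h_def)
  have hd: "(h has_derivative (\<lambda>a. - christoffel c ?x a (v c))) (at ?x)"
    unfolding h_eq
    using has_derivative_add[OF has_derivative_const has_derivative_minus[OF bounded_linear_imp_has_derivative[OF bl]]]
    by simp
  have "fd (\<lambda>x. Y (chart_inv c x) c) ?x = fd h ?x"
    by (rule frechet_derivative_cong_open[OF op])
      (use cA in \<open>auto simp: Y_def chart_inv_chart tvec_of_self charts_at_iff\<close>)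
  then have "nabla p w Y c = 0"
    using nabla_chart[OF W Y cA(2) w c] by (simp add: frechet_derivative_eqI[OF hd] Yp)
  then have "nabla p w Y = 0"
    by (rule tangent_eq_0I[OF c nabla_tangent[OF W Y cA(2) w]])
  then show ?thesis using Y Yp by blast
qed

text \<open>The definite description is well defined. The projection identifies the direction of any
  candidate with \<open>w\<close>, and the parallel condition then fixes its vertical component in
  each chart, whatever section represents it.\<close>

lemma horizontal_lift_facts:
  assumes p: "p \<in> points A" and v: "v \<in> tangent_space A p" and w: "w \<in> tangent_space A p"
  shows horizontal_lift_tangent: "horizontal_lift A nabla (p, v) w \<in> tangent_space (tangent_atlas A) (p, v)"
    and horizontal_lift_chart: "c \<in> charts_at A p \<Longrightarrow>
      horizontal_lift A nabla (p, v) w (tangent_chart A c) = (w c, - christoffel c (snd c p) (w c) (v c))"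
proof -
  obtain c0 where c0: "c0 \<in> charts_at A p" using p by (auto simp: points_def charts_at_def)
  let ?P = "\<lambda>\<xi>. \<xi> \<in> horizontal_space A nabla (p, v) \<and> differential (tangent_atlas A) A fst (p, v) \<xi> = w"
  have chart: "\<xi> \<in> tangent_space (tangent_atlas A) (p, v) \<and>
      (\<forall>c\<in>charts_at A p. \<xi> (tangent_chart A c) = (w c, - christoffel c (snd c p) (w c) (v c)))" if "?P \<xi>" for \<xi>
  proof -
    from that obtain W Y w' where \<xi>: "\<xi> = differential A (tangent_atlas A) (\<lambda>q. (q, Y q)) p w'"
      and W: "atlas_open A W" and pW: "p \<in> W" and Y: "smooth_field A W Y" and Yp: "Y p = v"
      and w': "w' \<in> tangent_space A p" and par: "nabla p w' Y = 0"
      by (auto simp: horizontal_space_def)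
    note sec = section_facts[OF W Y pW w', folded \<xi>, unfolded Yp]
    have "w' = w"
      using projection_chart[OF v sec(2) c0] sec(1)[OF c0] that
      by (intro tangent_eqI[OF w' w c0]) auto
    moreover have "fd (\<lambda>x. Y (chart_inv c x) c) (snd c p) (w' c) = - christoffel c (snd c p) (w' c) (v c)"
      if c: "c \<in> charts_at A p" for c
      using nabla_chart[OF W Y pW w' c] by (simp add: par Yp eq_neg_iff_add_eq_0)
    ultimately show ?thesis using sec by simp
  qed
  obtain Y where Y: "smooth_field A (fst c0) Y" "Y p = v" "nabla p w Y = 0"
    using parallel_section_exists[OF c0 v w] by blast
  have W: "atlas_open A (fst c0)" and pW: "p \<in> fst c0"
    using c0 atlas_open_domain by (auto simp: charts_at_iff)
  let ?\<xi> = "differential A (tangent_atlas A) (\<lambda>q. (q, Y q)) p w"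
  note sec = section_facts[OF W Y(1) pW w, unfolded Y(2)]
  have "?P ?\<xi>"
  proof
    show "?\<xi> \<in> horizontal_space A nabla (p, v)"
      unfolding horizontal_space_def using W pW Y w by force
    show "differential (tangent_atlas A) A fst (p, v) ?\<xi> = w"
    proof
      fix c show "differential (tangent_atlas A) A fst (p, v) ?\<xi> c = w c"
      proof (cases "c \<in> charts_at A p")
        case True
        then show ?thesis using projection_chart[OF v sec(2) True] sec(1)[OF True] by simp
      next
        case False
        then show ?thesis using tangent_outside[OF w False] by (simp add: differential_def)
      qed
    qed
  qed
  moreover have "\<xi> = \<xi>'" if "?P \<xi>" "?P \<xi>'" for \<xi> \<xi>'
    using chart[OF that(1)] chart[OF that(2)] c0
    by (intro T.tangent_eqI[OF _ _ tangent_chart_at[OF c0 v]]) auto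
  ultimately have "\<exists>!\<xi>. ?P \<xi>" by blast
  then have "?P (horizontal_lift A nabla (p, v) w)"
    unfolding horizontal_lift_def by (rule theI')
  from chart[OF this]
  show "horizontal_lift A nabla (p, v) w \<in> tangent_space (tangent_atlas A) (p, v)"
    "c \<in> charts_at A p \<Longrightarrow>
      horizontal_lift A nabla (p, v) w (tangent_chart A c) = (w c, - christoffel c (snd c p) (w c) (v c))"
    by auto
qed

text \<open>The splitting determines both lifts of a candidate from the components of
  \<open>\<xi>\<close>, so the description has one solution. The weight is a constant function here
  because the point of the bundle is fixed.\<close>

lemma weighted_J_facts:
  assumes p: "p \<in> points A" and v: "v \<in> tangent_space A p"
    and \<xi>: "\<xi> \<in> tangent_space (tangent_atlas A) (p, v)"
  defines "r \<equiv> fibre_norm g (p, v)"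
  shows weighted_J_tangent: "weighted_J A g nabla \<mu> lam (p, v) \<xi> \<in> tangent_space (tangent_atlas A) (p, v)"
    and weighted_J_chart: "c \<in> charts_at A p \<Longrightarrow>
      weighted_J A g nabla \<mu> lam (p, v) \<xi> (tangent_chart A c) =
      coord_J (christoffel c) (\<lambda>_. \<mu> r / lam r) (snd c p, v c) (\<xi> (tangent_chart A c))"
proof -
  let ?h = "horizontal_lift A nabla (p, v)" and ?v = "vertical_lift A (p, v)"
  let ?Q = "\<lambda>\<eta> a b. a \<in> tangent_space A p \<and> b \<in> tangent_space A p \<and> \<xi> = ?h a + ?v b \<and>
       \<eta> = (\<mu> r / lam r) *\<^sub>T ?v a - (lam r / \<mu> r) *\<^sub>T ?h b"
  obtain c0 where c0: "c0 \<in> charts_at A p" using p by (auto simp: points_def charts_at_def)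
  note hl = horizontal_lift_facts[OF p v] and vl = vertical_lift_facts[OF v]
  have chart: "\<eta> \<in> tangent_space (tangent_atlas A) (p, v) \<and> (\<forall>c\<in>charts_at A p. \<eta> (tangent_chart A c) =
      coord_J (christoffel c) (\<lambda>_. \<mu> r / lam r) (snd c p, v c) (\<xi> (tangent_chart A c)))" if "?Q \<eta> a b" for \<eta> a b
  proof (intro conjI ballI)
    show "\<eta> \<in> tangent_space (tangent_atlas A) (p, v)"
      using that by (auto intro!: T.tangent_space_diff T.tangent_space_scale hl vl)
    fix c assume c: "c \<in> charts_at A p"
    then have x: "c \<in> A" "snd c p \<in> snd c ` fst c" by (auto simp: charts_at_iff)
    interpret chart_geometry "snd c ` fst c" "christoffel c" "chart_metric c" by (rule geometry_in_chart[OF x(1)])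
    have "\<xi> (tangent_chart A c) = (a c, b c - christoffel c (snd c p) (a c) (v c))"
      using that by (simp add: hl(2)[OF _ c] vl(2)[OF _ c])
    moreover have "\<eta> (tangent_chart A c) = (- ((lam r / \<mu> r) *\<^sub>R b c),
        (\<mu> r / lam r) *\<^sub>R a c + (lam r / \<mu> r) *\<^sub>R christoffel c (snd c p) (b c) (v c))"
      using that by (simp add: hl(2)[OF _ c] vl(2)[OF _ c])
    ultimately show "\<eta> (tangent_chart A c) =
      coord_J (christoffel c) (\<lambda>_. \<mu> r / lam r) (snd c p, v c) (\<xi> (tangent_chart A c))"
      by (simp add: coord_J_def vertical_part_def)
  qed
  have uniq: "\<eta> = \<eta>'" if "?Q \<eta> a b" "?Q \<eta>' a' b'" for \<eta> \<eta>' a b a' b'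
    using chart[OF that(1)] chart[OF that(2)] c0
    by (intro T.tangent_eqI[OF _ _ tangent_chart_at[OF c0 v]]) auto
  have "\<exists>a b. ?Q ((\<mu> r / lam r) *\<^sub>T ?v a - (lam r / \<mu> r) *\<^sub>T ?h b) a b"
  proof -
    let ?z = "\<xi> (tangent_chart A c0)"
    \<comment> \<open>The second component of \<open>\<xi>\<close> is corrected by the Christoffel
      term to give its vertical part.\<close>
    let ?a = "tvec_of c0 p (fst ?z)" and ?b = "tvec_of c0 p (snd ?z + christoffel c0 (snd c0 p) (fst ?z) (v c0))"
    have a: "?a \<in> tangent_space A p" and b: "?b \<in> tangent_space A p" by (rule tvec_of_tangent[OF c0])+
    have "\<xi> = ?h ?a + ?v ?b"
      by (rule T.tangent_eqI[OF \<xi> T.tangent_space_add[OF hl(1)[OF a] vl(1)[OF b]] tangent_chart_at[OF c0 v]])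
        (simp add: hl(2)[OF a c0] vl(2)[OF b c0] tvec_of_self[OF c0] prod_eq_iff)
    then show ?thesis using a b by blast
  qed
  then obtain a b where ab: "?Q ((\<mu> r / lam r) *\<^sub>T ?v a - (lam r / \<mu> r) *\<^sub>T ?h b) a b" by blast
  have "weighted_J A g nabla \<mu> lam (p, v) \<xi> = (\<mu> r / lam r) *\<^sub>T ?v a - (lam r / \<mu> r) *\<^sub>T ?h b"
    unfolding weighted_J_def Let_def fst_conv r_def[symmetric]
    by (rule the_equality) (use ab uniq in blast)+
  from chart[OF ab] this
  show "weighted_J A g nabla \<mu> lam (p, v) \<xi> \<in> tangent_space (tangent_atlas A) (p, v)"
    "c \<in> charts_at A p \<Longrightarrow>
      weighted_J A g nabla \<mu> lam (p, v) \<xi> (tangent_chart A c) =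
      coord_J (christoffel c) (\<lambda>_. \<mu> r / lam r) (snd c p, v c) (\<xi> (tangent_chart A c))"
    by auto
qed

end


section \<open>Disk bundles and integrability\<close>

context riemannian_atlas
begin

definition chart_norm :: "('a, 'e) chart \<Rightarrow> 'e \<times> 'e \<Rightarrow> real" where
  "chart_norm c z = sqrt (chart_metric c (fst z) (snd z) (snd z))"

definition chart_disk :: "('a, 'e) chart \<Rightarrow> ereal \<Rightarrow> ('e \<times> 'e) set" where
  "chart_disk c \<rho> = {z. fst z \<in> snd c ` fst c \<and> ereal (chart_norm c z) < \<rho>}"

lemma g_chart:
  assumes "u \<in> tangent_space A p" "v \<in> tangent_space A p" "c \<in> charts_at A p"
  shows "g p u v = chart_metric c (snd c p) (u c) (v c)"
  using assms by (simp add: chart_metric_def charts_at_iff chart_inv_chart tvec_of_eq)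

lemma points_tangent: "(p, v) \<in> points (tangent_atlas A) \<longleftrightarrow> p \<in> points A \<and> v \<in> tangent_space A p"
  unfolding points_def tangent_atlas_def using in_tangent_chart by blast

lemma fibre_norm_chart:
  assumes "c \<in> charts_at A p" "v \<in> tangent_space A p"
  shows "fibre_norm g (p, v) = chart_norm c (snd c p, v c)"
  using g_chart[OF assms(2,2,1)] by (simp add: fibre_norm_def chart_norm_def)

lemma fibre_norm_inv:
  assumes "c \<in> A" "fst z \<in> snd c ` fst c"
  shows "fibre_norm g (chart_inv (tangent_chart A c) z) = chart_norm c z"
  using tangent_chart_inv[OF assms, of "snd z"] by (simp add: fibre_norm_def chart_norm_def chart_metric_def)

lemma chart_disk_eq:
  assumes c: "c \<in> A"
  shows "snd (tangent_chart A c) ` (fst (tangent_chart A c) \<inter> disk_bundle A g \<rho>) = chart_disk c \<rho>"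
proof -
  have "(chart_inv c x, tvec_of c (chart_inv c x) w) \<in> disk_bundle A g \<rho> \<longleftrightarrow> ereal (chart_norm c (x, w)) < \<rho>"
    if x: "x \<in> snd c ` fst c" for x w
  proof -
    have cp: "c \<in> charts_at A (chart_inv c x)" by (rule in_chart_image[OF c x])
    show ?thesis
      using fibre_norm_inv[OF c, of "(x, w)"] x tangent_chart_inv[OF c x, of w]
        chart_in_points[OF cp] tvec_of_tangent[OF cp]
      by (simp add: disk_bundle_def points_tangent)
  qed
  then show ?thesis unfolding tangent_chart_image[OF c] chart_disk_def by auto
qed

lemma open_chart_domain_times:
  assumes c: "c \<in> A" shows "open ((snd c ` fst c) \<times> (UNIV :: 'e set))"
  using open_chart_image[OF c atlas_open_domain[OF c]] by (intro open_Times) auto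

lemma smooth_on_chart_norm_sq:
  assumes c: "c \<in> A" and S: "open S" "S \<subseteq> (snd c ` fst c) \<times> UNIV"
  shows "smooth_on S (\<lambda>z. chart_metric c (fst z) (snd z) (snd z))"
  by (rule chart_geometry.smooth_on_norm_sq[OF geometry_in_chart[OF c] S])

lemma open_chart_disk:
  assumes c: "c \<in> A" shows "open (chart_disk c \<rho>)"
proof -
  let ?T = "(snd c ` fst c) \<times> (UNIV :: 'e set)"
  have "continuous_on ?T (\<lambda>z. ereal (chart_norm c z))"
    unfolding chart_norm_def
    by (intro continuous_on_ereal continuous_on_real_sqrt smooth_on_imp_continuous_on
        smooth_on_chart_norm_sq[OF c open_chart_domain_times[OF c]] order_refl)
  then have "open (?T \<inter> (\<lambda>z. ereal (chart_norm c z)) -` {..<\<rho>})"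
    by (rule continuous_open_preimage[OF _ open_chart_domain_times[OF c] open_lessThan])
  also have "?T \<inter> (\<lambda>z. ereal (chart_norm c z)) -` {..<\<rho>} = chart_disk c \<rho>"
    by (auto simp: chart_disk_def mem_Times_iff)
  finally show ?thesis .
qed

lemma atlas_open_disk_bundle: "atlas_open (tangent_atlas A) (disk_bundle A g \<rho>)"
  unfolding atlas_open_def
proof (intro conjI ballI)
  show "disk_bundle A g \<rho> \<subseteq> points (tangent_atlas A)" by (auto simp: disk_bundle_def)
  fix c' assume "c' \<in> tangent_atlas A"
  then show "open (snd c' ` (fst c' \<inter> disk_bundle A g \<rho>))"
    using chart_disk_eq open_chart_disk by (auto simp: tangent_atlas_def)
qed

definition weight :: "(real \<Rightarrow> real) \<Rightarrow> (real \<Rightarrow> real) \<Rightarrow> ('a, 'e) chart \<Rightarrow> 'e \<times> 'e \<Rightarrow> real" where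
  "weight \<mu> lam c z = \<mu> (chart_norm c z) / lam (chart_norm c z)"

text \<open>As \<open>sqrt\<close> is negative on negative arguments, this rests on positivity of
  the metric; the zero vector is separate because \<open>q_pos\<close> speaks of nonzero
  ones.\<close>

lemma chart_norm_nonneg:
  assumes "c \<in> A" "z \<in> chart_disk c \<rho>" shows "chart_norm c z \<ge> 0"
proof -
  interpret chart_geometry "snd c ` fst c" "christoffel c" "chart_metric c" by (rule geometry_in_chart[OF assms(1)])
  have "fst z \<in> snd c ` fst c" using assms(2) by (simp add: chart_disk_def)
  then show ?thesis
    using q_pos[of "fst z" "snd z"] q_simps(8)[of "fst z" 0]
    by (cases "snd z = 0") (auto simp: chart_norm_def less_imp_le)
qed

lemma weighted_chart_disk:
  assumes c: "c \<in> A" and wf: "weight_functions A g \<rho> \<mu> lam"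
  shows "weighted_chart (snd c ` fst c) (christoffel c) (chart_metric c) (chart_disk c \<rho>) (weight \<mu> lam c)"
proof (rule weighted_chart.intro[OF geometry_in_chart[OF c] weighted_chart_axioms.intro])
  let ?S = "chart_disk c \<rho>"
  show S: "open ?S" by (rule open_chart_disk[OF c])
  show "?S \<subseteq> (snd c ` fst c) \<times> UNIV" by (auto simp: chart_disk_def mem_Times_iff)
  have pos: "\<mu> (chart_norm c z) > 0" "lam (chart_norm c z) > 0" if "z \<in> ?S" for z
    using wf chart_norm_nonneg[OF c that] that by (auto simp: weight_functions_def chart_disk_def)
  \<comment> \<open>Smoothness of the weights is given on the disk bundle rather than in the radius,
    so it is transported through the chart inverse.\<close>
  have sm: "smooth_on ?S (\<lambda>z. h (chart_norm c z))"
    if h: "smooth_function (tangent_atlas A) (disk_bundle A g \<rho>) (\<lambda>u. h (fibre_norm g u))" for h :: "real \<Rightarrow> real"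
  proof (rule smooth_on_cong[OF S])
    show "smooth_on ?S ((\<lambda>u. h (fibre_norm g u)) \<circ> chart_inv (tangent_chart A c))"
      using h c unfolding smooth_function_def tangent_atlas_def chart_disk_eq[OF c, symmetric] by blast
    show "((\<lambda>u. h (fibre_norm g u)) \<circ> chart_inv (tangent_chart A c)) z = h (chart_norm c z)" if "z \<in> ?S" for z
      using that by (simp add: fibre_norm_inv[OF c] chart_disk_def)
  qed
  have "smooth_on ?S (\<lambda>z. \<mu> (chart_norm c z) * inverse (lam (chart_norm c z)))"
  proof (intro smooth_on_mult smooth_on_inverse S)
    show "smooth_on ?S (\<lambda>z. \<mu> (chart_norm c z))" "smooth_on ?S (\<lambda>z. lam (chart_norm c z))"
      using wf by (auto intro!: sm simp: weight_functions_def)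
    show "lam (chart_norm c z) \<noteq> 0" if "z \<in> ?S" for z using pos(2)[OF that] by simp
  qed
  then show "smooth_on ?S (weight \<mu> lam c)"
    by (simp add: weight_def[abs_def] divide_inverse)
  show "weight \<mu> lam c z > 0" if "z \<in> ?S" for z
    using pos[OF that] by (simp add: weight_def)
qed

lemma weighted_J_in_chart:
  assumes c: "c \<in> charts_at A p" and v: "v \<in> tangent_space A p"
    and \<xi>: "\<xi> \<in> tangent_space (tangent_atlas A) (p, v)"
  shows "weighted_J A g nabla \<mu> lam (p, v) \<xi> (tangent_chart A c) =
      coord_J (christoffel c) (weight \<mu> lam c) (snd c p, v c) (\<xi> (tangent_chart A c))"
  unfolding weighted_J_chart[OF chart_in_points[OF c] v \<xi> c]
  by (simp add: coord_J_def weight_def fibre_norm_chart[OF c v])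

section \<open>Integrability read in tangent charts\<close>

context
  fixes \<rho> \<mu> lam
  assumes wf: "weight_functions A g \<rho> \<mu> lam"
begin

abbreviation "J \<equiv> weighted_J A g nabla \<mu> lam"

abbreviation "nijenhuis_tensor c \<equiv> almost_complex_chart.nijenhuis_tensor (coord_J (christoffel c) (weight \<mu> lam c))"

lemma J_field_chart:
  assumes W: "atlas_open (tangent_atlas A) W" "W \<subseteq> disk_bundle A g \<rho>"
    and X: "smooth_field (tangent_atlas A) W X" and c: "c \<in> A" and d: "d = tangent_chart A c"
  shows "z \<in> snd d ` (fst d \<inter> W) \<Longrightarrow>
      J (chart_inv d z) (X (chart_inv d z)) d = coord_J (christoffel c) (weight \<mu> lam c) z (X (chart_inv d z) d)"
    and "z \<in> snd d ` (fst d \<inter> W) \<Longrightarrow> (\<lambda>z. J (chart_inv d z) (X (chart_inv d z)) d) differentiable (at z)"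
proof -
  let ?V = "snd d ` (fst d \<inter> W)"
  have dT: "d \<in> tangent_atlas A" using c d by (simp add: tangent_atlas_def)
  interpret WC: weighted_chart "snd c ` fst c" "christoffel c" "chart_metric c" "chart_disk c \<rho>" "weight \<mu> lam c"
    by (rule weighted_chart_disk[OF c wf])
  show eq: "J (chart_inv d z) (X (chart_inv d z)) d = coord_J (christoffel c) (weight \<mu> lam c) z (X (chart_inv d z) d)"
    if z: "z \<in> ?V" for z
  proof -
    obtain u where u: "u \<in> fst d" "u \<in> W" "z = snd d u" using z by auto
    obtain p v where pv: "u = (p, v)" by (cases u)
    have p: "p \<in> fst c" "v \<in> tangent_space A p" using u pv d by (auto simp: in_tangent_chart)
    have cp: "c \<in> charts_at A p" using c p by (simp add: charts_at_iff)
    have "X u \<in> tangent_space (tangent_atlas A) u" by (rule T.smooth_field_tangent[OF X u(2)])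
    from weighted_J_in_chart[OF cp p(2) this[unfolded pv]] show ?thesis
      using T.chart_inv_chart[OF dT u(1)] by (simp add: u(3) pv d tangent_chart_apply)
  qed
  show "(\<lambda>z. J (chart_inv d z) (X (chart_inv d z)) d) differentiable (at z)" if z: "z \<in> ?V"
  proof (rule differentiable_cong_open[OF T.open_chart_image[OF dT W(1)] z eq[symmetric]])
    have "?V \<subseteq> chart_disk c \<rho>" unfolding chart_disk_eq[OF c, symmetric] using W(2) d by auto
    then show "(\<lambda>z. coord_J (christoffel c) (weight \<mu> lam c) z (X (chart_inv d z) d)) differentiable (at z)"
      using WC.J.has_derivative_J_apply[OF _ smooth_on_has_derivative[OF T.smooth_field_chart[OF X dT] z]] z
      unfolding differentiable_def by blast
  qed
qed

lemma J_tangent: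
  assumes "u \<in> disk_bundle A g \<rho>" "\<xi> \<in> tangent_space (tangent_atlas A) u"
  shows "J u \<xi> \<in> tangent_space (tangent_atlas A) u"
proof -
  obtain p v where u: "u = (p, v)" by (cases u)
  then have "p \<in> points A" "v \<in> tangent_space A p"
    using assms(1) by (auto simp: disk_bundle_def points_tangent)
  then show ?thesis using weighted_J_tangent assms(2) unfolding u by blast
qed

text \<open>The description behind \<open>J\<close> is controlled only on tangent vectors, so the
  brackets inside \<open>nijenhuis\<close> are shown tangent before \<open>J\<close> is replaced by
  \<open>coord_J\<close>. The off-chart components vanish for the same reason.\<close>

lemma nijenhuis_in_chart:
  assumes W: "atlas_open (tangent_atlas A) W" "W \<subseteq> disk_bundle A g \<rho>"
    and X: "smooth_field (tangent_atlas A) W X" and Y: "smooth_field (tangent_atlas A) W Y" and u: "u \<in> W"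
  shows "c \<in> A \<Longrightarrow> tangent_chart A c \<in> charts_at (tangent_atlas A) u \<Longrightarrow>
      nijenhuis (tangent_atlas A) J X Y u (tangent_chart A c)
      = nijenhuis_tensor c (snd (tangent_chart A c) u) (X u (tangent_chart A c)) (Y u (tangent_chart A c))"
    and "d \<notin> charts_at (tangent_atlas A) u \<Longrightarrow> nijenhuis (tangent_atlas A) J X Y u d = 0"
proof -
  let ?TA = "tangent_atlas A"
  let ?JX = "\<lambda>q. J q (X q)" and ?JY = "\<lambda>q. J q (Y q)"
  have tan: "X q \<in> tangent_space ?TA q" "Y q \<in> tangent_space ?TA q"
    "?JX q \<in> tangent_space ?TA q" "?JY q \<in> tangent_space ?TA q" if "q \<in> W" for q
    using T.smooth_field_tangent[OF X that] T.smooth_field_tangent[OF Y that] J_tangent W(2) that by blast+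
  have diff: "(\<lambda>x. Z (chart_inv d x) d) differentiable (at (snd d u))"
    if "d \<in> charts_at ?TA u" "Z = X \<or> Z = Y \<or> Z = ?JX \<or> Z = ?JY" for d Z
  proof -
    have d: "d \<in> ?TA" "snd d u \<in> snd d ` (fst d \<inter> W)" using that(1) u by (auto simp: T.charts_at_iff)
    obtain c where c: "c \<in> A" "d = tangent_chart A c" using d(1) by (auto simp: tangent_atlas_def)
    have "(\<lambda>x. X (chart_inv d x) d) differentiable (at (snd d u))"
      "(\<lambda>x. Y (chart_inv d x) d) differentiable (at (snd d u))"
      using smooth_onD[OF T.smooth_field_chart[OF X d(1)] d(2)] smooth_onD[OF T.smooth_field_chart[OF Y d(1)] d(2)] .
    with that(2) J_field_chart(2)[OF W X c d(2)] J_field_chart(2)[OF W Y c d(2)] show ?thesis by auto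
  qed
  have lie: "lie_bracket ?TA P Q u \<in> tangent_space ?TA u"
    if "P = X \<or> P = Y \<or> P = ?JX \<or> P = ?JY" "Q = X \<or> Q = Y \<or> Q = ?JX \<or> Q = ?JY" for P Q
  proof (rule T.lie_bracket_tangent[OF W(1) u])
    show "P q \<in> tangent_space ?TA q" "Q q \<in> tangent_space ?TA q" if q: "q \<in> W" for q
      using \<open>P = X \<or> P = Y \<or> P = ?JX \<or> P = ?JY\<close> \<open>Q = X \<or> Q = Y \<or> Q = ?JX \<or> Q = ?JY\<close> tan[OF q] by auto
  qed (use that diff in blast)+
  have uD: "u \<in> disk_bundle A g \<rho>" using W(2) u by blast
  show "nijenhuis ?TA J X Y u d = 0" if "d \<notin> charts_at ?TA u"
    using that T.tangent_outside[OF J_tangent[OF uD lie[of ?JX Y]] that]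
      T.tangent_outside[OF J_tangent[OF uD lie[of X ?JY]] that]
    by (simp add: nijenhuis_def lie_bracket_def)
  fix c assume c: "c \<in> A" and d: "tangent_chart A c \<in> charts_at ?TA u"
  let ?d = "tangent_chart A c"
  let ?z = "snd ?d u" and ?V = "snd ?d ` (fst ?d \<inter> W)"
  let ?Xc = "\<lambda>z. X (chart_inv ?d z) ?d" and ?Yc = "\<lambda>z. Y (chart_inv ?d z) ?d"
  let ?Jc = "coord_J (christoffel c) (weight \<mu> lam c)"
  interpret WC: weighted_chart "snd c ` fst c" "christoffel c" "chart_metric c" "chart_disk c \<rho>" "weight \<mu> lam c"
    by (rule weighted_chart_disk[OF c wf])
  have dT: "?d \<in> ?TA" "u \<in> fst ?d" using d by (auto simp: T.charts_at_iff)
  have V: "open ?V" by (rule T.open_chart_image[OF dT(1) W(1)])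
  have zV: "?z \<in> ?V" using dT u by auto
  have "?V \<subseteq> chart_disk c \<rho>" unfolding chart_disk_eq[OF c, symmetric] using W(2) by auto
  then have zS: "?z \<in> chart_disk c \<rho>" using zV by blast
  have inv: "chart_inv ?d ?z = u" by (rule T.chart_inv_chart[OF dT])
  have JX: "fd (\<lambda>z. J (chart_inv ?d z) (X (chart_inv ?d z)) ?d) ?z = fd (\<lambda>z. ?Jc z (?Xc z)) ?z"
    by (rule frechet_derivative_cong_open[OF V zV J_field_chart(1)[OF W X c refl]])
  have JY: "fd (\<lambda>z. J (chart_inv ?d z) (Y (chart_inv ?d z)) ?d) ?z = fd (\<lambda>z. ?Jc z (?Yc z)) ?z"
    by (rule frechet_derivative_cong_open[OF V zV J_field_chart(1)[OF W Y c refl]])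
  obtain p v where pv: "u = (p, v)" by (cases u)
  have cp: "c \<in> charts_at A p" "v \<in> tangent_space A p"
    using dT(2) c by (auto simp: pv in_tangent_chart charts_at_iff)
  have Ju: "J u \<xi> ?d = ?Jc ?z (\<xi> ?d)" if "\<xi> \<in> tangent_space ?TA u" for \<xi>
    using weighted_J_in_chart[OF cp that[unfolded pv]] by (simp add: pv tangent_chart_apply)
  have "J u (lie_bracket ?TA ?JX Y u) ?d = ?Jc ?z (lie_bracket ?TA ?JX Y u ?d)"
    "J u (lie_bracket ?TA X ?JY u) ?d = ?Jc ?z (lie_bracket ?TA X ?JY u ?d)"
    by (rule Ju, rule lie, simp, simp)+
  then have "nijenhuis ?TA J X Y u ?d = lie_bracket ?TA ?JX ?JY u ?d - ?Jc ?z (lie_bracket ?TA ?JX Y u ?d)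
      - ?Jc ?z (lie_bracket ?TA X ?JY u ?d) - lie_bracket ?TA X Y u ?d"
    by (simp add: nijenhuis_def)
  also have "\<dots> = WC.J.chart_nijenhuis ?Xc ?Yc ?z"
    unfolding WC.J.chart_nijenhuis_def chart_bracket_def
    using d by (simp add: Ju tan u lie_bracket_def JX JY inv)
  also have "\<dots> = nijenhuis_tensor c ?z (X u ?d) (Y u ?d)"
    using WC.J.chart_nijenhuis_eq_nijenhuis_tensor[OF zS diff[OF d] diff[OF d], of X Y] by (simp add: inv)
  finally show "nijenhuis ?TA J X Y u ?d = nijenhuis_tensor c ?z (X u ?d) (Y u ?d)" .
qed

text \<open>By tensoriality, the constant-coefficient fields of a tangent chart already realise
  every pair of vectors at every point of the disk.\<close>

lemma integrable_iff:
  "integrable_on_open (tangent_atlas A) (disk_bundle A g \<rho>) J \<longleftrightarrow>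
    (\<forall>c\<in>A. \<forall>z\<in>chart_disk c \<rho>. \<forall>a b. nijenhuis_tensor c z a b = 0)"
proof (intro iffI ballI allI)
  fix c z a b assume int: "integrable_on_open (tangent_atlas A) (disk_bundle A g \<rho>) J"
    and c: "c \<in> A" and z: "z \<in> chart_disk c \<rho>"
  let ?d = "tangent_chart A c" and ?D = "disk_bundle A g \<rho>"
  let ?W = "fst ?d \<inter> ?D"
  have d: "?d \<in> tangent_atlas A" using c by (simp add: tangent_atlas_def)
  have W: "atlas_open (tangent_atlas A) ?W"
    by (rule T.atlas_open_Int[OF T.atlas_open_domain[OF d] atlas_open_disk_bundle])
  have X: "smooth_field (tangent_atlas A) ?W (\<lambda>q. T.tvec_of ?d q a)" for a
    by (rule T.smooth_field_subset[OF T.smooth_field_const[OF d]]) simp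
  obtain u where u: "u \<in> ?W" "z = snd ?d u" using z unfolding chart_disk_eq[OF c, symmetric] by blast
  have du: "?d \<in> charts_at (tangent_atlas A) u" using d u by (simp add: T.charts_at_iff)
  have "nijenhuis (tangent_atlas A) J (\<lambda>q. T.tvec_of ?d q a) (\<lambda>q. T.tvec_of ?d q b) u = 0"
    using int W X u(1) unfolding integrable_on_open_def by blast
  then show "nijenhuis_tensor c z a b = 0"
    using nijenhuis_in_chart(1)[OF W _ X[of a] X[of b] u(1) c du] by (simp add: T.tvec_of_self[OF du] u(2))
next
  assume 0: "\<forall>c\<in>A. \<forall>z\<in>chart_disk c \<rho>. \<forall>a b. nijenhuis_tensor c z a b = 0"
  show "integrable_on_open (tangent_atlas A) (disk_bundle A g \<rho>) J"
    unfolding integrable_on_open_def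
  proof (intro allI impI ballI, elim conjE)
    fix W X Y u
    assume W: "atlas_open (tangent_atlas A) W" "W \<subseteq> disk_bundle A g \<rho>"
      and X: "smooth_field (tangent_atlas A) W X" and Y: "smooth_field (tangent_atlas A) W Y" and u: "u \<in> W"
    show "nijenhuis (tangent_atlas A) J X Y u = 0"
    proof
      fix d show "nijenhuis (tangent_atlas A) J X Y u d = 0 d"
      proof (cases "d \<in> charts_at (tangent_atlas A) u")
        case False
        then show ?thesis using nijenhuis_in_chart(2)[OF W X Y u] by simp
      next
        case True
        then have d: "d \<in> tangent_atlas A" and du: "u \<in> fst d" by (simp_all add: T.charts_at_iff)
        obtain c where c: "c \<in> A" "d = tangent_chart A c" using d by (auto simp: tangent_atlas_def)
        have "snd d u \<in> chart_disk c \<rho>"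
          unfolding chart_disk_eq[OF c(1), symmetric] using du u W(2) c(2) by auto
        then show ?thesis
          using nijenhuis_in_chart(1)[OF W X Y u c(1)] True 0 c by simp
      qed
    qed
  qed
qed

end

section \<open>Constant sectional curvature in charts\<close>

lemma curvature_tangent:
  assumes W: "atlas_open A W" and X: "smooth_field A W X" and Y: "smooth_field A W Y" and Z: "smooth_field A W Z"
    and p: "p \<in> W"
  shows "curvature A nabla X Y Z p \<in> tangent_space A p"
proof -
  have lie: "lie_bracket A X Y p \<in> tangent_space A p"
    unfolding torsion_free[OF W X Y p, symmetric]
    by (intro tangent_space_diff nabla_tangent[OF W _ p] X Y smooth_field_tangent[OF _ p])
  show ?thesis
    unfolding curvature_def
    by (intro tangent_space_diff nabla_tangent[OF W nabla_smooth[OF W Z Y] p smooth_field_tangent[OF X p]]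
        nabla_tangent[OF W nabla_smooth[OF W Z X] p smooth_field_tangent[OF Y p]] nabla_tangent[OF W Z p lie])
qed

lemma sectional_curvature_chart:
  assumes W: "atlas_open A W" and X: "smooth_field A W X" and Y: "smooth_field A W Y"
    and p: "p \<in> W" and c: "c \<in> charts_at A p"
  shows "sectional_curvature A g nabla X Y p =
    chart_metric c (snd c p) (chart_curvature c (snd c p) (X p c) (Y p c) (Y p c)) (X p c) /
     (chart_metric c (snd c p) (X p c) (X p c) * chart_metric c (snd c p) (Y p c) (Y p c) - (chart_metric c (snd c p) (X p c) (Y p c))\<^sup>2)"
  unfolding sectional_curvature_def
  using g_chart[OF _ _ c] smooth_field_tangent[OF X p] smooth_field_tangent[OF Y p]
    curvature_tangent[OF W X Y Y p] curvature_chart[OF W X Y Y p c] by simp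

lemma constant_curvature_chart:
  assumes K: "constant_sectional_curvature A g nabla K" and c: "c \<in> A" and x: "x \<in> snd c ` fst c"
  shows "chart_curvature c x a b v = K *\<^sub>R (chart_metric c x b v *\<^sub>R a - chart_metric c x a v *\<^sub>R b)"
proof -
  interpret chart_geometry "snd c ` fst c" "christoffel c" "chart_metric c" by (rule geometry_in_chart[OF c])
  note W = atlas_open_domain[OF c] and E = smooth_field_const[OF c]
  have cp: "c \<in> charts_at A (chart_inv c x)" and px: "snd c (chart_inv c x) = x"
    by (rule in_chart_image[OF c x])+
  let ?p = "chart_inv c x"
  have p: "?p \<in> fst c" using cp by (simp add: charts_at_iff)
  have "chart_metric c x (Rm x a b b) a / (chart_metric c x a a * chart_metric c x b b - (chart_metric c x a b)\<^sup>2) = K"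
    if indep: "\<And>s t. s *\<^sub>R a + t *\<^sub>R b = 0 \<Longrightarrow> s = 0 \<and> t = 0" for a b
  proof -
    have "s = 0 \<and> t = 0" if "s *\<^sub>T tvec_of c ?p a + t *\<^sub>T tvec_of c ?p b = 0" for s t
    proof (rule indep)
      show "s *\<^sub>R a + t *\<^sub>R b = 0" using fun_cong[OF that, of c] by (simp add: tvec_of_self[OF cp])
    qed
    then have "sectional_curvature A g nabla (\<lambda>q. tvec_of c q a) (\<lambda>q. tvec_of c q b) ?p = K"
      using K W E p unfolding constant_sectional_curvature_def by blast
    then show ?thesis
      using sectional_curvature_chart[OF W E E p cp, of a b] by (simp add: px tvec_of_self[OF cp] chart_curvature_def)
  qed
  from Rm_of_sectional_independent[OF x this] show ?thesis by (simp add: chart_curvature_def)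
qed

lemma constant_curvature_of_chart:
  assumes R: "\<And>c x a b v. c \<in> A \<Longrightarrow> x \<in> snd c ` fst c \<Longrightarrow>
      chart_curvature c x a b v = K *\<^sub>R (chart_metric c x b v *\<^sub>R a - chart_metric c x a v *\<^sub>R b)"
  shows "constant_sectional_curvature A g nabla K"
  unfolding constant_sectional_curvature_def
proof (intro allI impI ballI, elim conjE)
  fix W X Y p
  assume W: "atlas_open A W" and X: "smooth_field A W X" and Y: "smooth_field A W Y" and p: "p \<in> W"
    and indep: "\<forall>a b. a *\<^sub>T X p + b *\<^sub>T Y p = 0 \<longrightarrow> a = 0 \<and> b = 0"
  have "p \<in> points A" using W p by (auto simp: atlas_open_def)
  then obtain c where c: "c \<in> charts_at A p" by (auto simp: points_def charts_at_def)
  then have cA: "c \<in> A" "snd c p \<in> snd c ` fst c" by (auto simp: charts_at_iff)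
  interpret chart_geometry "snd c ` fst c" "christoffel c" "chart_metric c" by (rule geometry_in_chart[OF cA(1)])
  let ?x = "snd c p"
  have "s = 0 \<and> t = 0" if "s *\<^sub>R X p c + t *\<^sub>R Y p c = 0" for s t
  proof -
    have "s *\<^sub>T X p + t *\<^sub>T Y p \<in> tangent_space A p"
      by (intro tangent_space_lincomb smooth_field_tangent[OF X p] smooth_field_tangent[OF Y p])
    from tangent_eq_0I[OF c this] that have "s *\<^sub>T X p + t *\<^sub>T Y p = 0" by simp
    then show ?thesis using indep by blast
  qed
  from gram_determinant_pos[OF cA(2), of "X p c" "Y p c", OF this]
  have "chart_metric c ?x (X p c) (X p c) * chart_metric c ?x (Y p c) (Y p c) - (chart_metric c ?x (X p c) (Y p c))\<^sup>2 \<noteq> 0" by simp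
  moreover have "chart_metric c ?x (chart_curvature c ?x (X p c) (Y p c) (Y p c)) (X p c)
    = K * (chart_metric c ?x (X p c) (X p c) * chart_metric c ?x (Y p c) (Y p c) - (chart_metric c ?x (X p c) (Y p c))\<^sup>2)"
    using q_sym[OF cA(2), of "Y p c" "X p c"]
    by (simp add: R[OF cA] q_simps cA(2) power2_eq_square)
  ultimately show "sectional_curvature A g nabla X Y p = K"
    unfolding sectional_curvature_chart[OF W X Y p c] by simp
qed

lemma weight_sq:
  assumes wf: "weight_functions A g \<rho> \<mu> lam" and c: "c \<in> A" and z: "z \<in> chart_disk c \<rho>"
    and law: "\<forall>r\<ge>0. ereal r < \<rho> \<longrightarrow> \<mu> r / lam r = sqrt (c\<^sub>1 + K * r\<^sup>2)"
  shows "(weight \<mu> lam c z)\<^sup>2 = c\<^sub>1 + K * chart_metric c (fst z) (snd z) (snd z)"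
proof -
  interpret WC: weighted_chart "snd c ` fst c" "christoffel c" "chart_metric c" "chart_disk c \<rho>" "weight \<mu> lam c"
    by (rule weighted_chart_disk[OF c wf])
  have nn: "chart_norm c z \<ge> 0" by (rule chart_norm_nonneg[OF c z])
  then have "(chart_norm c z)\<^sup>2 = chart_metric c (fst z) (snd z) (snd z)"
    by (simp add: chart_norm_def)
  moreover have "weight \<mu> lam c z = sqrt (c\<^sub>1 + K * (chart_norm c z)\<^sup>2)"
    using law nn z by (simp add: weight_def chart_disk_def)
  \<comment> \<open>Positivity of the weight makes the radicand positive, so that squaring removes
    the root.\<close>
  moreover have "weight \<mu> lam c z > 0" by (rule WC.F_pos[OF z])
  ultimately show ?thesis by simp
qed

lemma integrable_of_law:
  assumes wf: "weight_functions A g \<rho> \<mu> lam" and K: "constant_sectional_curvature A g nabla K"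
    and law: "\<forall>r\<ge>0. ereal r < \<rho> \<longrightarrow> \<mu> r / lam r = sqrt (c\<^sub>1 + K * r\<^sup>2)"
  shows "integrable_on_open (tangent_atlas A) (disk_bundle A g \<rho>) (weighted_J A g nabla \<mu> lam)"
  unfolding integrable_iff[OF wf]
proof (intro ballI allI)
  fix c z a b assume c: "c \<in> A" and z: "z \<in> chart_disk c \<rho>"
  interpret WC: weighted_chart "snd c ` fst c" "christoffel c" "chart_metric c" "chart_disk c \<rho>" "weight \<mu> lam c"
    by (rule weighted_chart_disk[OF c wf])
  show "WC.J.nijenhuis_tensor z a b = 0"
    by (rule WC.integrable_of_constant_curvature[OF weight_sq[OF wf c _ law] _ z])
      (use constant_curvature_chart[OF K c] in \<open>simp_all add: chart_curvature_def\<close>)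
qed

text \<open>The constants come from one ray over one point. The resulting law mentions only
  \<open>\<mu>\<close> and \<open>lam\<close>, so it can be differentiated in any other chart, where
  \<open>Rm_of_law\<close> converts it into curvature with the same \<open>K\<close>.\<close>

lemma law_of_integrable:
  assumes dim: "DIM('e) > 1" and ne: "points A \<noteq> {}" and \<rho>: "0 < \<rho>" and wf: "weight_functions A g \<rho> \<mu> lam"
    and int: "integrable_on_open (tangent_atlas A) (disk_bundle A g \<rho>) (weighted_J A g nabla \<mu> lam)"
  shows "\<exists>K. constant_sectional_curvature A g nabla K \<and>
    (\<exists>c\<^sub>1>0. \<forall>r\<ge>0. ereal r < \<rho> \<longrightarrow> \<mu> r / lam r = sqrt (c\<^sub>1 + K * r\<^sup>2))"
proof -
  note int' = int[unfolded integrable_iff[OF wf], rule_format]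
  obtain c0 x0 where c0: "c0 \<in> A" and x0: "x0 \<in> snd c0 ` fst c0" using ne by (auto simp: points_def)
  interpret WC0: weighted_chart "snd c0 ` fst c0" "christoffel c0" "chart_metric c0" "chart_disk c0 \<rho>" "weight \<mu> lam c0"
    by (rule weighted_chart_disk[OF c0 wf])
  obtain K c\<^sub>1 where c1: "c\<^sub>1 > 0" and law: "\<forall>r\<ge>0. ereal r < \<rho> \<longrightarrow> \<mu> r / lam r = sqrt (c\<^sub>1 + K * r\<^sup>2)"
    using WC0.radial_law[OF dim \<rho> x0, of "\<lambda>r. \<mu> r / lam r"] int'[OF c0]
    by (auto simp: chart_disk_def chart_norm_def weight_def)
  have "constant_sectional_curvature A g nabla K"
  proof (rule constant_curvature_of_chart)
    fix c x a b v assume c: "c \<in> A" and x: "x \<in> snd c ` fst c"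
    interpret WC: weighted_chart "snd c ` fst c" "christoffel c" "chart_metric c" "chart_disk c \<rho>" "weight \<mu> lam c"
      by (rule weighted_chart_disk[OF c wf])
    obtain R where R: "0 < ereal R" "ereal R < \<rho>" using ereal_dense2[OF \<rho>] by blast
    define n where "n = chart_norm c (x, v)"
    have n: "n \<ge> 0"
      using WC.q_pos[OF x, of v] WC.q_simps(8)[OF x, of 0]
      by (cases "v = 0") (auto simp: n_def chart_norm_def less_imp_le)
    \<comment> \<open>Scaling by \<open>t\<close> brings \<open>v\<close> into the disk of finite
      radius \<open>R\<close>; the added \<open>1\<close> covers \<open>v = 0\<close>.\<close>
    define t where "t = R / (n + 1)"
    have t: "t > 0" using R n by (simp add: t_def)
    have "chart_norm c (x, t *\<^sub>R v) = t * n"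
      using t by (simp add: chart_norm_def n_def WC.q_simps x real_sqrt_mult mult.assoc[symmetric])
    also have "\<dots> \<le> R" using R n by (simp add: t_def field_simps)
    finally have "(x, t *\<^sub>R v) \<in> chart_disk c \<rho>"
      using R x by (simp add: chart_disk_def) (meson ereal_less_eq(3) le_less_trans)
    from WC.Rm_of_law[OF weight_sq[OF wf c _ law] int'[OF c] x t this]
    show "chart_curvature c x a b v = K *\<^sub>R (chart_metric c x b v *\<^sub>R a - chart_metric c x a v *\<^sub>R b)" by (simp add: chart_curvature_def)
  qed
  then show ?thesis using c1 law by blast
qed

text \<open>The norm need not be smooth on the zero section, but the weight depends on its square,
  which is smooth, and the root is taken where the radicand is positive.\<close>

lemma weight_functions_sqrt:
  assumes pos: "\<And>r. r \<ge> 0 \<Longrightarrow> ereal r < \<rho> \<Longrightarrow> c\<^sub>1 + K * r\<^sup>2 > 0"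
  shows "weight_functions A g \<rho> (\<lambda>r. sqrt (c\<^sub>1 + K * r\<^sup>2)) (\<lambda>r. 1)"
  unfolding weight_functions_def
proof (intro conjI allI impI)
  show "smooth_function (tangent_atlas A) (disk_bundle A g \<rho>) (\<lambda>u. 1)"
    by (simp add: smooth_function_def o_def smooth_on_const)
  show "smooth_function (tangent_atlas A) (disk_bundle A g \<rho>) (\<lambda>u. sqrt (c\<^sub>1 + K * (fibre_norm g u)\<^sup>2))"
    unfolding smooth_function_def
  proof
    fix d assume "d \<in> tangent_atlas A"
    then obtain c where c: "c \<in> A" "d = tangent_chart A c" by (auto simp: tangent_atlas_def)
    let ?S = "chart_disk c \<rho>"
    have S: "open ?S" by (rule open_chart_disk[OF c(1)])
    have nsq: "chart_metric c (fst z) (snd z) (snd z) = (chart_norm c z)\<^sup>2" if "z \<in> ?S" for z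
      using chart_norm_nonneg[OF c(1) that] by (simp add: chart_norm_def)
    have "smooth_on ?S (\<lambda>z. sqrt (c\<^sub>1 + K * chart_metric c (fst z) (snd z) (snd z)))"
    proof (intro smooth_on_sqrt smooth_on_add smooth_on_mult smooth_on_const S)
      show "smooth_on ?S (\<lambda>z. chart_metric c (fst z) (snd z) (snd z))"
        by (rule smooth_on_chart_norm_sq[OF c(1) S]) (auto simp: chart_disk_def mem_Times_iff)
      fix z assume z: "z \<in> ?S"
      then show "c\<^sub>1 + K * chart_metric c (fst z) (snd z) (snd z) > 0"
        using pos[OF chart_norm_nonneg[OF c(1) z]] nsq[OF z] by (simp add: chart_disk_def)
    qed
    then have "smooth_on ?S ((\<lambda>u. sqrt (c\<^sub>1 + K * (fibre_norm g u)\<^sup>2)) \<circ> chart_inv d)"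
    proof (rule smooth_on_cong[OF S, rotated])
      fix z assume z: "z \<in> ?S"
      then have "fst z \<in> snd c ` fst c" by (simp add: chart_disk_def)
      then show "sqrt (c\<^sub>1 + K * chart_metric c (fst z) (snd z) (snd z)) = ((\<lambda>u. sqrt (c\<^sub>1 + K * (fibre_norm g u)\<^sup>2)) \<circ> chart_inv d) z"
        using nsq[OF z] by (simp add: c(2) fibre_norm_inv[OF c(1)])
    qed
    then show "smooth_on (snd d ` (fst d \<inter> disk_bundle A g \<rho>)) ((\<lambda>u. sqrt (c\<^sub>1 + K * (fibre_norm g u)\<^sup>2)) \<circ> chart_inv d)"
      using chart_disk_eq[OF c(1)] c(2) by simp
  qed
qed (use pos in auto)

text \<open>For negative \<open>K\<close>, a radius beyond \<open>r\<^sub>0\<close> would include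
  the zero of \<open>c\<^sub>1 + K * r\<^sup>2\<close>, where the law gives
  \<open>\<mu> / lam = 0\<close> against positivity. Attainment uses the weights
  \<open>sqrt (c\<^sub>1 + K * r\<^sup>2)\<close> and \<open>1\<close>.\<close>

lemma largest_radius:
  assumes K: "constant_sectional_curvature A g nabla K" and c1: "c\<^sub>1 > 0"
    and r0: "r\<^sub>0 = (if K < 0 then ereal (sqrt (- c\<^sub>1 / K)) else \<infinity>)"
  shows "r\<^sub>0 \<in> integrable_radii A g nabla K c\<^sub>1" "\<rho> \<in> integrable_radii A g nabla K c\<^sub>1 \<Longrightarrow> \<rho> \<le> r\<^sub>0"
proof -
  have pos: "c\<^sub>1 + K * r\<^sup>2 > 0" if r: "r \<ge> 0" "ereal r < r\<^sub>0" for r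
  proof (cases "K < 0")
    case True
    then have "r < sqrt (- c\<^sub>1 / K)" using r r0 by simp
    then have "r\<^sup>2 < - c\<^sub>1 / K" using r(1) by (metis real_less_rsqrt real_sqrt_less_iff abs_of_nonneg real_sqrt_abs)
    then show ?thesis using True by (simp add: field_simps)
  next
    case False
    then have "K * r\<^sup>2 \<ge> 0" by simp
    then show ?thesis using c1 by linarith
  qed
  have r0_pos: "0 < r\<^sub>0"
    using c1 by (auto simp: r0 zero_ereal_def divide_pos_neg divide_neg_neg)
  have "weight_functions A g r\<^sub>0 (\<lambda>r. sqrt (c\<^sub>1 + K * r\<^sup>2)) (\<lambda>r. 1)"
    by (rule weight_functions_sqrt[OF pos])
  moreover have "weight_law K c\<^sub>1 r\<^sub>0 (\<lambda>r. sqrt (c\<^sub>1 + K * r\<^sup>2)) (\<lambda>r. 1)"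
    by (simp add: weight_law_def)
  moreover have "integrable_on_open (tangent_atlas A) (disk_bundle A g r\<^sub>0) (weighted_J A g nabla \<mu> lam)"
    if "weight_functions A g r\<^sub>0 \<mu> lam" "weight_law K c\<^sub>1 r\<^sub>0 \<mu> lam" for \<mu> lam
    by (rule integrable_of_law[OF that(1) K that(2)[unfolded weight_law_def]])
  ultimately show "r\<^sub>0 \<in> integrable_radii A g nabla K c\<^sub>1"
    using r0_pos unfolding integrable_radii_def by blast
  show "\<rho> \<le> r\<^sub>0" if \<rho>: "\<rho> \<in> integrable_radii A g nabla K c\<^sub>1"
  proof (rule ccontr)
    assume "\<not> \<rho> \<le> r\<^sub>0"
    then have less: "r\<^sub>0 < \<rho>" by simp
    then have neg: "K < 0" using r0 by (auto split: if_splits)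
    let ?s = "sqrt (- c\<^sub>1 / K)"
    \<comment> \<open>The critical radius now lies strictly inside the range of the law, so the law
      may be evaluated there.\<close>
    have s: "?s \<ge> 0" "ereal ?s < \<rho>" using neg c1 less r0 by (auto simp: divide_nonneg_neg)
    obtain \<mu> lam where wf: "weight_functions A g \<rho> \<mu> lam" and law: "weight_law K c\<^sub>1 \<rho> \<mu> lam"
      using \<rho> unfolding integrable_radii_def by blast
    have "\<mu> ?s / lam ?s = sqrt (c\<^sub>1 + K * ?s\<^sup>2)" using law s by (simp only: weight_law_def)
    also have "?s\<^sup>2 = - c\<^sub>1 / K" using neg c1 by (simp add: divide_nonneg_neg)
    also have "c\<^sub>1 + K * (- c\<^sub>1 / K) = 0" using neg by simp
    finally have "\<mu> ?s / lam ?s = 0" by simp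
    moreover have "\<mu> ?s > 0" "lam ?s > 0" using wf s by (auto simp: weight_functions_def)
    ultimately show False by simp
  qed
qed

end

theorem theorem3p2:
  fixes A :: "('a, 'e::euclidean_space) chart set"
    and g :: "'a \<Rightarrow> ('a, 'e) tvec \<Rightarrow> ('a, 'e) tvec \<Rightarrow> real"
    and nabla :: "('a, 'e) connection"
  assumes "smooth_manifold A"
    and "points A \<noteq> {}"
    and "DIM('e) > 1"
    and "riemannian_metric A g"
    and "levi_civita A g nabla"
  shows
    "(\<forall>\<rho> \<mu> lam. 0 < \<rho> \<and> weight_functions A g \<rho> \<mu> lam \<longrightarrow>
        (integrable_on_open (tangent_atlas A) (disk_bundle A g \<rho>) (weighted_J A g nabla \<mu> lam)
         \<longleftrightarrow> (\<exists>K. constant_sectional_curvature A g nabla K \<and>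
               (\<exists>c\<^sub>1>0. \<forall>r\<ge>0. ereal r < \<rho> \<longrightarrow> \<mu> r / lam r = sqrt (c\<^sub>1 + K * r\<^sup>2)))))
     \<and>
     (\<forall>K c\<^sub>1 r\<^sub>0. constant_sectional_curvature A g nabla K \<and> c\<^sub>1 > 0 \<and>
        r\<^sub>0 = (if K < 0 then ereal (sqrt (- c\<^sub>1 / K)) else \<infinity>)
        \<longrightarrow> r\<^sub>0 \<in> integrable_radii A g nabla K c\<^sub>1 \<and>
            (\<forall>\<rho> \<in> integrable_radii A g nabla K c\<^sub>1. \<rho> \<le> r\<^sub>0))"
proof -
  interpret smooth_atlas A by (rule smooth_manifold_imp_smooth_atlas[OF assms(1)])
  interpret riemannian_atlas A g nabla by unfold_locales (rule assms(4,5))+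
  show ?thesis
  proof (intro conjI allI impI)
    fix \<rho> \<mu> lam assume "0 < \<rho> \<and> weight_functions A g \<rho> \<mu> lam"
    then show "integrable_on_open (tangent_atlas A) (disk_bundle A g \<rho>) (weighted_J A g nabla \<mu> lam)
       \<longleftrightarrow> (\<exists>K. constant_sectional_curvature A g nabla K \<and>
             (\<exists>c\<^sub>1>0. \<forall>r\<ge>0. ereal r < \<rho> \<longrightarrow> \<mu> r / lam r = sqrt (c\<^sub>1 + K * r\<^sup>2)))"
      using law_of_integrable[OF assms(3,2)] integrable_of_law by blast
  next
    fix K c\<^sub>1 r\<^sub>0
    assume "constant_sectional_curvature A g nabla K \<and> c\<^sub>1 > 0 \<and>
        r\<^sub>0 = (if K < 0 then ereal (sqrt (- c\<^sub>1 / K)) else \<infinity>)"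
    then have "constant_sectional_curvature A g nabla K" "c\<^sub>1 > 0"
        "r\<^sub>0 = (if K < 0 then ereal (sqrt (- c\<^sub>1 / K)) else \<infinity>)" by blast+
    from largest_radius[OF this]
    show "r\<^sub>0 \<in> integrable_radii A g nabla K c\<^sub>1" "\<forall>\<rho> \<in> integrable_radii A g nabla K c\<^sub>1. \<rho> \<le> r\<^sub>0"
      by blast+
  qed
qed

end
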